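(* Suppose $s,t>0$ satisfy $s+t>1$, let $p$ be the polynomial on $\mathbf R^d$ $$p(x)=\sum_{\alpha\in\mathbf N^d,\,|\alpha|\leq m}c_\alpha x^\alpha,\quad x\in\mathbf R^d,$$ with $c_\alpha\in\mathbf C$ and $m\in\mathbf N\setminus0$, and define $$u=\sum_{\alpha\in\mathbf N^d,\,|\alpha|\leq m}c_\alpha D^\alpha\delta_0\in\mathscr S'(\mathbf R^d).$$ Then $$\mathrm{WF_g}(u)=\mathrm{WF}^{t,s}(u)=\{0\}\times(\mathbf R^d\setminus0)$$ and $$\mathrm{WF_g}(p)=\mathrm{WF}^{t,s}(p)=(\mathbf R^d\setminus0)\times\{0\}.$$
   Context: Notation: $\mathbf N=\{0,1,2,\dots\}$, $D^\beta=(-i)^{|\beta|}\partial^\beta$, $\delta_0$ is the Dirac distribution at $0$, $\langle z\rangle=(1+|z|^2)^{1/2}$, $T^*\mathbf R^d\simeq\mathbf R^{2d}$, and $\setminus 0$ means that the origin (zero element) is removed. For $s,t>0$ with $s+t>1$, the (Beurling type) Gelfand--Shilov space $\Sigma_t^s(\mathbf R^d)$ consists of all $f\in C^\infty(\mathbf R^d)$ such that for every $h>0$ $$\|f\|_{\mathcal S_{t,h}^s}=\sup_{\alpha,\beta\in\mathbf N^d,\,x\in\mathbf R^d}\frac{|x^\alpha D^\beta f(x)|}{h^{|\alpha+\beta|}\alpha!^t\beta!^s}<\infty,$$ with the Fréchet topology given by these seminorms. $(\Sigma_t^s)'(\mathbf R^d)$ is its topological dual, which contains $\mathscr S'(\mathbf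 R^d)$; the action $(u,\varphi)$ is conjugate linear in $\varphi$ and consistent with the $L^2$ inner product. Short-time Fourier transform: with $T_xf(y)=f(y-x)$, $M_\xi f(y)=e^{i\langle y,\xi\rangle}f(y)$, set $V_\psi u(x,\xi)=(2\pi)^{-d/2}(u,M_\xi T_x\psi)$. Gabor wave front set: for $u\in\mathscr S'(\mathbf R^d)$ and a fixed $\varphi\in\mathscr S(\mathbf R^d)\setminus\{0\}$, a point $z_0\in T^*\mathbf R^d\setminus0$ satisfies $z_0\notin\mathrm{WF_g}(u)$ if there is an open conic set $\Gamma\subseteq T^*\mathbf R^d\setminus0$ containing $z_0$ with $\sup_{z\in\Gamma}\langle z\rangle^N|V_\varphi u(z)|<\infty$ for all $N\geq0$ (independent of $\varphi$). Wave front set $\mathrm{WF}^{t,s}$: for $u\in(\Sigma_t^s)'(\mathbf R^d)$ and a fixed $\psi\in\Sigma_t^s(\mathbf R^d)\setminus\{0\}$, $(x_0,\xi_0)\in T^*\mathbf R^d\setminus0$ satisfies $(x_0,\xi_0)\notin\mathrm{WF}^{t,s}(u)$ if there is an open set $U\subseteq T^*\mathbf R^d\setminus0$ containing $(x_0,\xi_0)$ such that $$\sup_{\lambda>0,\,(x,\xi)\in U}e^{r\lambda}|V_\psi u(\lambda^tx,\lambda^s\xi)|<\infty\quad\forall r>0.$$ The definition does not depend on the choice of $\psi$.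
   Formalization: The formal statement assumes in addition that some coefficient c_α with |α| ≤ m is nonzero; if all c_α vanish, then u = 0 and p = 0 have empty wave front sets and the claim fails. *)

theory Defs
  imports "HOL-Analysis.Analysis"
begin

section \<open>Multi-indices and derivatives\<close>

type_synonym 'n mindex = "'n \<Rightarrow> nat"

definition mi_abs :: "('n::finite) mindex \<Rightarrow> nat"
  where "mi_abs \<alpha> = (\<Sum>i\<in>UNIV. \<alpha> i)"

definition mi_fact :: "('n::finite) mindex \<Rightarrow> real"
  where "mi_fact \<alpha> = (\<Prod>i\<in>UNIV. fact (\<alpha> i))"

definition monomial :: "('n::finite) mindex \<Rightarrow> real ^ 'n \<Rightarrow> real"
  where "monomial \<alpha> x = (\<Prod>i\<in>UNIV. (x $ i) ^ \<alpha> i)"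

definition pd :: "'n::finite \<Rightarrow> (real ^ 'n \<Rightarrow> complex) \<Rightarrow> real ^ 'n \<Rightarrow> complex"
  where "pd i f x = vector_derivative (\<lambda>h. f (x + h *\<^sub>R axis i 1)) (at 0)"

text \<open>\<open>C\<^sup>\<infinity>\<close>: every iterated partial derivative, taken in any order of the variables, is
  (totally) differentiable everywhere. In particular all of them exist and are continuous.\<close>

definition smooth :: "(real ^ 'n::finite \<Rightarrow> complex) \<Rightarrow> bool"
  where "smooth f \<longleftrightarrow> (\<forall>is x. foldr pd is f differentiable (at x))"

text \<open>The index type carries no order, so \<open>\<partial>\<^sup>\<alpha>\<close> is written as
  \<open>\<partial>\<^bsub>i1\<^esub>\<^bsup>\<alpha> i1\<^esup> \<cdots> \<partial>\<^bsub>id\<^esub>\<^bsup>\<alpha> id\<^esup>\<close> for one fixed enumeration of the coordinates. It is only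
  applied to smooth functions, for which the enumeration is irrelevant.\<close>

definition coord_enum :: "'n::finite list"
  where "coord_enum = (SOME is. distinct is \<and> set is = UNIV)"

lemma coord_enum: "distinct (coord_enum :: 'n::finite list)" "set (coord_enum :: 'n list) = UNIV"
proof -
  have "\<exists>is :: 'n list. distinct is \<and> set is = UNIV"
    using finite_distinct_list[of "UNIV :: 'n set"] by auto
  from someI_ex[OF this]
  show "distinct (coord_enum :: 'n list)" "set (coord_enum :: 'n list) = UNIV"
    unfolding coord_enum_def by auto
qed

definition partial :: "('n::finite) mindex \<Rightarrow> (real ^ 'n \<Rightarrow> complex) \<Rightarrow> real ^ 'n \<Rightarrow> complex"
  where "partial \<alpha> f = foldr (\<lambda>i. pd i ^^ \<alpha> i) coord_enum f"

definition Dop :: "('n::finite) mindex \<Rightarrow> (real ^ 'n \<Rightarrow> complex) \<Rightarrow> real ^ 'n \<Rightarrow> complex"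
  where "Dop \<alpha> f x = (- \<i>) ^ mi_abs \<alpha> * partial \<alpha> f x"

section \<open>Test function spaces and their duals\<close>

definition seminorm_topology ::
    "('a \<Rightarrow> complex) set \<Rightarrow> (('a \<Rightarrow> complex) \<Rightarrow> real) set \<Rightarrow> ('a \<Rightarrow> complex) topology"
  where "seminorm_topology X P = topology_generated_by
    {{g \<in> X. q (\<lambda>x. g x - f x) < e} | q f e. q \<in> P \<and> f \<in> X \<and> e > 0}"

definition antidual ::
    "('a \<Rightarrow> complex) set \<Rightarrow> (('a \<Rightarrow> complex) \<Rightarrow> real) set \<Rightarrow> (('a \<Rightarrow> complex) \<Rightarrow> complex) set"
  where "antidual X P = {u.
    (\<forall>f\<in>X. \<forall>g\<in>X. u (\<lambda>x. f x + g x) = u f + u g) \<and>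
    (\<forall>a. \<forall>f\<in>X. u (\<lambda>x. a * f x) = cnj a * u f) \<and>
    continuous_map (seminorm_topology X P) euclidean u}"

definition schwartz_space :: "(real ^ 'n::finite \<Rightarrow> complex) set"
  where "schwartz_space = {f. smooth f \<and>
    (\<forall>\<alpha> \<beta>. bdd_above (range (\<lambda>x. cmod (of_real (monomial \<alpha> x) * Dop \<beta> f x))))}"

definition schwartz_seminorm ::
    "('n::finite) mindex \<Rightarrow> 'n mindex \<Rightarrow> (real ^ 'n \<Rightarrow> complex) \<Rightarrow> real"
  where "schwartz_seminorm \<alpha> \<beta> f = (SUP x. cmod (of_real (monomial \<alpha> x) * Dop \<beta> f x))"

definition tempered_distributions :: "((real ^ 'n::finite \<Rightarrow> complex) \<Rightarrow> complex) set"
  where "tempered_distributions =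
    antidual schwartz_space {schwartz_seminorm \<alpha> \<beta> | \<alpha> \<beta>. True}"

definition gs_quotient ::
    "real \<Rightarrow> real \<Rightarrow> real \<Rightarrow> (real ^ 'n::finite \<Rightarrow> complex)
      \<Rightarrow> 'n mindex \<times> 'n mindex \<times> (real ^ 'n) \<Rightarrow> real"
  where "gs_quotient t s h f = (\<lambda>(\<alpha>, \<beta>, x).
    cmod (of_real (monomial \<alpha> x) * Dop \<beta> f x)
      / (h ^ mi_abs (\<lambda>i. \<alpha> i + \<beta> i) * mi_fact \<alpha> powr t * mi_fact \<beta> powr s))"

definition gs_space :: "real \<Rightarrow> real \<Rightarrow> (real ^ 'n::finite \<Rightarrow> complex) set"
  where "gs_space t s = {f. smooth f \<and> (\<forall>h>0. bdd_above (range (gs_quotient t s h f)))}"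

definition gs_seminorm :: "real \<Rightarrow> real \<Rightarrow> real \<Rightarrow> (real ^ 'n::finite \<Rightarrow> complex) \<Rightarrow> real"
  where "gs_seminorm t s h f = (SUP k. gs_quotient t s h f k)"

definition gs_dual :: "real \<Rightarrow> real \<Rightarrow> ((real ^ 'n::finite \<Rightarrow> complex) \<Rightarrow> complex) set"
  where "gs_dual t s = antidual (gs_space t s) {gs_seminorm t s h | h. h > 0}"

section \<open>Distributions\<close>

text \<open>All pairings \<open>(u, \<phi>)\<close> are conjugate linear in \<open>\<phi>\<close> and extend the \<open>L\<^sup>2\<close> inner product
  \<open>\<integral> f cnj \<phi>\<close>. Hence \<open>(\<delta>\<^sub>0, \<phi>) = cnj (\<phi> 0)\<close>, and since \<open>D\<^sup>\<alpha>\<close> is formally self-adjoint for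
  this pairing, \<open>(D\<^sup>\<alpha> u, \<phi>) = (u, D\<^sup>\<alpha> \<phi>)\<close> without any sign.\<close>

definition dist_of_fun ::
    "(real ^ 'n::finite \<Rightarrow> complex) \<Rightarrow> (real ^ 'n \<Rightarrow> complex) \<Rightarrow> complex"
  where "dist_of_fun f \<phi> = (LINT x|lborel. f x * cnj (\<phi> x))"

definition dirac0 :: "(real ^ 'n::finite \<Rightarrow> complex) \<Rightarrow> complex"
  where "dirac0 \<phi> = cnj (\<phi> 0)"

definition dist_D :: "('n::finite) mindex \<Rightarrow> ((real ^ 'n \<Rightarrow> complex) \<Rightarrow> complex)
    \<Rightarrow> (real ^ 'n \<Rightarrow> complex) \<Rightarrow> complex"
  where "dist_D \<alpha> u \<phi> = u (Dop \<alpha> \<phi>)"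

section \<open>Short-time Fourier transform and wave front sets\<close>

definition translation :: "real ^ 'n::finite \<Rightarrow> (real ^ 'n \<Rightarrow> complex) \<Rightarrow> real ^ 'n \<Rightarrow> complex"
  where "translation x f y = f (y - x)"

definition modulation :: "real ^ 'n::finite \<Rightarrow> (real ^ 'n \<Rightarrow> complex) \<Rightarrow> real ^ 'n \<Rightarrow> complex"
  where "modulation \<xi> f y = exp (\<i> * of_real (y \<bullet> \<xi>)) * f y"

definition stft :: "(real ^ 'n::finite \<Rightarrow> complex) \<Rightarrow> ((real ^ 'n \<Rightarrow> complex) \<Rightarrow> complex)
    \<Rightarrow> (real ^ 'n) \<times> (real ^ 'n) \<Rightarrow> complex"
  where "stft \<psi> u = (\<lambda>(x, \<xi>).
    of_real ((2 * pi) powr (- real CARD('n) / 2)) * u (modulation \<xi> (translation x \<psi>)))"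

text \<open>Unlike \<^const>\<open>conic\<close>, this cone need not contain the origin.\<close>

definition positive_conic :: "'a::real_vector set \<Rightarrow> bool"
  where "positive_conic \<Gamma> \<longleftrightarrow> (\<forall>z\<in>\<Gamma>. \<forall>a>0. a *\<^sub>R z \<in> \<Gamma>)"

definition bracket :: "'a::real_normed_vector \<Rightarrow> real"
  where "bracket z = sqrt (1 + (norm z)\<^sup>2)"

text \<open>The first argument of both wave front sets is the window of the short-time Fourier
  transform.\<close>

definition WF_g :: "(real ^ 'n::finite \<Rightarrow> complex) \<Rightarrow> ((real ^ 'n \<Rightarrow> complex) \<Rightarrow> complex)
    \<Rightarrow> ((real ^ 'n) \<times> (real ^ 'n)) set"
  where "WF_g \<phi> u = {z0. z0 \<noteq> 0 \<and>
    \<not> (\<exists>\<Gamma>. open \<Gamma> \<and> positive_conic \<Gamma> \<and> 0 \<notin> \<Gamma> \<and> z0 \<in> \<Gamma> \<and>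
        (\<forall>N::nat. bdd_above ((\<lambda>z. bracket z ^ N * cmod (stft \<phi> u z)) ` \<Gamma>)))}"

definition WF_ts :: "real \<Rightarrow> real \<Rightarrow> (real ^ 'n::finite \<Rightarrow> complex)
    \<Rightarrow> ((real ^ 'n \<Rightarrow> complex) \<Rightarrow> complex) \<Rightarrow> ((real ^ 'n) \<times> (real ^ 'n)) set"
  where "WF_ts t s \<psi> u = {z0. z0 \<noteq> 0 \<and>
    \<not> (\<exists>U. open U \<and> 0 \<notin> U \<and> z0 \<in> U \<and>
        (\<forall>r>0. bdd_above
          ((\<lambda>(l, x, \<xi>). exp (r * l) * cmod (stft \<psi> u (l powr t *\<^sub>R x, l powr s *\<^sub>R \<xi>)))
            ` ({0<..} \<times> U))))}"

end

theory Submission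
  imports Defs "HOL-Real_Asymp.Real_Asymp"
begin

text \<open>For a window \<open>\<psi>\<close>, up to constants and unimodular factors, both short-time Fourier transforms
  are of the form
  \<open>Q a b = (\<Sum>\<alpha>. c \<alpha> * (\<Sum>\<beta>\<le>\<alpha>. (\<alpha> choose \<beta>) * a^(\<alpha> - \<beta>) * g \<beta> b))\<close>:
  for \<open>u\<close> by Leibniz' rule with \<open>(a, b) = (\<xi>, x)\<close> and \<open>g \<beta> x = cnj (D\<^sup>\<beta>\<psi> (-x))\<close>, for \<open>p\<close> by the binomial
  theorem with \<open>(a, b) = (x, \<xi>)\<close> and \<open>g \<beta>\<close> the Fourier transform of \<open>y\<^sup>\<beta> cnj \<psi>\<close>. Polynomial growth in
  \<open>a\<close> loses against the decay of \<open>g \<beta>\<close> wherever \<open>b \<noteq> 0\<close>. Near a point \<open>(a0, 0)\<close> one fixes \<open>b\<close> with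
  \<open>g 0 b \<noteq> 0\<close>, which exists for \<open>p\<close> because the Fourier transform is injective; then \<open>Q (l a) b\<close> is a
  nonzero polynomial in \<open>l\<close> for suitable \<open>a\<close> near \<open>a0\<close>, hence bounded away from \<open>0\<close> as \<open>l\<close> grows, so
  there is no decay.\<close>

section \<open>Calculus of smooth functions\<close>

text \<open>The hypothesis \<open>p_nonzero\<close> keeps the wave front sets nonempty: with all
  coefficients zero both distributions vanish. The line \<open>b = 0\<close> itself is no place to
  test for decay, since \<open>g 0\<close> may vanish there (the window may vanish at the origin). A
  fixed \<open>b\<close> is nevertheless reached from every neighbourhood of (a0, 0): it is the
  dilate of b / l or of l^(-\<tau>) b, and these tend to 0. So one choice of \<open>b\<close> serves
  cones and anisotropic dilations alike. On the decay side the two exponents have to match. Powers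
  of x on the window grow like factorials to the power t, derivatives like factorials to the power
  s. For \<open>u\<close> the decaying variable is x and the powers are used directly; for
  \<open>p\<close> it is \<xi>, and the Fourier transform trades derivatives for powers of \<xi>.
  With exponent \<tau> this means decay like exp(-c |b|^(1/\<tau>)) for every c > 0, hence exp(-c l)
  at points dilated by l^\<tau>, which is exactly the scale of \<open>WF_ts\<close>. Bounds are kept
  as sequences in the power k of a single coordinate. They survive the operations needed, and make
  Schwartz and Gelfand-Shilov windows two instances of one argument.\<close>

lemma pd_has_derivative:
  assumes "(f has_derivative f') (at x)"
  shows "pd i f x = f' (axis i 1)"
proof -
  have "((\<lambda>h. x + h *\<^sub>R axis i (1::real)) has_derivative (\<lambda>h. h *\<^sub>R axis i 1)) (at 0)"
    by (auto intro!: derivative_eq_intros)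
  moreover have "(f has_derivative f') (at (x + 0 *\<^sub>R axis i 1))"
    using assms by simp
  ultimately have "((\<lambda>h. f (x + h *\<^sub>R axis i 1)) has_derivative (\<lambda>h. f' (h *\<^sub>R axis i 1))) (at 0)"
    by (rule has_derivative_compose)
  moreover have "f' (h *\<^sub>R axis i 1) = h *\<^sub>R f' (axis i 1)" for h
    using assms by (simp add: has_derivative_bounded_linear bounded_linear.linear linear_cmul)
  ultimately have "((\<lambda>h. f (x + h *\<^sub>R axis i 1)) has_vector_derivative f' (axis i 1)) (at 0)"
    by (simp add: has_vector_derivative_def)
  then show ?thesis
    unfolding pd_def by (rule vector_derivative_at)
qed

text \<open>The derivative along a coordinate line at an arbitrary parameter, as the mean value
  inequality requires it later.\<close>

lemma has_vector_derivative_pd: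
  assumes "f differentiable at (x + h *\<^sub>R axis i 1)"
  shows "((\<lambda>h. f (x + h *\<^sub>R axis i 1)) has_vector_derivative pd i f (x + h *\<^sub>R axis i 1)) (at h)"
proof -
  obtain f' where f': "(f has_derivative f') (at (x + h *\<^sub>R axis i 1))"
    using assms by (auto simp: differentiable_def)
  have "((\<lambda>h. x + h *\<^sub>R axis i (1::real)) has_derivative (\<lambda>h. h *\<^sub>R axis i 1)) (at h)"
    by (auto intro!: derivative_eq_intros)
  then have "((\<lambda>h. f (x + h *\<^sub>R axis i 1)) has_derivative (\<lambda>h. f' (h *\<^sub>R axis i 1))) (at h)"
    by (rule has_derivative_compose) (rule f')
  moreover have "f' (h *\<^sub>R axis i 1) = h *\<^sub>R f' (axis i 1)" for h
    using f' by (simp add: has_derivative_bounded_linear bounded_linear.linear linear_cmul)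
  ultimately show ?thesis
    by (simp add: has_vector_derivative_def pd_has_derivative[OF f'])
qed

section \<open>Rules for a single partial derivative\<close>

lemma pd_add:
  assumes "f differentiable at x" "g differentiable at x"
  shows "pd i (\<lambda>x. f x + g x) x = pd i f x + pd i g x"
  using assms unfolding differentiable_def
  by (elim exE) (simp add: pd_has_derivative[OF has_derivative_add] pd_has_derivative)

lemma pd_mult:
  assumes "f differentiable at x" "g differentiable at x"
  shows "pd i (\<lambda>x. f x * g x) x = pd i f x * g x + f x * pd i g x"
  using assms unfolding differentiable_def
  by (elim exE) (simp add: pd_has_derivative[OF has_derivative_mult] pd_has_derivative)

lemma pd_const [simp]: "pd i (\<lambda>_. a) = (\<lambda>_. 0)"
  by (rule ext) (rule pd_has_derivative, simp)

lemma pd_cmult: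
  assumes "f differentiable at x"
  shows "pd i (\<lambda>x. a * f x) x = a * pd i f x"
  using pd_mult[OF differentiable_const assms] by simp

lemma differentiable_cnj:
  fixes f :: "'a::real_normed_vector \<Rightarrow> complex"
  shows "f differentiable at x \<Longrightarrow> (\<lambda>x. cnj (f x)) differentiable at x"
  by (auto simp: differentiable_def intro: bounded_linear.has_derivative[OF bounded_linear_cnj])

lemma pd_cnj:
  assumes "f differentiable at x"
  shows "pd i (\<lambda>x. cnj (f x)) x = cnj (pd i f x)"
  using assms unfolding differentiable_def
  by (elim exE)
     (simp add: pd_has_derivative[OF bounded_linear.has_derivative[OF bounded_linear_cnj]]
       pd_has_derivative)

lemma pd_translation: "pd i (translation x f) = translation x (pd i f)"
  by (auto simp: pd_def translation_def fun_eq_iff algebra_simps)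

lemma has_derivative_coordinate:
  "((\<lambda>y::real^'n::finite. complex_of_real (y $ j)) has_derivative (\<lambda>y. complex_of_real (y $ j))) (at x)"
  by (intro bounded_linear.has_derivative[OF bounded_linear_of_real]
      bounded_linear.has_derivative[OF bounded_linear_vec_nth] has_derivative_ident)

lemma pd_coordinate: "pd i (\<lambda>y. complex_of_real (y $ j)) = (\<lambda>_. if i = j then 1 else 0)"
  by (rule ext, subst pd_has_derivative[OF has_derivative_coordinate]) (simp add: axis_def)

lemma has_derivative_character:
  "((\<lambda>y. exp (\<i> * complex_of_real (y \<bullet> \<xi>))) has_derivative
     (\<lambda>v. \<i> * complex_of_real (v \<bullet> \<xi>) * exp (\<i> * complex_of_real (x \<bullet> \<xi>)))) (at x)"
proof -
  have "((\<lambda>y. \<i> * complex_of_real (y \<bullet> \<xi>)) has_derivative (\<lambda>v. \<i> * complex_of_real (v \<bullet> \<xi>))) (at x)"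
    by (intro has_derivative_mult_right bounded_linear.has_derivative[OF bounded_linear_of_real]
        has_derivative_inner_left has_derivative_ident)
  from has_derivative_compose[OF this has_field_derivative_imp_has_derivative[OF DERIV_exp]]
  show ?thesis by (simp add: mult_ac)
qed

lemma pd_character:
  "pd i (\<lambda>y. exp (\<i> * complex_of_real (y \<bullet> \<xi>)))
     = (\<lambda>y. \<i> * of_real (\<xi> $ i) * exp (\<i> * complex_of_real (y \<bullet> \<xi>)))"
  by (rule ext, subst pd_has_derivative[OF has_derivative_character])
     (simp add: inner_commute[of "axis i 1"] inner_axis)

text \<open>By induction on the list of variables every iterated derivative stays in
  \<open>P\<close>. Closure properties of smoothness thus only need a class of differentiable
  functions that is stable under one partial derivative.\<close>

lemma smooth_coinduct:
  assumes "P f" and step: "\<And>f. P f \<Longrightarrow> (\<forall>x. f differentiable at x) \<and> (\<forall>i. P (pd i f))"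
  shows "smooth f"
proof -
  have "P (foldr pd is f)" for "is"
    using assms by (induction "is") auto
  then show ?thesis
    unfolding smooth_def using step by blast
qed

lemma smooth_differentiable:
  assumes "smooth f"
  shows "f differentiable at x"
proof -
  have "foldr pd [] f differentiable at x"
    using assms unfolding smooth_def by blast
  then show ?thesis by simp
qed

lemma smooth_pd:
  assumes "smooth f"
  shows "smooth (pd i f)"
  unfolding smooth_def
proof (intro allI)
  fix "is" x
  have "foldr pd (is @ [i]) f differentiable at x"
    using assms unfolding smooth_def by blast
  then show "foldr pd is (pd i f) differentiable at x" by simp
qed

lemma smooth_pd_funpow: "smooth f \<Longrightarrow> smooth ((pd i ^^ k) f)"
  by (induction k) (auto intro: smooth_pd)

lemma smooth_foldr_pd_funpow: "smooth f \<Longrightarrow> smooth (foldr (\<lambda>i. pd i ^^ a i) is f)"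
  by (induction "is") (auto intro: smooth_pd_funpow)

lemma smooth_continuous: "smooth f \<Longrightarrow> continuous_on A f"
  by (intro continuous_at_imp_continuous_on ballI differentiable_imp_continuous_within
      smooth_differentiable)

lemma smooth_borel_measurable [measurable_dest]: "smooth f \<Longrightarrow> f \<in> borel_measurable borel"
  by (rule borel_measurable_continuous_onI[OF smooth_continuous])

lemma smooth_add:
  assumes "smooth f" "smooth g"
  shows "smooth (\<lambda>x. f x + g x)"
proof (rule smooth_coinduct[of "\<lambda>h. \<exists>f g. smooth f \<and> smooth g \<and> h = (\<lambda>x. f x + g x)"])
  fix h :: "real ^ 'a \<Rightarrow> complex"
  assume "\<exists>f g. smooth f \<and> smooth g \<and> h = (\<lambda>x. f x + g x)"
  then obtain f g where fg: "smooth f" "smooth g" and h: "h = (\<lambda>x. f x + g x)" by blast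
  have "pd i h = (\<lambda>x. pd i f x + pd i g x)" for i
    unfolding h by (rule ext) (intro pd_add smooth_differentiable fg)
  then show "(\<forall>x. h differentiable at x) \<and> (\<forall>i. \<exists>f g. smooth f \<and> smooth g \<and> pd i h = (\<lambda>x. f x + g x))"
    using smooth_differentiable[OF fg(1)] smooth_differentiable[OF fg(2)]
      smooth_pd[OF fg(1)] smooth_pd[OF fg(2)]
    unfolding h by (blast intro: differentiable_add)
qed (use assms in blast)

text \<open>Products alone are not stable under \<open>pd\<close>, because the product rule yields a
  sum of two products. This is the closure to which \<open>smooth_coinduct\<close> applies.\<close>

inductive product_sum :: "(real ^ 'n::finite \<Rightarrow> complex) \<Rightarrow> bool" where
  "smooth f \<Longrightarrow> smooth g \<Longrightarrow> product_sum (\<lambda>x. f x * g x)"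
| "product_sum f \<Longrightarrow> product_sum g \<Longrightarrow> product_sum (\<lambda>x. f x + g x)"

lemma smooth_mult:
  assumes "smooth f" "smooth g"
  shows "smooth (\<lambda>x. f x * g x)"
proof (rule smooth_coinduct[of product_sum])
  fix h :: "real ^ 'a \<Rightarrow> complex"
  assume "product_sum h"
  then show "(\<forall>x. h differentiable at x) \<and> (\<forall>i. product_sum (pd i h))"
  proof induction
    case (1 f g)
    have "pd i (\<lambda>x. f x * g x) = (\<lambda>x. pd i f x * g x + f x * pd i g x)" for i
      by (rule ext) (intro pd_mult smooth_differentiable 1)
    moreover have "product_sum (\<lambda>x. pd i f x * g x + f x * pd i g x)" for i
      by (intro product_sum.intros smooth_pd 1)
    ultimately show ?case
      using smooth_differentiable[OF 1(1)] smooth_differentiable[OF 1(2)]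
      by (simp add: differentiable_mult)
  next
    case (2 f g)
    have "pd i (\<lambda>x. f x + g x) = (\<lambda>x. pd i f x + pd i g x)" for i
      by (rule ext) (intro pd_add; use 2 in blast)
    with 2 show ?case
      by (auto intro!: product_sum.intros differentiable_add)
  qed
qed (use assms product_sum.intros in blast)

lemma smooth_const: "smooth (\<lambda>_. a)"
  by (rule smooth_coinduct[of "\<lambda>f. \<exists>a. f = (\<lambda>_. a)"]) auto

lemma smooth_cmult: "smooth f \<Longrightarrow> smooth (\<lambda>x. a * f x)"
  by (rule smooth_mult[OF smooth_const])

lemma smooth_coordinate: "smooth (\<lambda>y. complex_of_real (y $ j))"
proof (rule smooth_coinduct[of "\<lambda>f. (\<exists>a. f = (\<lambda>_. a)) \<or> f = (\<lambda>y. complex_of_real (y $ j))"])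
  fix f :: "real ^ 'a \<Rightarrow> complex"
  assume "(\<exists>a. f = (\<lambda>_. a)) \<or> f = (\<lambda>y. complex_of_real (y $ j))"
  then show "(\<forall>x. f differentiable at x) \<and>
      (\<forall>i. (\<exists>a. pd i f = (\<lambda>_. a)) \<or> pd i f = (\<lambda>y. complex_of_real (y $ j)))"
    using differentiableI[OF has_derivative_coordinate] by (auto simp: pd_coordinate)
qed simp

lemma smooth_character: "smooth (\<lambda>y. exp (\<i> * complex_of_real (y \<bullet> \<xi>)))"
proof (rule smooth_coinduct[of "\<lambda>f. \<exists>a. f = (\<lambda>y. a * exp (\<i> * complex_of_real (y \<bullet> \<xi>)))"])
  fix f :: "real ^ 'a \<Rightarrow> complex"
  assume "\<exists>a. f = (\<lambda>y. a * exp (\<i> * complex_of_real (y \<bullet> \<xi>)))"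
  then obtain a where f: "f = (\<lambda>y. a * exp (\<i> * complex_of_real (y \<bullet> \<xi>)))" ..
  have d: "(\<lambda>y. exp (\<i> * complex_of_real (y \<bullet> \<xi>))) differentiable at x" for x
    using has_derivative_character differentiable_def by blast
  have "pd i f = (\<lambda>y. (a * \<i> * of_real (\<xi> $ i)) * exp (\<i> * complex_of_real (y \<bullet> \<xi>)))" for i
    unfolding f by (rule ext, subst pd_cmult[OF d]) (simp add: pd_character)
  with d show "(\<forall>x. f differentiable at x) \<and>
      (\<forall>i. \<exists>a. pd i f = (\<lambda>y. a * exp (\<i> * complex_of_real (y \<bullet> \<xi>))))"
    by (auto simp: f)
qed (metis mult_1)

lemma smooth_cnj:
  assumes "smooth f"
  shows "smooth (\<lambda>x. cnj (f x))"
proof (rule smooth_coinduct[of "\<lambda>h. \<exists>f. smooth f \<and> h = (\<lambda>x. cnj (f x))"])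
  fix h :: "real ^ 'a \<Rightarrow> complex"
  assume "\<exists>f. smooth f \<and> h = (\<lambda>x. cnj (f x))"
  then obtain f where f: "smooth f" and h: "h = (\<lambda>x. cnj (f x))" by blast
  have "pd i h = (\<lambda>x. cnj (pd i f x))" for i
    unfolding h by (rule ext) (intro pd_cnj smooth_differentiable f)
  then show "(\<forall>x. h differentiable at x) \<and> (\<forall>i. \<exists>f. smooth f \<and> pd i h = (\<lambda>x. cnj (f x)))"
    using smooth_differentiable[OF f] smooth_pd[OF f] unfolding h
    by (blast intro: differentiable_cnj)
qed (use assms in blast)

lemma smooth_translation:
  assumes "smooth f"
  shows "smooth (translation x f)"
proof (rule smooth_coinduct[of "\<lambda>h. \<exists>f. smooth f \<and> h = translation x f"])
  fix h :: "real ^ 'a \<Rightarrow> complex"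
  assume "\<exists>f. smooth f \<and> h = translation x f"
  then obtain f where f: "smooth f" and h: "h = translation x f" by blast
  have "(f \<circ> (\<lambda>y. y - x)) differentiable at y" for y
    by (intro differentiable_chain_at smooth_differentiable[OF f]) simp
  then have "h differentiable at y" for y
    by (simp add: h o_def translation_def[abs_def])
  then show "(\<forall>x. h differentiable at x) \<and> (\<forall>i. \<exists>f. smooth f \<and> pd i h = translation x f)"
    using smooth_pd[OF f] unfolding h pd_translation by blast
qed (use assms in blast)

section \<open>Iterated partial derivatives\<close>

lemma smooth_pd_add:
  "smooth f \<Longrightarrow> smooth g \<Longrightarrow> pd i (\<lambda>x. f x + g x) = (\<lambda>x. pd i f x + pd i g x)"
  by (rule ext) (rule pd_add[OF smooth_differentiable smooth_differentiable])

lemma smooth_pd_cmult: "smooth f \<Longrightarrow> pd i (\<lambda>x. a * f x) = (\<lambda>x. a * pd i f x)"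
  by (rule ext) (rule pd_cmult[OF smooth_differentiable])

lemma smooth_pd_cnj: "smooth f \<Longrightarrow> pd i (\<lambda>x. cnj (f x)) = (\<lambda>x. cnj (pd i f x))"
  by (rule ext) (rule pd_cnj[OF smooth_differentiable])

lemma pd_funpow_add:
  "smooth f \<Longrightarrow> smooth g \<Longrightarrow>
    (pd i ^^ k) (\<lambda>x. f x + g x) = (\<lambda>x. (pd i ^^ k) f x + (pd i ^^ k) g x)"
  by (induction k) (simp_all add: smooth_pd_add smooth_pd_funpow)

lemma pd_funpow_cmult:
  "smooth f \<Longrightarrow> (pd i ^^ k) (\<lambda>x. a * f x) = (\<lambda>x. a * (pd i ^^ k) f x)"
  by (induction k) (simp_all add: smooth_pd_cmult smooth_pd_funpow)

lemma pd_funpow_cnj: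
  "smooth f \<Longrightarrow> (pd i ^^ k) (\<lambda>x. cnj (f x)) = (\<lambda>x. cnj ((pd i ^^ k) f x))"
  by (induction k) (simp_all add: smooth_pd_cnj smooth_pd_funpow)

lemma pd_funpow_translation: "(pd i ^^ k) (translation x f) = translation x ((pd i ^^ k) f)"
  by (induction k) (auto simp: pd_translation)

text \<open>Leibniz' rule with a linear factor, so only two terms survive. At \<open>k = 0\<close>
  the truncated exponent \<open>k - 1\<close> is harmless because of the factor
  \<open>of_nat k\<close>.\<close>

lemma pd_funpow_coordinate_mult:
  assumes "smooth f"
  shows "(pd i ^^ k) (\<lambda>y. of_real (y $ j) * f y)
    = (\<lambda>y. of_real (y $ j) * (pd i ^^ k) f y + (if i = j then of_nat k * (pd i ^^ (k - 1)) f y else 0))"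
proof (induction k)
  case (Suc k)
  have *: "smooth (\<lambda>y. of_real (y $ j) * (pd i ^^ k) f y)"
    by (intro smooth_mult smooth_coordinate smooth_pd_funpow assms)
  have **: "smooth (\<lambda>y. if i = j then of_nat k * (pd i ^^ (k - 1)) f y else 0)"
    by (cases "i = j") (auto intro!: smooth_cmult smooth_const smooth_pd_funpow assms)
  have "pd i (\<lambda>y. if i = j then of_nat k * (pd i ^^ (k - 1)) f y else 0) x
      = (if i = j then of_nat k * (pd i ^^ k) f x else 0)" for x
    by (cases "i = j"; cases k) (auto simp: pd_cmult[OF smooth_differentiable] smooth_pd_funpow smooth_pd assms)
  moreover have "pd i (\<lambda>y. of_real (y $ j) * (pd i ^^ k) f y) x
      = (if i = j then (pd i ^^ k) f x else 0) + of_real (x $ j) * (pd i ^^ Suc k) f x" for x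
    by (subst pd_mult) (auto simp: pd_coordinate intro!: smooth_differentiable smooth_coordinate smooth_pd_funpow assms)
  ultimately show ?case
    unfolding funpow.simps comp_apply Suc smooth_pd_add[OF * **]
    by (auto simp: fun_eq_iff algebra_simps)
qed (simp add: fun_eq_iff)

lemma foldr_pd_add:
  "smooth f \<Longrightarrow> smooth g \<Longrightarrow> foldr (\<lambda>i. pd i ^^ a i) is (\<lambda>x. f x + g x)
    = (\<lambda>x. foldr (\<lambda>i. pd i ^^ a i) is f x + foldr (\<lambda>i. pd i ^^ a i) is g x)"
  by (induction "is") (auto simp: pd_funpow_add smooth_foldr_pd_funpow)

lemma foldr_pd_cmult:
  "smooth f \<Longrightarrow> foldr (\<lambda>i. pd i ^^ a i) is (\<lambda>x. b * f x)
    = (\<lambda>x. b * foldr (\<lambda>i. pd i ^^ a i) is f x)"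
  by (induction "is") (auto simp: pd_funpow_cmult smooth_foldr_pd_funpow)

lemma Dop_add: "smooth f \<Longrightarrow> smooth g \<Longrightarrow> Dop \<beta> (\<lambda>x. f x + g x) x = Dop \<beta> f x + Dop \<beta> g x"
  by (simp add: Dop_def partial_def foldr_pd_add algebra_simps)

lemma Dop_cmult: "smooth f \<Longrightarrow> Dop \<beta> (\<lambda>x. a * f x) x = a * Dop \<beta> f x"
  by (simp add: Dop_def partial_def foldr_pd_cmult)

lemma Dop_zero [simp]: "Dop \<beta> (\<lambda>_. 0) x = 0"
  using Dop_cmult[OF smooth_const, of \<beta> 0 0] by simp

lemma Dop_0 [simp]: "Dop (\<lambda>_. 0) f = f"
proof -
  have "foldr (\<lambda>i. pd i ^^ 0) is f = f" for "is"
    by (induction "is") auto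
  then show ?thesis
    by (simp add: Dop_def partial_def mi_abs_def fun_eq_iff)
qed

text \<open>The unspecified enumeration of the coordinates meets \<open>i\<close> exactly once, and
  the power of -i has modulus 1.\<close>

lemma cmod_Dop_single: "cmod (Dop (\<lambda>j. if j = i then k else 0) f x) = cmod ((pd i ^^ k) f x)"
proof -
  have "foldr (\<lambda>j. pd j ^^ (if j = i then k else 0)) is f = (if i \<in> set is then (pd i ^^ k) f else f)"
    if "distinct is" for "is"
    using that by (induction "is") auto
  from this[of coord_enum] show ?thesis
    by (simp add: Dop_def partial_def coord_enum norm_mult norm_power)
qed

section \<open>Leibniz' rule for a character times a smooth function\<close>

lemma smooth_sum:
  "(\<And>k. k \<in> K \<Longrightarrow> smooth (f k)) \<Longrightarrow> smooth (\<lambda>x. \<Sum>k\<in>K. f k x)"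
  by (induction K rule: infinite_finite_induct) (auto intro: smooth_const smooth_add)

lemma pd_funpow_sum:
  assumes "\<And>k. k \<in> K \<Longrightarrow> smooth (f k)"
  shows "(pd i ^^ n) (\<lambda>x. \<Sum>k\<in>K. a k * f k x) = (\<lambda>x. \<Sum>k\<in>K. a k * (pd i ^^ n) (f k) x)"
  using assms
proof (induction K rule: infinite_finite_induct)
  case (insert k K)
  have "smooth (\<lambda>x. \<Sum>k\<in>K. a k * f k x)"
    by (intro smooth_sum smooth_cmult insert.prems insertI2)
  with insert show ?case
    by (simp add: pd_funpow_add smooth_cmult pd_funpow_cmult)
qed (use pd_funpow_cmult[OF smooth_const, of n i 0 0] in auto)

text \<open>Pascal's rule, summed over a whole row; it carries the induction step of Leibniz'
  rule.\<close>

lemma sum_binomial_Suc: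
  fixes F :: "nat \<Rightarrow> 'a::comm_ring_1"
  shows "(\<Sum>j\<le>Suc k. of_nat (Suc k choose j) * F j) = (\<Sum>j\<le>k. of_nat (k choose j) * (F j + F (Suc j)))"
proof -
  have "(\<Sum>j\<le>k. of_nat (k choose j) * F j) = (\<Sum>j\<le>Suc k. of_nat (k choose j) * F j)"
    by (simp add: binomial_eq_0)
  also have "\<dots> = F 0 + (\<Sum>j\<le>k. of_nat (k choose Suc j) * F (Suc j))"
    by (subst sum.atMost_Suc_shift) simp
  finally have *: "(\<Sum>j\<le>k. of_nat (k choose j) * F j)
      = F 0 + (\<Sum>j\<le>k. of_nat (k choose Suc j) * F (Suc j))" .
  show ?thesis
    by (subst sum.atMost_Suc_shift) (simp add: ring_distribs sum.distrib *)
qed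

abbreviation character :: "real ^ 'n::finite \<Rightarrow> real ^ 'n \<Rightarrow> complex"
  where "character \<xi> \<equiv> (\<lambda>y. exp (\<i> * complex_of_real (y \<bullet> \<xi>)))"

text \<open>The innermost derivative replaces \<open>g\<close> by \<open>?a * g + pd i g\<close> and
  leaves the character as an outer factor. This is why the induction runs over arbitrary
  \<open>g\<close>.\<close>

lemma pd_funpow_character_mult:
  assumes "smooth g"
  shows "(pd i ^^ k) (\<lambda>y. character \<xi> y * g y) = (\<lambda>y. character \<xi> y *
    (\<Sum>j\<le>k. of_nat (k choose j) * ((\<i> * of_real (\<xi> $ i)) ^ (k - j) * (pd i ^^ j) g y)))"
  using assms
proof (induction k arbitrary: g)
  case (Suc k)
  let ?a = "\<i> * complex_of_real (\<xi> $ i)"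
  let ?F = "\<lambda>y j. ?a ^ (Suc k - j) * (pd i ^^ j) g y"
  note g = Suc.prems
  have s: "smooth (\<lambda>y. ?a * g y + pd i g y)"
    by (intro smooth_add smooth_cmult smooth_pd g)
  have "pd i (\<lambda>y. character \<xi> y * g y) = (\<lambda>y. character \<xi> y * (?a * g y + pd i g y))"
    by (rule ext, subst pd_mult)
       (simp_all add: pd_character smooth_differentiable[OF smooth_character]
         smooth_differentiable[OF g] algebra_simps)
  then have "(pd i ^^ Suc k) (\<lambda>y. character \<xi> y * g y)
      = (pd i ^^ k) (\<lambda>y. character \<xi> y * (?a * g y + pd i g y))"
    by (simp add: funpow_swap1)
  also have "\<dots> = (\<lambda>y. character \<xi> y *
      (\<Sum>j\<le>k. of_nat (k choose j) * (?a ^ (k - j) * (pd i ^^ j) (\<lambda>y. ?a * g y + pd i g y) y)))"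
    by (rule Suc.IH[OF s])
  also have "\<dots> = (\<lambda>y. character \<xi> y * (\<Sum>j\<le>k. of_nat (k choose j) * (?F y j + ?F y (Suc j))))"
  proof (intro ext arg_cong2[where f = "(*)"] refl sum.cong)
    fix y j assume "j \<in> {..k}"
    then have "Suc k - j = Suc (k - j)" by auto
    moreover have "(pd i ^^ j) (\<lambda>y. ?a * g y + pd i g y) y = ?a * (pd i ^^ j) g y + (pd i ^^ Suc j) g y"
      by (simp only: pd_funpow_add[OF smooth_cmult[OF g] smooth_pd[OF g]] pd_funpow_cmult[OF g]
          funpow_Suc_right comp_apply)
    ultimately show "?a ^ (k - j) * (pd i ^^ j) (\<lambda>y. ?a * g y + pd i g y) y = ?F y j + ?F y (Suc j)"
      by (simp add: algebra_simps)
  qed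
  also have "\<dots> = (\<lambda>y. character \<xi> y * (\<Sum>j\<le>Suc k. of_nat (Suc k choose j) * ?F y j))"
    by (simp only: sum_binomial_Suc)
  finally show ?case .
qed simp

definition mi_binom :: "('n::finite) mindex \<Rightarrow> 'n mindex \<Rightarrow> real"
  where "mi_binom \<alpha> \<beta> = (\<Prod>i\<in>UNIV. real (\<alpha> i choose \<beta> i))"

text \<open>Leibniz' rule, one coordinate of the list at a time. Requiring \<beta> to vanish off the
  list makes it determined by its values on the list, so adjoining a coordinate \<open>i\<close> is
  the bijection from pairs (k, \<beta>) to \<open>\<beta>(i := k)\<close>.\<close>

lemma foldr_pd_character_mult:
  fixes \<alpha> :: "'n::finite mindex"
  assumes "smooth g" "distinct is"
  shows "foldr (\<lambda>i. pd i ^^ \<alpha> i) is (\<lambda>y. character \<xi> y * g y) = (\<lambda>y. character \<xi> y *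
    (\<Sum>\<beta> | (\<forall>i\<in>set is. \<beta> i \<le> \<alpha> i) \<and> (\<forall>i. i \<notin> set is \<longrightarrow> \<beta> i = 0).
      (\<Prod>i\<in>set is. of_nat (\<alpha> i choose \<beta> i) * (\<i> * of_real (\<xi> $ i)) ^ (\<alpha> i - \<beta> i))
        * foldr (\<lambda>i. pd i ^^ \<beta> i) is g y))"
  using assms(2)
proof (induction "is")
  case Nil
  have "{\<beta>. \<forall>i. \<beta> i = 0} = {\<lambda>i::'n. 0::nat}" by auto
  then show ?case by simp
next
  case (Cons i "is")
  let ?M = "\<lambda>is. {\<beta>. (\<forall>i\<in>set is. \<beta> i \<le> \<alpha> i) \<and> (\<forall>i. i \<notin> set is \<longrightarrow> \<beta> i = 0)}"
  let ?t = "\<lambda>\<beta> i. of_nat (\<alpha> i choose \<beta> i) * (\<i> * complex_of_real (\<xi> $ i)) ^ (\<alpha> i - \<beta> i)"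
  let ?d = "\<lambda>\<beta> is. foldr (\<lambda>i. pd i ^^ \<beta> i) is g"
  let ?c = "\<lambda>k. of_nat (\<alpha> i choose k) * (\<i> * complex_of_real (\<xi> $ i)) ^ (\<alpha> i - k)"
  have i: "i \<notin> set is" using Cons.prems by simp
  have s: "smooth (?d \<beta> is)" for \<beta>
    by (rule smooth_foldr_pd_funpow[OF assms(1)])
  have s': "smooth (\<lambda>y. \<Sum>\<beta>\<in>?M is. (\<Prod>i\<in>set is. ?t \<beta> i) * ?d \<beta> is y)"
    by (intro smooth_sum smooth_cmult s)
  have d: "?d \<beta> (i # is) = (pd i ^^ \<beta> i) (?d (\<beta>(i := 0)) is)" for \<beta>
  proof -
    have "?d \<beta> is = ?d (\<beta>(i := 0)) is"
      by (rule foldr_cong) (use i in auto)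
    then show ?thesis by simp
  qed
  have p: "(\<Prod>j\<in>set (i # is). ?t \<beta> j) = ?c (\<beta> i) * (\<Prod>j\<in>set is. ?t (\<beta>(i := 0)) j)" for \<beta>
  proof -
    have "(\<Prod>j\<in>set is. ?t \<beta> j) = (\<Prod>j\<in>set is. ?t (\<beta>(i := 0)) j)"
      by (rule prod.cong) (use i in auto)
    with i show ?thesis by simp
  qed
  have "foldr (\<lambda>i. pd i ^^ \<alpha> i) (i # is) (\<lambda>y. character \<xi> y * g y)
      = (pd i ^^ \<alpha> i) (\<lambda>y. character \<xi> y * (\<Sum>\<beta>\<in>?M is. (\<Prod>i\<in>set is. ?t \<beta> i) * ?d \<beta> is y))"
    using Cons by simp
  also have "\<dots> = (\<lambda>y. character \<xi> y * (\<Sum>k\<le>\<alpha> i. \<Sum>\<beta>\<in>?M is.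
      (?c k * (\<Prod>j\<in>set is. ?t \<beta> j)) * (pd i ^^ k) (?d \<beta> is) y))"
    by (subst pd_funpow_character_mult[OF s'], subst pd_funpow_sum[OF s])
       (simp add: sum_distrib_left mult_ac)
  also have "\<dots> = (\<lambda>y. character \<xi> y * (\<Sum>(k, \<beta>)\<in>{..\<alpha> i} \<times> ?M is.
      (?c k * (\<Prod>j\<in>set is. ?t \<beta> j)) * (pd i ^^ k) (?d \<beta> is) y))"
    by (simp add: sum.cartesian_product)
  also have "\<dots> = (\<lambda>y. character \<xi> y * (\<Sum>\<beta>\<in>?M (i # is). (\<Prod>j\<in>set (i # is). ?t \<beta> j) * ?d \<beta> (i # is) y))"
  proof (intro ext arg_cong2[where f = "(*)"] refl)
    fix y
    show "(\<Sum>(k, \<beta>)\<in>{..\<alpha> i} \<times> ?M is. (?c k * (\<Prod>j\<in>set is. ?t \<beta> j)) * (pd i ^^ k) (?d \<beta> is) y)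
      = (\<Sum>\<beta>\<in>?M (i # is). (\<Prod>j\<in>set (i # is). ?t \<beta> j) * ?d \<beta> (i # is) y)"
    proof (rule sum.reindex_bij_witness[where j = "\<lambda>(k, \<beta>). \<beta>(i := k)" and i = "\<lambda>\<beta>. (\<beta> i, \<beta>(i := 0))"])
      fix k\<beta> assume "k\<beta> \<in> {..\<alpha> i} \<times> ?M is"
      then obtain k \<beta> where *: "k\<beta> = (k, \<beta>)" "k \<le> \<alpha> i" "\<beta> \<in> ?M is" by blast
      with i have **: "\<beta> i = 0" by simp
      then have u: "(\<beta>(i := k))(i := 0) = \<beta>" by auto
      show "((case k\<beta> of (k, \<beta>) \<Rightarrow> \<beta>(i := k)) i, (case k\<beta> of (k, \<beta>) \<Rightarrow> \<beta>(i := k))(i := 0)) = k\<beta>"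
        using * u by simp
      show "(case k\<beta> of (k, \<beta>) \<Rightarrow> \<beta>(i := k)) \<in> ?M (i # is)"
        using * i by auto
      show "(\<Prod>j\<in>set (i # is). ?t (case k\<beta> of (k, \<beta>) \<Rightarrow> \<beta>(i := k)) j) * ?d (case k\<beta> of (k, \<beta>) \<Rightarrow> \<beta>(i := k)) (i # is) y
          = (case k\<beta> of (k, \<beta>) \<Rightarrow> (?c k * (\<Prod>j\<in>set is. ?t \<beta> j)) * (pd i ^^ k) (?d \<beta> is) y)"
        unfolding *(1) prod.case p[of "\<beta>(i := k)"] d[of "\<beta>(i := k)"] u by simp
    qed (use i in \<open>auto simp: Let_def\<close>)
  qed
  finally show ?case .
qed

text \<open>The normalisation of D absorbs the factors i produced by the character: (-i)^a (i
  z)^(a-b) = z^(a-b) (-i)^b. What is left over turns the derivative of \<open>g\<close> into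
  \<open>Dop \<beta> g\<close>, and the coefficients become real.\<close>

lemma Dop_character_mult:
  assumes "smooth g"
  shows "Dop \<alpha> (\<lambda>y. character \<xi> y * g y) x
    = character \<xi> x * (\<Sum>\<beta>\<in>{..\<alpha>}. of_real (mi_binom \<alpha> \<beta> * monomial (\<alpha> - \<beta>) \<xi>) * Dop \<beta> g x)"
proof -
  have "(- \<i>) ^ mi_abs \<alpha> * (\<Prod>i\<in>UNIV. of_nat (\<alpha> i choose \<beta> i) * (\<i> * of_real (\<xi> $ i)) ^ (\<alpha> i - \<beta> i))
      = of_real (mi_binom \<alpha> \<beta> * monomial (\<alpha> - \<beta>) \<xi>) * (- \<i>) ^ mi_abs \<beta>" if "\<beta> \<le> \<alpha>" for \<beta>
  proof -
    have *: "(- \<i>) ^ a * (\<i> * z) ^ (a - b) = z ^ (a - b) * (- \<i>) ^ b" if "b \<le> a" for a b :: nat and z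
    proof -
      have "(- \<i>) ^ a = (- \<i>) ^ (a - b) * (- \<i>) ^ b" using that by (simp flip: power_add)
      moreover have "(- \<i>) ^ (a - b) * (\<i> * z) ^ (a - b) = z ^ (a - b)"
        by (simp flip: power_mult_distrib)
      ultimately show ?thesis by (simp add: mult_ac)
    qed
    have "(- \<i>) ^ mi_abs \<alpha> * (\<Prod>i\<in>UNIV. of_nat (\<alpha> i choose \<beta> i) * (\<i> * of_real (\<xi> $ i)) ^ (\<alpha> i - \<beta> i))
      = (\<Prod>i\<in>UNIV. of_nat (\<alpha> i choose \<beta> i) * ((- \<i>) ^ \<alpha> i * (\<i> * of_real (\<xi> $ i)) ^ (\<alpha> i - \<beta> i)))"
      by (simp add: mi_abs_def power_sum prod.distrib mult_ac)
    also have "\<dots> = (\<Prod>i\<in>UNIV. of_nat (\<alpha> i choose \<beta> i) * (of_real (\<xi> $ i) ^ (\<alpha> i - \<beta> i) * (- \<i>) ^ \<beta> i))"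
      using that by (intro prod.cong refl arg_cong2[where f = "(*)"] *) (auto simp: le_fun_def)
    also have "\<dots> = of_real (mi_binom \<alpha> \<beta> * monomial (\<alpha> - \<beta>) \<xi>) * (- \<i>) ^ mi_abs \<beta>"
      by (simp add: mi_abs_def mi_binom_def monomial_def power_sum prod.distrib mult_ac)
    finally show ?thesis .
  qed
  note coeff = this
  have M: "{\<beta>. (\<forall>i\<in>UNIV. \<beta> i \<le> \<alpha> i) \<and> (\<forall>i. i \<notin> UNIV \<longrightarrow> \<beta> i = 0)} = {..\<alpha>}"
    by (auto simp: le_fun_def)
  show ?thesis
    unfolding Dop_def partial_def foldr_pd_character_mult[OF assms coord_enum(1)] coord_enum(2) M
      mult.left_commute[of _ "character \<xi> x"] sum_distrib_left
    by (rule sum.cong[OF refl], rule arg_cong[where f = "(*) (character \<xi> x)"])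
       (simp only: mult.assoc[symmetric] coeff atMost_iff)
qed

section \<open>Integration on Euclidean space\<close>

text \<open>A product over the coordinates rather than a power of the norm: its reciprocal
  integrates one variable at a time, and it expands into monomials, which the seminorms
  control.\<close>

definition weight :: "real ^ 'n::finite \<Rightarrow> real"
  where "weight y = (\<Prod>i\<in>UNIV. 1 + (y $ i)\<^sup>2)"

lemma weight_ge_1: "weight y \<ge> 1"
  unfolding weight_def by (rule prod_ge_1) simp

lemma weight_pos: "weight y > 0"
  using weight_ge_1[of y] by linarith

text \<open>Expanding the product picks 1 or the square from each factor; \<open>B\<close> records
  the coordinates at which the square is picked.\<close>

lemma weight_eq_sum_monomial: "weight y = (\<Sum>B\<in>UNIV. monomial (\<lambda>i. if i \<in> B then 2 else 0) y)"
proof -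
  have "weight y = (\<Prod>i\<in>UNIV. (y $ i)\<^sup>2 + 1)"
    by (simp add: weight_def add.commute)
  also have "\<dots> = (\<Sum>B\<in>Pow UNIV. (\<Prod>i\<in>B. (y $ i)\<^sup>2) * (\<Prod>i\<in>UNIV - B. 1))"
    by (rule prod_add) simp
  also have "\<dots> = (\<Sum>B\<in>UNIV. monomial (\<lambda>i. if i \<in> B then 2 else 0) y)"
  proof (rule sum.cong)
    fix B :: "'a set"
    have "monomial (\<lambda>i. if i \<in> B then 2 else 0) y = (\<Prod>i\<in>UNIV. if i \<in> B then (y $ i)\<^sup>2 else 1)"
      unfolding monomial_def by (rule prod.cong) auto
    then show "(\<Prod>i\<in>B. (y $ i)\<^sup>2) * (\<Prod>i\<in>UNIV - B. 1) = monomial (\<lambda>i. if i \<in> B then 2 else 0) y"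
      by (simp add: prod.If_cases)
  qed simp
  finally show ?thesis .
qed

lemma continuous_monomial: "continuous_on A (\<lambda>y. monomial \<alpha> y)"
  unfolding monomial_def by (intro continuous_intros)

lemma borel_measurable_monomial [measurable]: "(\<lambda>y. monomial \<alpha> y) \<in> borel_measurable borel"
  by (rule borel_measurable_continuous_onI[OF continuous_monomial])

lemma borel_measurable_weight [measurable]: "weight \<in> borel_measurable borel"
proof -
  have "continuous_on UNIV (weight :: real^'a \<Rightarrow> real)"
    unfolding weight_def[abs_def] by (intro continuous_intros)
  then show ?thesis by (rule borel_measurable_continuous_onI)
qed

lemma nn_integral_inverse_1_plus_square: "(\<integral>\<^sup>+x. ennreal (1 / (1 + x\<^sup>2)) \<partial>lborel) < \<infinity>"
proof -
  let ?f = "\<lambda>x::real. ennreal (1 / (1 + x\<^sup>2))"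
  have [measurable]: "(\<lambda>x::real. 1 / (1 + x\<^sup>2)) \<in> borel_measurable borel" by measurable
  have half: "(\<integral>\<^sup>+x. ?f x * indicator {0..} x \<partial>lborel) = ennreal (pi / 2 - arctan 0)"
    by (rule nn_integral_FTC_atLeast)
       (auto intro!: derivative_eq_intros tendsto_arctan_at_top simp: field_simps power2_eq_square)
  have "(\<integral>\<^sup>+x. ?f x * indicator {0..} (- x) \<partial>lborel) = (\<integral>\<^sup>+x. ?f x * indicator {0..} x \<partial>lborel)"
    by (subst (2) nn_integral_real_affine[where c = "-1" and t = 0]) auto
  \<comment> \<open>The origin is counted in both halves, hence an inequality.\<close>
  moreover have "(\<integral>\<^sup>+x. ?f x \<partial>lborel) \<le> (\<integral>\<^sup>+x. ?f x * indicator {0..} x + ?f x * indicator {0..} (- x) \<partial>lborel)"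
    by (rule nn_integral_mono) (auto simp: indicator_def)
  ultimately have "(\<integral>\<^sup>+x. ?f x \<partial>lborel) \<le> ennreal (pi / 2) + ennreal (pi / 2)"
    using half by (subst (asm) nn_integral_add) auto
  then show ?thesis
    by (auto simp: less_top[symmetric] top_unique)
qed

lemma integrable_inverse_weight: "integrable lborel (\<lambda>y::real^'n::finite. 1 / weight y)"
proof (rule integrableI_nonneg)
  have "(\<integral>\<^sup>+y. ennreal (1 / weight (y::real^'n)) \<partial>lborel)
      = (\<integral>\<^sup>+y. (\<Prod>b\<in>Basis. ennreal (1 / (1 + ((y::real^'n) \<bullet> b)\<^sup>2))) \<partial>lborel)"
  proof (rule nn_integral_cong)
    fix y :: "real^'n"
    have "inj (\<lambda>i::'n. axis i (1::real))" by (auto simp: inj_def axis_eq_axis)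
    then have "(\<Prod>b\<in>Basis. 1 / (1 + (y \<bullet> b)\<^sup>2)) = (\<Prod>i\<in>UNIV. 1 / (1 + (y \<bullet> axis i 1)\<^sup>2))"
      by (simp add: Basis_vec_def UNION_singleton_eq_range prod.reindex)
    then have "1 / weight y = (\<Prod>b\<in>Basis. 1 / (1 + (y \<bullet> b)\<^sup>2))"
      by (simp add: weight_def inner_axis prod_dividef)
    then show "ennreal (1 / weight y) = (\<Prod>b\<in>Basis. ennreal (1 / (1 + (y \<bullet> b)\<^sup>2)))"
      by (simp add: prod_ennreal)
  qed
  also have "\<dots> = (\<Prod>b\<in>(Basis::(real^'n) set). (\<integral>\<^sup>+x. ennreal (1 / (1 + x\<^sup>2)) \<partial>lborel))"
    by (rule nn_integral_lborel_prod) auto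
  also have "\<dots> < \<infinity>"
    using nn_integral_inverse_1_plus_square
    by (simp add: less_top[symmetric] power_eq_top_ennreal)
  finally show "(\<integral>\<^sup>+y. ennreal (1 / weight (y::real^'n)) \<partial>lborel) < \<infinity>" .
qed (auto simp: weight_pos less_imp_le)

lemma lborel_integral_affine:
  fixes f :: "'a::euclidean_space \<Rightarrow> complex"
  assumes [measurable]: "f \<in> borel_measurable borel" and c: "c \<noteq> 0"
  shows "(LINT y|lborel. f y) = \<bar>c\<bar> ^ DIM('a) *\<^sub>R (LINT y|lborel. f (t + c *\<^sub>R y))"
  by (subst lborel_affine[OF c, of t], subst integral_density)
     (simp_all add: integral_distr)

lemma lborel_integral_translation:
  fixes f :: "'a::euclidean_space \<Rightarrow> complex"
  assumes "f \<in> borel_measurable borel"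
  shows "(LINT y|lborel. f (y + t)) = (LINT y|lborel. f y)"
  using lborel_integral_affine[OF assms, of 1 t] by (simp add: add.commute)

lemma lborel_integrable_translation:
  fixes f :: "'a::euclidean_space \<Rightarrow> complex"
  assumes "integrable lborel f"
  shows "integrable lborel (\<lambda>y. f (y + t))"
proof -
  have [measurable]: "f \<in> borel_measurable borel"
    using assms by simp
  have "integrable (distr lborel borel ((+) t)) f"
    using assms by (simp add: lborel_distr_plus)
  then show ?thesis
    by (simp add: integrable_distr_eq add.commute)
qed

lemma weight_dominated:
  fixes f :: "real ^ 'n::finite \<Rightarrow> complex"
  assumes [measurable]: "f \<in> borel_measurable borel" and K: "\<And>y. cmod (f y) * weight y \<le> K"
  shows "integrable lborel f"
    and "cmod (LINT y|lborel. f y) \<le> K * (LINT y::real^'n|lborel. 1 / weight y)"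
proof -
  have i: "integrable lborel (\<lambda>y::real^'n. K * (1 / weight y))"
    using integrable_inverse_weight by (rule integrable_mult_right)
  have le: "cmod (f y) \<le> K * (1 / weight y)" for y
    using K[of y] weight_pos[of y] by (simp add: field_simps)
  show f: "integrable lborel f"
  proof (rule Bochner_Integration.integrable_bound[OF i])
    have "cmod (f y) \<le> norm (K * (1 / weight y))" for y
      using order_trans[OF le abs_ge_self] by simp
    then show "AE y in lborel. cmod (f y) \<le> norm (K * (1 / weight y))" by blast
  qed simp
  have "cmod (LINT y|lborel. f y) \<le> (LINT y|lborel. cmod (f y))"
    by (rule integral_norm_bound)
  also have "\<dots> \<le> (LINT y::real^'n|lborel. K * (1 / weight y))"
    by (rule integral_mono[OF integrable_norm[OF f] i le])
  finally show "cmod (LINT y|lborel. f y) \<le> K * (LINT y::real^'n|lborel. 1 / weight y)"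
    by (simp only: integral_mult_right_zero)
qed

text \<open>Only the factor of coordinate \<open>j\<close> changes. The estimate moves a bound at an
  intermediate point of a mean value inequality back to \<open>y\<close>.\<close>

lemma weight_shift_axis:
  assumes "0 \<le> \<theta>" "\<theta> \<le> 1"
  shows "weight y \<le> 3 * weight (y + \<theta> *\<^sub>R axis j 1)"
proof -
  have split: "weight z = (1 + (z $ j)\<^sup>2) * (\<Prod>i\<in>UNIV - {j}. 1 + (z $ i)\<^sup>2)" for z :: "real^'a"
    unfolding weight_def by (rule prod.remove) auto
  have "(\<Prod>i\<in>UNIV - {j}. 1 + ((y + \<theta> *\<^sub>R axis j 1) $ i)\<^sup>2) = (\<Prod>i\<in>UNIV - {j}. 1 + (y $ i)\<^sup>2)"
    by (rule prod.cong) (auto simp: axis_def)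
  moreover have "1 + (y $ j)\<^sup>2 \<le> 3 * (1 + (y $ j + \<theta>)\<^sup>2)"
  proof -
    have "\<theta>\<^sup>2 \<le> 1" using assms by (simp add: power_le_one)
    \<comment> \<open>Completing the square; with the constant 3 the remainder 2 - 3/2 \<theta>^2 is
      at least 1/2 for 0 \<le> \<theta> \<le> 1.\<close>
    moreover have "3 * (1 + (y $ j + \<theta>)\<^sup>2) - (1 + (y $ j)\<^sup>2)
        = 2 * (y $ j + 3 / 2 * \<theta>)\<^sup>2 + (2 - 3 / 2 * \<theta>\<^sup>2)"
      by (simp add: power2_eq_square algebra_simps)
    ultimately show ?thesis
      using zero_le_power2[of "y $ j + 3 / 2 * \<theta>"] by linarith
  qed
  moreover have "0 \<le> (\<Prod>i\<in>UNIV - {j}. 1 + (y $ i)\<^sup>2)" by (intro prod_nonneg) simp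
  ultimately show ?thesis
    unfolding split[of y] split[of "y + \<theta> *\<^sub>R axis j 1"]
    by (simp add: axis_def mult_right_mono mult.assoc[symmetric])
qed

text \<open>Difference quotients have integral \<open>0\<close> by translation invariance, and the mean value
  inequality lets dominated convergence apply to them; this replaces Fubini and the
  one-dimensional fundamental theorem of calculus.\<close>

lemma integral_pd_eq_0:
  fixes F :: "real ^ 'n::finite \<Rightarrow> complex"
  assumes F: "smooth F" "integrable lborel F" and K: "\<And>y. cmod (pd j F y) * weight y \<le> K"
  shows "(LINT y|lborel. pd j F y) = 0"
proof -
  define h where "h n = 1 / (real n + 1)" for n
  have h: "0 < h n" "h n \<le> 1" for n by (auto simp: h_def)
  have h0: "h \<longlonglongrightarrow> 0"
    unfolding h_def using LIMSEQ_Suc[OF lim_1_over_n] by (simp add: add.commute)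
  define D where "D n y = (F (y + h n *\<^sub>R axis j 1) - F y) /\<^sub>R h n" for n y
  have [measurable]: "F \<in> borel_measurable borel" "pd j F \<in> borel_measurable borel"
    using F(1) by (auto intro: smooth_borel_measurable smooth_pd)
  have D0: "(LINT y|lborel. D n y) = 0" for n
    unfolding D_def using lborel_integrable_translation[OF F(2)] F(2)
    by (simp add: Bochner_Integration.integral_diff lborel_integral_translation)
  have bound: "cmod (D n y) \<le> 3 * K * (1 / weight y)" for n y
  proof -
    let ?\<phi> = "\<lambda>\<theta>. F (y + \<theta> *\<^sub>R axis j 1)"
    have d: "(?\<phi> has_derivative (\<lambda>v. v *\<^sub>R pd j F (y + \<theta> *\<^sub>R axis j 1))) (at \<theta>)" for \<theta>
      using has_vector_derivative_pd[OF smooth_differentiable[OF F(1)]]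
      by (simp add: has_vector_derivative_def)
    have "continuous_on {0..h n} ?\<phi>"
      using d by (meson continuous_at_imp_continuous_on has_derivative_continuous)
    then obtain \<theta> where \<theta>: "\<theta> \<in> {0<..<h n}"
      "norm (?\<phi> (h n) - ?\<phi> 0) \<le> norm ((h n - 0) *\<^sub>R pd j F (y + \<theta> *\<^sub>R axis j 1))"
      using mvt_general[of 0 "h n" ?\<phi> "\<lambda>\<theta> v. v *\<^sub>R pd j F (y + \<theta> *\<^sub>R axis j 1)"] d h(1) by blast
    from \<theta>(2) have "cmod (D n y) \<le> cmod (pd j F (y + \<theta> *\<^sub>R axis j 1))"
      using h(1)[of n] by (simp add: D_def divide_simps mult.commute)
    \<comment> \<open>\<open>K\<close> bounds the derivative at the intermediate point. The factor 3
      is the price for a majorant in \<open>y\<close> that does not depend on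
      \<open>n\<close>.\<close>
    also have "\<dots> * weight y \<le> cmod (pd j F (y + \<theta> *\<^sub>R axis j 1)) * (3 * weight (y + \<theta> *\<^sub>R axis j 1))"
      using \<theta>(1) h(2)[of n] by (intro mult_left_mono weight_shift_axis) auto
    also have "\<dots> \<le> 3 * K"
      using K[of "y + \<theta> *\<^sub>R axis j 1"] by simp
    finally show ?thesis
      using weight_pos[of y] by (simp add: field_simps)
  qed
  have lim: "(\<lambda>n. D n y) \<longlonglongrightarrow> pd j F y" for y
  proof -
    have "((\<lambda>\<theta>. F (y + \<theta> *\<^sub>R axis j 1)) has_vector_derivative pd j F y) (at 0)"
      using has_vector_derivative_pd[OF smooth_differentiable[OF F(1)], where x = y and h = 0 and i = j]
      by simp
    then have "((\<lambda>\<theta>. norm (F (y + \<theta> *\<^sub>R axis j 1) - F y - \<theta> *\<^sub>R pd j F y) / norm \<theta>) \<longlongrightarrow> 0) (at 0)"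
      by (simp add: has_vector_derivative_def has_derivative_at)
    then have "((\<lambda>\<theta>. norm ((F (y + \<theta> *\<^sub>R axis j 1) - F y) /\<^sub>R \<theta> - pd j F y)) \<longlongrightarrow> 0) (at 0)"
    proof (rule Lim_transform_eventually)
      have eq: "norm (F (y + \<theta> *\<^sub>R axis j 1) - F y - \<theta> *\<^sub>R pd j F y) / norm \<theta>
          = norm ((F (y + \<theta> *\<^sub>R axis j 1) - F y) /\<^sub>R \<theta> - pd j F y)" if "\<theta> \<noteq> 0" for \<theta> :: real
      proof -
        have "(F (y + \<theta> *\<^sub>R axis j 1) - F y) /\<^sub>R \<theta> - pd j F y
            = (F (y + \<theta> *\<^sub>R axis j 1) - F y - \<theta> *\<^sub>R pd j F y) /\<^sub>R \<theta>"
          using that by (simp add: scaleR_diff_right)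
        then show ?thesis by (simp add: divide_inverse_commute)
      qed
      show "\<forall>\<^sub>F \<theta> in at 0. norm (F (y + \<theta> *\<^sub>R axis j 1) - F y - \<theta> *\<^sub>R pd j F y) / norm \<theta>
          = norm ((F (y + \<theta> *\<^sub>R axis j 1) - F y) /\<^sub>R \<theta> - pd j F y)"
        by (rule eventually_mono[OF eventually_neq_at_within eq])
    qed
    then have "((\<lambda>\<theta>. (F (y + \<theta> *\<^sub>R axis j 1) - F y) /\<^sub>R \<theta>) \<longlongrightarrow> pd j F y) (at 0)"
      by (rule LIM_zero_cancel[OF tendsto_norm_zero_cancel])
    moreover have "filterlim h (at 0) sequentially"
      using h0 h(1) by (auto simp: filterlim_at less_imp_neq[symmetric])
    ultimately show ?thesis
      unfolding D_def by (rule filterlim_compose)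
  qed
  have "(\<lambda>n. LINT y|lborel. D n y) \<longlonglongrightarrow> (LINT y|lborel. pd j F y)"
  proof (rule integral_dominated_convergence)
    show "integrable lborel (\<lambda>y::real^'n. 3 * K * (1 / weight y))"
      using integrable_inverse_weight by (rule integrable_mult_right)
    show "D n \<in> borel_measurable lborel" for n
      unfolding D_def[abs_def] by measurable
  qed (use bound lim in auto)
  then show ?thesis
    by (simp add: D0 LIMSEQ_const_iff)
qed

section \<open>The Fourier transform\<close>

definition fourier :: "(real ^ 'n::finite \<Rightarrow> complex) \<Rightarrow> real ^ 'n \<Rightarrow> complex"
  where "fourier f \<xi> = (LINT y|lborel. character (- \<xi>) y * f y)"

lemma cmod_character [simp]: "cmod (character \<xi> y) = 1"
  by (simp add: norm_exp_eq_Re)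

lemma borel_measurable_character [measurable]: "character \<xi> \<in> borel_measurable borel"
  by (rule smooth_borel_measurable[OF smooth_character])

lemma fourier_bound:
  fixes f :: "real ^ 'n::finite \<Rightarrow> complex"
  assumes "smooth f" "\<And>y. cmod (f y) * weight y \<le> K"
  shows "cmod (fourier f \<xi>) \<le> K * (LINT y::real^'n|lborel. 1 / weight y)"
  unfolding fourier_def
  by (rule weight_dominated)
     (use assms smooth_borel_measurable[OF assms(1)] in \<open>auto simp: norm_mult\<close>)

text \<open>Integration by parts: the derivative of the character times \<open>f\<close> has
  integral 0, and the product rule splits it into the two sides. The bound \<open>K\<close> on
  \<open>f\<close> itself enters because differentiating the character leaves \<xi>_j times
  \<open>f\<close>.\<close>

lemma fourier_pd:
  fixes f :: "real ^ 'n::finite \<Rightarrow> complex"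
  assumes f: "smooth f" and K: "\<And>y. cmod (f y) * weight y \<le> K" and L: "\<And>y. cmod (pd j f y) * weight y \<le> L"
  shows "fourier (pd j f) \<xi> = \<i> * of_real (\<xi> $ j) * fourier f \<xi>"
proof -
  let ?F = "\<lambda>y. character (- \<xi>) y * f y"
  have [measurable]: "f \<in> borel_measurable borel" "pd j f \<in> borel_measurable borel"
    using f by (auto intro: smooth_borel_measurable smooth_pd)
  have i: "integrable lborel ?F" "integrable lborel (\<lambda>y. character (- \<xi>) y * pd j f y)"
    using weight_dominated(1)[of ?F K] weight_dominated(1)[of "\<lambda>y. character (- \<xi>) y * pd j f y" L] K L
    by (auto simp: norm_mult)
  have pdF: "pd j ?F = (\<lambda>y. character (- \<xi>) y * pd j f y - \<i> * of_real (\<xi> $ j) * ?F y)"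
    by (rule ext, subst pd_mult[OF smooth_differentiable[OF smooth_character] smooth_differentiable[OF f]],
        subst pd_character) (simp add: algebra_simps)
  have "cmod (pd j ?F y) * weight y \<le> L + \<bar>\<xi> $ j\<bar> * K" for y
  proof -
    have "cmod (pd j ?F y) \<le> cmod (pd j f y) + \<bar>\<xi> $ j\<bar> * cmod (f y)"
      unfolding pdF by (rule order_trans[OF norm_triangle_ineq4]) (simp add: norm_mult)
    then have "cmod (pd j ?F y) * weight y \<le> (cmod (pd j f y) + \<bar>\<xi> $ j\<bar> * cmod (f y)) * weight y"
      using weight_pos[of y] by (intro mult_right_mono) auto
    also have "\<dots> = cmod (pd j f y) * weight y + \<bar>\<xi> $ j\<bar> * (cmod (f y) * weight y)"
      by (simp add: algebra_simps)
    also have "\<dots> \<le> L + \<bar>\<xi> $ j\<bar> * K"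
      using K L by (intro add_mono mult_left_mono) auto
    finally show ?thesis .
  qed
  then have "(LINT y|lborel. pd j ?F y) = 0"
    by (rule integral_pd_eq_0[OF smooth_mult[OF smooth_character f] i(1)])
  then show ?thesis
    unfolding pdF fourier_def using i by simp
qed

section \<open>Test function spaces and continuity of functionals\<close>

lemma monomial_0 [simp]: "monomial (\<lambda>_. 0) x = 1"
  by (simp add: monomial_def)

lemma monomial_add: "monomial (\<lambda>i. \<alpha> i + \<beta> i) x = monomial \<alpha> x * monomial \<beta> x"
  by (simp add: monomial_def power_add prod.distrib)

lemma monomial_single: "monomial (\<lambda>j. if j = i then k else 0) x = (x $ i) ^ k"
proof -
  have "monomial (\<lambda>j. if j = i then k else 0) x = (\<Prod>j\<in>UNIV. if j = i then (x $ j) ^ k else 1)"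
    unfolding monomial_def by (rule prod.cong) auto
  then show ?thesis by simp
qed

lemma mi_fact_pos: "mi_fact \<alpha> > 0"
  by (auto simp: mi_fact_def intro: prod_pos)

lemma mi_fact_0 [simp]: "mi_fact (\<lambda>_. 0) = 1"
  by (simp add: mi_fact_def)

lemma mi_fact_single: "mi_fact (\<lambda>j. if j = i then k else 0) = fact k"
proof -
  have "mi_fact (\<lambda>j. if j = i then k else 0) = (\<Prod>j\<in>UNIV. if j = i then fact k else 1)"
    unfolding mi_fact_def by (rule prod.cong) auto
  then show ?thesis by simp
qed

lemma mi_abs_add: "mi_abs (\<lambda>i. \<alpha> i + \<beta> i) = mi_abs \<alpha> + mi_abs \<beta>"
  by (simp add: mi_abs_def sum.distrib)

lemma mi_abs_single: "mi_abs (\<lambda>j. if j = i then k else 0) = k"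
  by (simp add: mi_abs_def)

lemma mi_abs_0 [simp]: "mi_abs (\<lambda>_. 0) = 0"
  by (simp add: mi_abs_def)

lemma mi_le_mi_abs: "\<alpha> i \<le> mi_abs \<alpha>"
  unfolding mi_abs_def by (rule member_le_sum) auto

lemma finite_mi_abs_le: "finite {\<alpha> :: 'n::finite mindex. mi_abs \<alpha> \<le> m}"
proof (rule finite_subset)
  show "{\<alpha>. mi_abs \<alpha> \<le> m} \<subseteq> (UNIV :: 'n set) \<rightarrow>\<^sub>E {..m}"
    using mi_le_mi_abs order_trans by fastforce
qed (auto intro: finite_PiE)

section \<open>The test function spaces and their inclusion\<close>

lemma schwartz_space_iff:
  "f \<in> schwartz_space \<longleftrightarrow> smooth f \<and>
    (\<forall>\<alpha> \<beta>. \<exists>C. \<forall>x. cmod (of_real (monomial \<alpha> x) * Dop \<beta> f x) \<le> C)"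
  by (auto simp: schwartz_space_def bdd_above_def)

lemma gs_space_iff:
  "f \<in> gs_space t s \<longleftrightarrow> smooth f \<and> (\<forall>h>0. \<exists>C. \<forall>\<alpha> \<beta> x. cmod (of_real (monomial \<alpha> x) * Dop \<beta> f x)
    \<le> C * (h ^ mi_abs (\<lambda>i. \<alpha> i + \<beta> i) * mi_fact \<alpha> powr t * mi_fact \<beta> powr s))"
proof -
  have *: "h ^ mi_abs (\<lambda>i. \<alpha> i + \<beta> i) * mi_fact \<alpha> powr t * mi_fact \<beta> powr s > 0"
    if "h > 0" for h and \<alpha> \<beta> :: "'a mindex"
    using that mi_fact_pos[of \<alpha>] mi_fact_pos[of \<beta>] by simp
  have "bdd_above (range (gs_quotient t s h f)) \<longleftrightarrow> (\<exists>C. \<forall>\<alpha> \<beta> x.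
      cmod (of_real (monomial \<alpha> x) * Dop \<beta> f x)
      \<le> C * (h ^ mi_abs (\<lambda>i. \<alpha> i + \<beta> i) * mi_fact \<alpha> powr t * mi_fact \<beta> powr s))" if "h > 0" for h
    using *[OF that] unfolding bdd_above_def
    by (simp add: gs_quotient_def pos_divide_le_eq)
  then show ?thesis
    unfolding gs_space_def by simp
qed

lemma schwartz_smooth: "f \<in> schwartz_space \<Longrightarrow> smooth f"
  by (simp add: schwartz_space_def)

lemma gs_space_subset_schwartz_space: "gs_space t s \<subseteq> schwartz_space"
proof
  fix f :: "real^'a \<Rightarrow> complex"
  assume f: "f \<in> gs_space t s"
  then obtain C where C: "\<And>\<alpha> \<beta> x. cmod (of_real (monomial \<alpha> x) * Dop \<beta> f x)
      \<le> C * (1 ^ mi_abs (\<lambda>i. \<alpha> i + \<beta> i) * mi_fact \<alpha> powr t * mi_fact \<beta> powr s)"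
    unfolding gs_space_iff using zero_less_one by blast
  show "f \<in> schwartz_space"
    unfolding schwartz_space_iff using f C by (auto simp: gs_space_iff)
qed

lemma schwartz_space_add:
  assumes "f \<in> schwartz_space" "g \<in> schwartz_space"
  shows "(\<lambda>x. f x + g x) \<in> schwartz_space"
  unfolding schwartz_space_iff
proof (intro conjI allI)
  show "smooth (\<lambda>x. f x + g x)"
    using assms by (simp add: schwartz_smooth smooth_add)
  fix \<alpha> \<beta> :: "'a mindex"
  obtain C D where "\<And>x. cmod (of_real (monomial \<alpha> x) * Dop \<beta> f x) \<le> C"
    "\<And>x. cmod (of_real (monomial \<alpha> x) * Dop \<beta> g x) \<le> D"
    using assms unfolding schwartz_space_iff by metis
  then have "cmod (of_real (monomial \<alpha> x) * Dop \<beta> (\<lambda>x. f x + g x) x) \<le> C + D" for x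
    using assms by (auto simp: Dop_add schwartz_smooth distrib_left intro: norm_triangle_mono)
  then show "\<exists>C. \<forall>x. cmod (of_real (monomial \<alpha> x) * Dop \<beta> (\<lambda>x. f x + g x) x) \<le> C" by blast
qed

lemma schwartz_space_cmult:
  assumes "f \<in> schwartz_space"
  shows "(\<lambda>x. a * f x) \<in> schwartz_space"
  unfolding schwartz_space_iff
proof (intro conjI allI)
  show "smooth (\<lambda>x. a * f x)"
    using assms by (simp add: schwartz_smooth smooth_cmult)
  fix \<alpha> \<beta> :: "'a mindex"
  obtain C where "\<And>x. cmod (of_real (monomial \<alpha> x) * Dop \<beta> f x) \<le> C"
    using assms unfolding schwartz_space_iff by metis
  then have "cmod a * cmod (of_real (monomial \<alpha> x) * Dop \<beta> f x) \<le> cmod a * C" for x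
    by (simp add: mult_left_mono)
  then have "cmod (of_real (monomial \<alpha> x) * Dop \<beta> (\<lambda>x. a * f x) x) \<le> cmod a * C" for x
    using assms by (simp add: Dop_cmult schwartz_smooth norm_mult mult_ac)
  then show "\<exists>C. \<forall>x. cmod (of_real (monomial \<alpha> x) * Dop \<beta> (\<lambda>x. a * f x) x) \<le> C" by blast
qed

lemma gs_space_add:
  assumes "f \<in> gs_space t s" "g \<in> gs_space t s"
  shows "(\<lambda>x. f x + g x) \<in> gs_space t s"
  unfolding gs_space_iff
proof (intro conjI allI impI)
  have sm: "smooth f" "smooth g" using assms by (auto simp: gs_space_iff)
  then show "smooth (\<lambda>x. f x + g x)" by (rule smooth_add)
  fix h :: real assume "h > 0"
  let ?w = "\<lambda>\<alpha> \<beta>. h ^ mi_abs (\<lambda>i. \<alpha> i + \<beta> i) * mi_fact \<alpha> powr t * mi_fact \<beta> powr s"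
  obtain C where C: "\<And>\<alpha> \<beta> x. cmod (of_real (monomial \<alpha> x) * Dop \<beta> f x) \<le> C * ?w \<alpha> \<beta>"
    using assms \<open>h > 0\<close> unfolding gs_space_iff by meson
  obtain D where D: "\<And>\<alpha> \<beta> x. cmod (of_real (monomial \<alpha> x) * Dop \<beta> g x) \<le> D * ?w \<alpha> \<beta>"
    using assms \<open>h > 0\<close> unfolding gs_space_iff by meson
  have "cmod (of_real (monomial \<alpha> x) * Dop \<beta> (\<lambda>x. f x + g x) x) \<le> (C + D) * ?w \<alpha> \<beta>" for \<alpha> \<beta> x
    unfolding Dop_add[OF sm] distrib_left distrib_right
    by (rule norm_triangle_mono[OF C D])
  then show "\<exists>C. \<forall>\<alpha> \<beta> x. cmod (of_real (monomial \<alpha> x) * Dop \<beta> (\<lambda>x. f x + g x) x) \<le> C * ?w \<alpha> \<beta>"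
    by blast
qed

lemma gs_space_cmult:
  assumes "f \<in> gs_space t s"
  shows "(\<lambda>x. a * f x) \<in> gs_space t s"
  unfolding gs_space_iff
proof (intro conjI allI impI)
  have sm: "smooth f" using assms by (auto simp: gs_space_iff)
  then show "smooth (\<lambda>x. a * f x)" by (rule smooth_cmult)
  fix h :: real assume "h > 0"
  let ?w = "\<lambda>\<alpha> \<beta>. h ^ mi_abs (\<lambda>i. \<alpha> i + \<beta> i) * mi_fact \<alpha> powr t * mi_fact \<beta> powr s"
  obtain C where C: "\<And>\<alpha> \<beta> x. cmod (of_real (monomial \<alpha> x) * Dop \<beta> f x) \<le> C * ?w \<alpha> \<beta>"
    using assms \<open>h > 0\<close> unfolding gs_space_iff by meson
  have "cmod (of_real (monomial \<alpha> x) * Dop \<beta> (\<lambda>x. a * f x) x) \<le> (cmod a * C) * ?w \<alpha> \<beta>" for \<alpha> \<beta> x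
  proof -
    have "cmod (of_real (monomial \<alpha> x) * Dop \<beta> (\<lambda>x. a * f x) x)
        = cmod a * cmod (of_real (monomial \<alpha> x) * Dop \<beta> f x)"
      by (simp add: Dop_cmult[OF sm] norm_mult)
    also have "\<dots> \<le> cmod a * (C * ?w \<alpha> \<beta>)"
      by (rule mult_left_mono[OF C]) simp
    finally show ?thesis by (simp add: mult.assoc)
  qed
  then show "\<exists>C. \<forall>\<alpha> \<beta> x. cmod (of_real (monomial \<alpha> x) * Dop \<beta> (\<lambda>x. a * f x) x) \<le> C * ?w \<alpha> \<beta>"
    by blast
qed

lemma schwartz_seminorm_upper:
  assumes "f \<in> schwartz_space"
  shows "cmod (of_real (monomial \<alpha> x) * Dop \<beta> f x) \<le> schwartz_seminorm \<alpha> \<beta> f"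
  unfolding schwartz_seminorm_def
  by (rule cSUP_upper) (use assms in \<open>auto simp: schwartz_space_def\<close>)

lemma schwartz_seminorm_le_gs_seminorm:
  assumes "f \<in> gs_space t s"
  shows "schwartz_seminorm \<alpha> \<beta> f \<le> mi_fact \<alpha> powr t * mi_fact \<beta> powr s * gs_seminorm t s 1 f"
  unfolding schwartz_seminorm_def
proof (rule cSUP_least)
  fix x :: "real^'a"
  have "gs_quotient t s 1 f (\<alpha>, \<beta>, x) \<le> gs_seminorm t s 1 f"
    unfolding gs_seminorm_def by (rule cSUP_upper) (use assms in \<open>auto simp: gs_space_def\<close>)
  moreover have "0 < mi_fact \<alpha> powr t * mi_fact \<beta> powr s"
    using mi_fact_pos[of \<alpha>] mi_fact_pos[of \<beta>] by simp
  ultimately show "cmod (of_real (monomial \<alpha> x) * Dop \<beta> f x)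
      \<le> mi_fact \<alpha> powr t * mi_fact \<beta> powr s * gs_seminorm t s 1 f"
    by (simp add: gs_quotient_def pos_divide_le_eq mult.commute)
qed simp

text \<open>A bound by finitely many seminorms, applied to the difference g - f, gives continuity at
  every \<open>f\<close>. The seminorm balls are only a subbasis, which is why \<open>K\<close> must
  be finite.\<close>

lemma antidualI:
  assumes add: "\<And>f g. f \<in> X \<Longrightarrow> g \<in> X \<Longrightarrow> (\<lambda>x. f x + g x) \<in> X"
    and cmult: "\<And>a f. f \<in> X \<Longrightarrow> (\<lambda>x. a * f x) \<in> X"
    and zero: "\<And>q. q \<in> P \<Longrightarrow> q (\<lambda>_. 0) = 0"
    and u_add: "\<And>f g. f \<in> X \<Longrightarrow> g \<in> X \<Longrightarrow> u (\<lambda>x. f x + g x) = u f + u g"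
    and u_cmult: "\<And>a f. f \<in> X \<Longrightarrow> u (\<lambda>x. a * f x) = cnj a * u f"
    and K: "finite K" "\<And>k. k \<in> K \<Longrightarrow> q k \<in> P" "\<And>k. k \<in> K \<Longrightarrow> 0 \<le> a k"
    and bound: "\<And>f. f \<in> X \<Longrightarrow> cmod (u f) \<le> (\<Sum>k\<in>K. a k * q k f)"
  shows "u \<in> antidual X P"
proof -
  let ?T = "seminorm_topology X P"
  have top: "topspace ?T \<subseteq> X"
    unfolding seminorm_topology_def topology_generated_by_topspace by auto
  have "openin ?T {f \<in> topspace ?T. u f \<in> V}" if V: "open V" for V
  proof (subst openin_subopen, intro ballI)
    fix f assume "f \<in> {f \<in> topspace ?T. u f \<in> V}"
    then have f: "f \<in> topspace ?T" "f \<in> X" "u f \<in> V" using top by auto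
    obtain \<epsilon> where \<epsilon>: "\<epsilon> > 0" "ball (u f) \<epsilon> \<subseteq> V"
      using V f(3) by (auto elim: openE)
    \<comment> \<open>The \<open>+ 1\<close> keeps the denominator positive when all coefficients
      are 0 and makes the final estimate strict.\<close>
    define e where "e = \<epsilon> / ((\<Sum>k\<in>K. a k) + 1)"
    have A: "0 \<le> (\<Sum>k\<in>K. a k)" by (rule sum_nonneg) (rule K(3))
    then have e: "e > 0" using \<epsilon>(1) by (simp add: e_def)
    let ?B = "\<lambda>k. {g \<in> X. q k (\<lambda>x. g x - f x) < e}"
    \<comment> \<open>For empty \<open>K\<close> the intersection of balls is the whole type; the
      topspace makes \<open>N\<close> open in that case too.\<close>
    define N where "N = (\<Inter>k\<in>K. ?B k) \<inter> topspace ?T"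
    have "openin ?T N"
      unfolding N_def using K(1)
    proof (rule openin_INT)
      fix k assume "k \<in> K"
      then show "openin ?T (?B k)"
        unfolding seminorm_topology_def
        using K(2)[OF \<open>k \<in> K\<close>] f(2) e
        by (intro topology_generated_by_Basis CollectI exI[of _ "q k"] exI[of _ f] exI[of _ e] conjI refl)
    qed
    moreover have "f \<in> N"
      using f e zero[OF K(2)] by (simp add: N_def)
    moreover have "N \<subseteq> {f \<in> topspace ?T. u f \<in> V}"
    proof
      fix g assume "g \<in> N"
      then have g: "g \<in> topspace ?T" "g \<in> X" "\<And>k. k \<in> K \<Longrightarrow> q k (\<lambda>x. g x - f x) < e"
        using top by (auto simp: N_def)
      have gf: "(\<lambda>x. g x - f x) \<in> X" and ugf: "u (\<lambda>x. g x - f x) = u g - u f"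
        using add[OF g(2) cmult[OF f(2), of "-1"]] u_add[OF g(2) cmult[OF f(2), of "-1"]]
          u_cmult[OF f(2), of "-1"] by simp_all
      have "cmod (u g - u f) \<le> (\<Sum>k\<in>K. a k * q k (\<lambda>x. g x - f x))"
        using bound[OF gf] by (simp add: ugf)
      also have "\<dots> \<le> (\<Sum>k\<in>K. a k * e)"
        using g(3) K(3) by (intro sum_mono mult_left_mono) (auto intro: less_imp_le)
      also have "\<dots> = (\<Sum>k\<in>K. a k) * e"
        by (rule sum_distrib_right[symmetric])
      also have "\<dots> < \<epsilon>"
        using A \<epsilon>(1) by (simp add: e_def field_simps)
      finally have "u g \<in> ball (u f) \<epsilon>"
        by (simp add: dist_norm norm_minus_commute)
      then show "g \<in> {f \<in> topspace ?T. u f \<in> V}"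
        using \<epsilon>(2) g(1) by blast
    qed
    ultimately show "\<exists>N. openin ?T N \<and> f \<in> N \<and> N \<subseteq> {f \<in> topspace ?T. u f \<in> V}" by blast
  qed
  then have "continuous_map ?T euclidean u"
    by (simp add: continuous_map_def)
  then show ?thesis
    unfolding antidual_def using u_add u_cmult by blast
qed

text \<open>One estimate by Schwartz seminorms serves both duals: on the smaller space it is
  rewritten with the single seminorm for \<open>h = 1\<close>, the factorials going into the
  coefficients.\<close>

lemma distributionI:
  fixes u :: "(real ^ 'n::finite \<Rightarrow> complex) \<Rightarrow> complex"
  assumes u_add: "\<And>f g. f \<in> schwartz_space \<Longrightarrow> g \<in> schwartz_space \<Longrightarrow> u (\<lambda>x. f x + g x) = u f + u g"
    and u_cmult: "\<And>a f. f \<in> schwartz_space \<Longrightarrow> u (\<lambda>x. a * f x) = cnj a * u f"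
    and K: "finite K" "\<And>k. k \<in> K \<Longrightarrow> 0 \<le> a k"
    and bound: "\<And>f. f \<in> schwartz_space \<Longrightarrow>
      cmod (u f) \<le> (\<Sum>k\<in>K. a k * schwartz_seminorm (A k) (B k) f)"
  shows "u \<in> tempered_distributions \<inter> gs_dual t s"
proof
  show "u \<in> tempered_distributions"
    unfolding tempered_distributions_def
  proof (rule antidualI[where K = K and a = a and q = "\<lambda>k. schwartz_seminorm (A k) (B k)"])
    show "q (\<lambda>_. 0) = 0" if "q \<in> {schwartz_seminorm \<alpha> \<beta> |\<alpha> \<beta>. True}"
      for q :: "(real^'n \<Rightarrow> complex) \<Rightarrow> real"
      using that by (auto simp: schwartz_seminorm_def)
  qed (use assms schwartz_space_add schwartz_space_cmult in auto)
  show "u \<in> gs_dual t s"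
    unfolding gs_dual_def
  proof (rule antidualI[where K = K and q = "\<lambda>k. gs_seminorm t s 1"
        and a = "\<lambda>k. a k * (mi_fact (A k) powr t * mi_fact (B k) powr s)"])
    show "q (\<lambda>_. 0) = 0" if "q \<in> {gs_seminorm t s h |h. 0 < h}"
      for q :: "(real^'n \<Rightarrow> complex) \<Rightarrow> real"
      using that by (auto simp: gs_seminorm_def gs_quotient_def case_prod_beta')
    show "gs_seminorm t s 1 \<in> {gs_seminorm t s h |h. 0 < h}"
      using zero_less_one by blast
    show "0 \<le> a k * (mi_fact (A k) powr t * mi_fact (B k) powr s)" if "k \<in> K" for k
      using K(2)[OF that] by simp
    fix f :: "real^'n \<Rightarrow> complex"
    assume f: "f \<in> gs_space t s"
    have "cmod (u f) \<le> (\<Sum>k\<in>K. a k * schwartz_seminorm (A k) (B k) f)"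
      using bound f gs_space_subset_schwartz_space by blast
    also have "\<dots> \<le> (\<Sum>k\<in>K. a k * (mi_fact (A k) powr t * mi_fact (B k) powr s * gs_seminorm t s 1 f))"
      using K(2) schwartz_seminorm_le_gs_seminorm[OF f] by (intro sum_mono mult_left_mono) auto
    finally show "cmod (u f) \<le> (\<Sum>k\<in>K. a k * (mi_fact (A k) powr t * mi_fact (B k) powr s) * gs_seminorm t s 1 f)"
      by (simp add: mult.assoc)
  qed (use gs_space_subset_schwartz_space in \<open>auto intro!: gs_space_add gs_space_cmult u_add u_cmult K\<close>)
qed

section \<open>The polynomial and the Dirac combination as functionals\<close>

lemma schwartz_weight_bound:
  assumes "f \<in> schwartz_space"
  shows "cmod (of_real (monomial \<alpha> y) * f y) * weight y
    \<le> (\<Sum>B\<in>UNIV. schwartz_seminorm (\<lambda>i. \<alpha> i + (if i \<in> B then 2 else 0)) (\<lambda>_. 0) f)"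
proof -
  have "cmod (of_real (monomial \<alpha> y) * f y) * weight y
      \<le> (\<Sum>B\<in>UNIV. cmod (of_real (monomial \<alpha> y) * f y) * \<bar>monomial (\<lambda>i. if i \<in> B then 2 else 0) y\<bar>)"
    unfolding weight_eq_sum_monomial sum_distrib_left by (intro sum_mono mult_left_mono) auto
  also have "\<dots> = (\<Sum>B\<in>UNIV. cmod (of_real (monomial (\<lambda>i. \<alpha> i + (if i \<in> B then 2 else 0)) y) * Dop (\<lambda>_. 0) f y))"
    by (simp only: monomial_add norm_mult norm_of_real abs_mult Dop_0 of_real_mult mult_ac)
  also have "\<dots> \<le> (\<Sum>B\<in>UNIV. schwartz_seminorm (\<lambda>i. \<alpha> i + (if i \<in> B then 2 else 0)) (\<lambda>_. 0) f)"
    by (intro sum_mono schwartz_seminorm_upper assms)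
  finally show ?thesis .
qed

lemma integrable_monomial_schwartz:
  fixes f :: "real ^ 'n::finite \<Rightarrow> complex"
  assumes "f \<in> schwartz_space"
  shows "integrable lborel (\<lambda>y. of_real (monomial \<alpha> y) * f y)"
    and "cmod (LINT y|lborel. of_real (monomial \<alpha> y) * f y) \<le>
      (\<Sum>B\<in>UNIV. schwartz_seminorm (\<lambda>i. \<alpha> i + (if i \<in> B then 2 else 0)) (\<lambda>_. 0) f)
        * (LINT y::real^'n|lborel. 1 / weight y)"
proof -
  have "f \<in> borel_measurable borel"
    using assms by (intro smooth_borel_measurable schwartz_smooth)
  then have "(\<lambda>y. of_real (monomial \<alpha> y) * f y) \<in> borel_measurable borel" by measurable
  note * = weight_dominated[OF this schwartz_weight_bound[OF assms]]
  show "integrable lborel (\<lambda>y. of_real (monomial \<alpha> y) * f y)"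
    by (rule *(1))
  show "cmod (LINT y|lborel. of_real (monomial \<alpha> y) * f y) \<le>
      (\<Sum>B\<in>UNIV. schwartz_seminorm (\<lambda>i. \<alpha> i + (if i \<in> B then 2 else 0)) (\<lambda>_. 0) f)
        * (LINT y::real^'n|lborel. 1 / weight y)"
    by (rule *(2))
qed

context
  fixes c :: "'n::finite mindex \<Rightarrow> complex" and p :: "real^'n \<Rightarrow> complex" and m :: nat
  assumes p_def: "p = (\<lambda>x. \<Sum>\<alpha> | mi_abs \<alpha> \<le> m. c \<alpha> * of_real (monomial \<alpha> x))"
begin

lemma dist_of_polynomial:
  assumes "f \<in> schwartz_space"
  shows "integrable lborel (\<lambda>x. p x * cnj (f x))"
    and "dist_of_fun p f = (\<Sum>\<alpha> | mi_abs \<alpha> \<le> m. c \<alpha> * cnj (LINT y|lborel. of_real (monomial \<alpha> y) * f y))"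
proof -
  have i: "integrable lborel (\<lambda>y. c \<alpha> * cnj (of_real (monomial \<alpha> y) * f y))" for \<alpha>
    by (intro integrable_mult_right integrable_cnj integrable_monomial_schwartz assms)
  have eq: "p x * cnj (f x) = (\<Sum>\<alpha> | mi_abs \<alpha> \<le> m. c \<alpha> * cnj (of_real (monomial \<alpha> x) * f x))" for x
    by (simp add: p_def sum_distrib_left mult_ac)
  show "integrable lborel (\<lambda>x. p x * cnj (f x))"
    unfolding eq by (intro Bochner_Integration.integrable_sum i)
  show "dist_of_fun p f = (\<Sum>\<alpha> | mi_abs \<alpha> \<le> m. c \<alpha> * cnj (LINT y|lborel. of_real (monomial \<alpha> y) * f y))"
    unfolding dist_of_fun_def eq
    by (subst Bochner_Integration.integral_sum[OF i])
       (simp only: integral_mult_right_zero Bochner_Integration.integral_cnj)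
qed

lemma dist_of_polynomial_in_duals: "dist_of_fun p \<in> tempered_distributions \<inter> gs_dual t s"
proof (rule distributionI)
  let ?I = "LINT y::real^'n|lborel. 1 / weight y"
  have I: "0 \<le> ?I"
    by (rule integral_nonneg_AE) (auto intro: less_imp_le weight_pos)
  \<comment> \<open>A pair consists of a monomial of \<open>p\<close> and a set \<open>B\<close>
    naming one term in the expansion of \<open>weight\<close>.\<close>
  show "finite ({\<alpha> :: 'n mindex. mi_abs \<alpha> \<le> m} \<times> (UNIV :: 'n set set))"
    by (intro finite_cartesian_product finite_mi_abs_le finite)
  show "0 \<le> (case k of (\<alpha>, B) \<Rightarrow> cmod (c \<alpha>) * ?I)" for k :: "'n mindex \<times> 'n set"
    using I by (auto split: prod.split)
  show "dist_of_fun p (\<lambda>x. f x + g x) = dist_of_fun p f + dist_of_fun p g"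
    if "f \<in> schwartz_space" "g \<in> schwartz_space" for f g
    using dist_of_polynomial(1)[OF that(1)] dist_of_polynomial(1)[OF that(2)]
    by (simp add: dist_of_fun_def distrib_left)
  show "dist_of_fun p (\<lambda>x. a * f x) = cnj a * dist_of_fun p f" for a f
    by (simp add: dist_of_fun_def mult.left_commute)
  fix f :: "real^'n \<Rightarrow> complex"
  assume f: "f \<in> schwartz_space"
  have "cmod (dist_of_fun p f) \<le> (\<Sum>\<alpha> | mi_abs \<alpha> \<le> m. cmod (c \<alpha>) * cmod (LINT y|lborel. of_real (monomial \<alpha> y) * f y))"
    unfolding dist_of_polynomial(2)[OF f]
    by (rule order_trans[OF norm_sum]) (simp add: norm_mult)
  also have "\<dots> \<le> (\<Sum>\<alpha> | mi_abs \<alpha> \<le> m. cmod (c \<alpha>) *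
      ((\<Sum>B\<in>UNIV. schwartz_seminorm (\<lambda>i. \<alpha> i + (if i \<in> B then 2 else 0)) (\<lambda>_. 0) f) * ?I))"
    by (intro sum_mono mult_left_mono integrable_monomial_schwartz f) simp
  also have "\<dots> = (\<Sum>(\<alpha>, B)\<in>{\<alpha>. mi_abs \<alpha> \<le> m} \<times> UNIV.
      cmod (c \<alpha>) * ?I * schwartz_seminorm (\<lambda>i. \<alpha> i + (if i \<in> B then 2 else 0)) (\<lambda>_. 0) f)"
    by (simp add: sum.cartesian_product[symmetric] sum_distrib_left sum_distrib_right mult_ac)
  finally show "cmod (dist_of_fun p f) \<le> (\<Sum>k\<in>{\<alpha>. mi_abs \<alpha> \<le> m} \<times> UNIV. (case k of (\<alpha>, B) \<Rightarrow> cmod (c \<alpha>) * ?I)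
      * schwartz_seminorm (case k of (\<alpha>, B) \<Rightarrow> \<lambda>i. \<alpha> i + (if i \<in> B then 2 else 0)) ((\<lambda>k. \<lambda>_. 0) k) f)"
    by (simp add: case_prod_beta)
qed

end

lemma dirac_combination_in_duals:
  "(\<lambda>\<phi>. \<Sum>\<alpha> | mi_abs \<alpha> \<le> m. c \<alpha> * dist_D \<alpha> dirac0 \<phi>) \<in> tempered_distributions \<inter> gs_dual t s"
proof (rule distributionI[OF _ _ finite_mi_abs_le])
  fix f :: "real^'a \<Rightarrow> complex"
  assume f: "f \<in> schwartz_space"
  have "cmod (\<Sum>\<alpha> | mi_abs \<alpha> \<le> m. c \<alpha> * dist_D \<alpha> dirac0 f)
      \<le> (\<Sum>\<alpha> | mi_abs \<alpha> \<le> m. cmod (c \<alpha>) * cmod (Dop \<alpha> f 0))"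
    by (rule order_trans[OF norm_sum]) (simp add: norm_mult dist_D_def dirac0_def)
  also have "\<dots> \<le> (\<Sum>\<alpha> | mi_abs \<alpha> \<le> m. cmod (c \<alpha>) * schwartz_seminorm (\<lambda>_. 0) \<alpha> f)"
    using schwartz_seminorm_upper[OF f, of "\<lambda>_. 0" 0] by (intro sum_mono mult_left_mono) auto
  finally show "cmod (\<Sum>\<alpha> | mi_abs \<alpha> \<le> m. c \<alpha> * dist_D \<alpha> dirac0 f)
      \<le> (\<Sum>\<alpha> | mi_abs \<alpha> \<le> m. cmod (c \<alpha>) * schwartz_seminorm ((\<lambda>_ _. 0) \<alpha>) ((\<lambda>\<alpha>. \<alpha>) \<alpha>) f)" .
qed (auto simp: dist_D_def dirac0_def Dop_add Dop_cmult schwartz_smooth distrib_left sum.distrib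
    sum_distrib_left mult.left_commute)

section \<open>Decay of Fourier transforms\<close>

text \<open>The admissible sequences of bounds, indexed by the number k of derivatives. The axioms
  record what happens to such bounds under the operations used below; \<open>shift\<close> is the
  second term of Leibniz' rule for a coordinate times a function. The instances are all sequences,
  for Schwartz windows, and \<open>gs_sequences\<close>.\<close>

locale growth_class =
  fixes \<B> :: "(nat \<Rightarrow> real) set"
  assumes zero: "(\<lambda>_. 0) \<in> \<B>"
    and add: "a \<in> \<B> \<Longrightarrow> b \<in> \<B> \<Longrightarrow> (\<lambda>k. a k + b k) \<in> \<B>"
    and cmult: "0 \<le> C \<Longrightarrow> b \<in> \<B> \<Longrightarrow> (\<lambda>k. C * b k) \<in> \<B>"
    and shift: "b \<in> \<B> \<Longrightarrow> (\<lambda>k. real k * b (k - 1)) \<in> \<B>"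

lemma (in growth_class) sum:
  "(\<And>j. j \<in> J \<Longrightarrow> b j \<in> \<B>) \<Longrightarrow> (\<lambda>k. \<Sum>j\<in>J. b j k) \<in> \<B>"
  by (induction J rule: infinite_finite_induct) (auto intro: zero add)

text \<open>The Beurling growth condition: every \<open>h > 0\<close> is allowed and
  \<open>C\<close> may depend on it. Only upper bounds are asked for, since the members serve as
  bounds.\<close>

definition gs_sequences :: "real \<Rightarrow> (nat \<Rightarrow> real) set"
  where "gs_sequences s = {b. \<forall>h>0. \<exists>C\<ge>0. \<forall>k. b k \<le> C * h ^ k * fact k powr s}"

lemma growth_class_UNIV: "growth_class UNIV"
  by unfold_locales auto

lemma growth_class_gs_sequences:
  assumes "s > 0"
  shows "growth_class (gs_sequences s)"
proof
  show "(\<lambda>_. 0) \<in> gs_sequences s"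
    by (auto simp: gs_sequences_def intro!: exI[of _ 0])
next
  fix a b assume ab: "a \<in> gs_sequences s" "b \<in> gs_sequences s"
  show "(\<lambda>k. a k + b k) \<in> gs_sequences s"
    unfolding gs_sequences_def
  proof (intro CollectI allI impI)
    fix h :: real assume "h > 0"
    then obtain A B where A: "0 \<le> A" "\<And>k. a k \<le> A * h ^ k * fact k powr s"
      and B: "0 \<le> B" "\<And>k. b k \<le> B * h ^ k * fact k powr s"
      using ab unfolding gs_sequences_def by blast
    have "a k + b k \<le> (A + B) * h ^ k * fact k powr s" for k
      using add_mono[OF A(2)[of k] B(2)[of k]] by (simp add: algebra_simps)
    with A B show "\<exists>C\<ge>0. \<forall>k. a k + b k \<le> C * h ^ k * fact k powr s"
      by (intro exI[of _ "A + B"]) simp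
  qed
next
  fix C :: real and b assume C: "0 \<le> C" and b: "b \<in> gs_sequences s"
  show "(\<lambda>k. C * b k) \<in> gs_sequences s"
    unfolding gs_sequences_def
  proof (intro CollectI allI impI)
    fix h :: real assume "h > 0"
    then obtain B where B: "0 \<le> B" "\<And>k. b k \<le> B * h ^ k * fact k powr s"
      using b unfolding gs_sequences_def by blast
    have "C * b k \<le> (C * B) * h ^ k * fact k powr s" for k
      using mult_left_mono[OF B(2)[of k] C] by (simp add: mult_ac)
    with B C show "\<exists>C'\<ge>0. \<forall>k. C * b k \<le> C' * h ^ k * fact k powr s"
      by (intro exI[of _ "C * B"]) simp
  qed
next
  fix b assume b: "b \<in> gs_sequences s"
  show "(\<lambda>k. real k * b (k - 1)) \<in> gs_sequences s"
    unfolding gs_sequences_def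
  proof (intro CollectI allI impI)
    fix h :: real assume h: "h > 0"
    \<comment> \<open>Halving \<open>h\<close> leaves a factor 2^(-k) that absorbs the new factor k
      \<le> 2^k; the constant 2 / h pays for the index k - 1.\<close>
    then obtain B where B: "0 \<le> B" "\<And>k. b k \<le> B * (h / 2) ^ k * fact k powr s"
      using b half_gt_zero[OF h] unfolding gs_sequences_def by blast
    have "real k * b (k - 1) \<le> (B * (2 / h)) * h ^ k * fact k powr s" for k
    proof (cases k)
      case (Suc j)
      have "real k * b j \<le> real k * (B * (h / 2) ^ j * fact j powr s)"
        by (rule mult_left_mono[OF B(2)]) simp
      also have "\<dots> \<le> 2 ^ k * (B * (h / 2) ^ j * fact k powr s)"
      proof (rule mult_mono)
        show "real k \<le> 2 ^ k" by (metis less_exp less_imp_le of_nat_le_iff of_nat_numeral of_nat_power)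
        have "fact j powr s \<le> (fact k :: real) powr s"
          using assms Suc by (intro powr_mono2) (auto intro: fact_mono)
        then show "B * (h / 2) ^ j * fact j powr s \<le> B * (h / 2) ^ j * fact k powr s"
          using B h by (intro mult_left_mono) auto
      qed (use B h in auto)
      also have "\<dots> = (B * (2 / h)) * h ^ k * fact k powr s"
        using h by (simp add: Suc power_divide)
      finally show ?thesis by (simp add: Suc)
    qed (use B h in simp)
    with B h show "\<exists>C\<ge>0. \<forall>k. real k * b (k - 1) \<le> C * h ^ k * fact k powr s"
      by (intro exI[of _ "B * (2 / h)"]) simp
  qed
qed

text \<open>Derivatives in the single direction \<open>i\<close> suffice, as only powers of the i-th
  frequency coordinate are to be gained. All monomials are included so that the class is stable
  under multiplication by coordinates; the bound may depend on \<gamma> but not on \<open>k\<close>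
  apart from its index.\<close>

definition controlled :: "'n::finite \<Rightarrow> (nat \<Rightarrow> real) set \<Rightarrow> (real ^ 'n \<Rightarrow> complex) \<Rightarrow> bool"
  where "controlled i \<B> f \<longleftrightarrow> smooth f \<and>
    (\<forall>\<gamma>. \<exists>b\<in>\<B>. \<forall>k y. cmod (of_real (monomial \<gamma> y) * (pd i ^^ k) f y) \<le> b k)"

context growth_class
begin

text \<open>Of the two terms in Leibniz' rule, the first is bounded by the sequence for \<gamma>
  raised by one at \<open>j\<close>, the second by the shifted sequence for \<gamma>.\<close>

lemma controlled_coordinate_mult:
  assumes f: "controlled i \<B> f"
  shows "controlled i \<B> (\<lambda>y. of_real (y $ j) * f y)"
  unfolding controlled_def
proof (intro conjI allI)
  have sm: "smooth f" using f by (simp add: controlled_def)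
  then show "smooth (\<lambda>y. of_real (y $ j) * f y)"
    by (intro smooth_mult smooth_coordinate)
  fix \<gamma> :: "'a mindex"
  let ?e = "\<lambda>l. if l = j then 1 else 0"
  obtain a where a: "a \<in> \<B>" "\<And>k y. cmod (of_real (monomial (\<lambda>l. \<gamma> l + ?e l) y) * (pd i ^^ k) f y) \<le> a k"
    using f unfolding controlled_def by meson
  obtain b where b: "b \<in> \<B>" "\<And>k y. cmod (of_real (monomial \<gamma> y) * (pd i ^^ k) f y) \<le> b k"
    using f unfolding controlled_def by meson
  have b0: "0 \<le> b k" for k
    using b(2)[of undefined k] norm_ge_zero order_trans by blast
  have "cmod (of_real (monomial \<gamma> y) * (pd i ^^ k) (\<lambda>y. of_real (y $ j) * f y) y) \<le> a k + real k * b (k - 1)" for k y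
  proof -
    have "of_real (monomial \<gamma> y) * (pd i ^^ k) (\<lambda>y. of_real (y $ j) * f y) y
        = of_real (monomial (\<lambda>l. \<gamma> l + ?e l) y) * (pd i ^^ k) f y
          + (if i = j then of_nat k * (of_real (monomial \<gamma> y) * (pd i ^^ (k - 1)) f y) else 0)"
      unfolding pd_funpow_coordinate_mult[OF sm] by (simp add: monomial_add monomial_single algebra_simps)
    also have "cmod \<dots> \<le> a k + real k * b (k - 1)"
      using b(2)[of y "k - 1"] b0[of "k - 1"]
      by (intro norm_triangle_mono a(2)) (auto simp: norm_mult mult_left_mono)
    finally show ?thesis .
  qed
  then show "\<exists>b\<in>\<B>. \<forall>k y. cmod (of_real (monomial \<gamma> y) * (pd i ^^ k) (\<lambda>y. of_real (y $ j) * f y) y) \<le> b k"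
    by (intro bexI[OF _ add[OF a(1) shift[OF b(1)]]]) blast
qed

lemma controlled_monomial_mult:
  assumes f: "controlled i \<B> f"
  shows "controlled i \<B> (\<lambda>y. of_real (monomial \<gamma> y) * f y)"
proof -
  have pow: "controlled i \<B> (\<lambda>y. of_real ((y $ j) ^ n) * g y)" if "controlled i \<B> g" for g j n
  proof (induction n)
    case (Suc n)
    from controlled_coordinate_mult[OF this, of j] show ?case
      by (simp add: mult.assoc)
  qed (use that in simp)
  have "controlled i \<B> (\<lambda>y. of_real (\<Prod>j\<in>S. (y $ j) ^ \<gamma> j) * f y)" if "finite S" for S
    using that
  proof (induction S)
    case (insert j S)
    from pow[OF insert.IH, of j "\<gamma> j"] insert.hyps show ?case
      by (simp add: mult.assoc)
  qed (use f in simp)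
  from this[of UNIV] show ?thesis
    by (simp add: monomial_def)
qed

lemma controlled_weight_bound:
  assumes "controlled i \<B> f"
  shows "\<exists>b\<in>\<B>. \<forall>k y. cmod ((pd i ^^ k) f y) * weight y \<le> b k"
proof -
  have "\<forall>B. \<exists>b\<in>\<B>. \<forall>k y. cmod (of_real (monomial (\<lambda>i. if i \<in> B then 2 else 0) y) * (pd i ^^ k) f y) \<le> b k"
    using assms unfolding controlled_def by blast
  then obtain b where b: "\<And>B. b B \<in> \<B>"
    "\<And>B k y. cmod (of_real (monomial (\<lambda>i. if i \<in> B then 2 else 0) y) * (pd i ^^ k) f y) \<le> b B k"
    by metis
  have "cmod ((pd i ^^ k) f y) * weight y \<le> (\<Sum>B\<in>UNIV. b B k)" for k y
    unfolding weight_eq_sum_monomial sum_distrib_left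
  proof (rule sum_mono)
    fix B
    show "cmod ((pd i ^^ k) f y) * monomial (\<lambda>i. if i \<in> B then 2 else 0) y \<le> b B k"
      using b(2)[where B = B and k = k and y = y]
        mult_left_mono[OF abs_ge_self[of "monomial (\<lambda>i. if i \<in> B then 2 else 0) y"] norm_ge_zero[of "(pd i ^^ k) f y"]]
      by (simp add: norm_mult mult.commute)
  qed
  then show ?thesis
    by (intro bexI[where x = "\<lambda>k. \<Sum>B\<in>UNIV. b B k"] allI sum b(1))
qed

text \<open>Each power of \<xi>_i is traded for a derivative of \<open>f\<close>, and the weighted
  bound on that derivative controls its Fourier transform uniformly in \<xi>.\<close>

lemma controlled_fourier_decay:
  assumes f: "controlled i \<B> f"
  shows "\<exists>b\<in>\<B>. \<forall>k \<xi>. \<bar>\<xi> $ i\<bar> ^ k * cmod (fourier f \<xi>) \<le> b k"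
proof -
  obtain b where b: "b \<in> \<B>" "\<And>k y. cmod ((pd i ^^ k) f y) * weight y \<le> b k"
    using controlled_weight_bound[OF f] by blast
  have sm: "smooth ((pd i ^^ k) f)" for k
    using f by (simp add: controlled_def smooth_pd_funpow)
  have "fourier ((pd i ^^ k) f) \<xi> = (\<i> * of_real (\<xi> $ i)) ^ k * fourier f \<xi>" for k \<xi>
  proof (induction k)
    case (Suc k)
    have "fourier (pd i ((pd i ^^ k) f)) \<xi> = \<i> * of_real (\<xi> $ i) * fourier ((pd i ^^ k) f) \<xi>"
      using b(2)[of "Suc k"] by (intro fourier_pd[OF sm b(2)]) simp
    with Suc show ?case by (simp add: mult.assoc)
  qed simp
  then have eq: "\<bar>\<xi> $ i\<bar> ^ k * cmod (fourier f \<xi>) = cmod (fourier ((pd i ^^ k) f) \<xi>)" for k \<xi>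
    by (simp add: norm_mult norm_power)
  let ?I = "LINT y::real^'a|lborel. 1 / weight y"
  have "\<bar>\<xi> $ i\<bar> ^ k * cmod (fourier f \<xi>) \<le> ?I * b k" for k \<xi>
    unfolding eq using fourier_bound[OF sm b(2)] by (simp add: mult.commute)
  moreover have "0 \<le> ?I"
    by (rule integral_nonneg_AE) (auto intro: less_imp_le weight_pos)
  ultimately show ?thesis
    by (intro bexI[OF _ cmult[OF _ b(1)]]) auto
qed

end

lemma controlled_cnj_schwartz:
  assumes "f \<in> schwartz_space" and "\<And>\<gamma>. (\<lambda>k. schwartz_seminorm \<gamma> (\<lambda>j. if j = i then k else 0) f) \<in> \<B>"
  shows "controlled i \<B> (\<lambda>y. cnj (f y))"
  unfolding controlled_def
proof (intro conjI allI bexI[OF _ assms(2)])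
  have sm: "smooth f" using assms(1) by (rule schwartz_smooth)
  then show "smooth (\<lambda>y. cnj (f y))" by (rule smooth_cnj)
  show "cmod (of_real (monomial \<gamma> y) * (pd i ^^ k) (\<lambda>y. cnj (f y)) y)
      \<le> schwartz_seminorm \<gamma> (\<lambda>j. if j = i then k else 0) f" for \<gamma> k y
    using schwartz_seminorm_upper[OF assms(1), of \<gamma> y "\<lambda>j. if j = i then k else 0"]
    by (simp add: pd_funpow_cnj[OF sm] norm_mult cmod_Dop_single)
qed

lemma gs_schwartz_seminorm_le:
  assumes "f \<in> gs_space t s" "h > 0"
  shows "\<exists>C\<ge>0. \<forall>\<alpha> \<beta>. schwartz_seminorm \<alpha> \<beta> f
    \<le> C * (h ^ mi_abs (\<lambda>i. \<alpha> i + \<beta> i) * mi_fact \<alpha> powr t * mi_fact \<beta> powr s)"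
proof -
  let ?w = "\<lambda>\<alpha> \<beta>. h ^ mi_abs (\<lambda>i. \<alpha> i + \<beta> i) * mi_fact \<alpha> powr t * mi_fact \<beta> powr s"
  obtain C where C: "\<And>\<alpha> \<beta> x. cmod (of_real (monomial \<alpha> x) * Dop \<beta> f x) \<le> C * ?w \<alpha> \<beta>"
    using assms unfolding gs_space_iff by meson
  have "0 \<le> C"
    using order_trans[OF norm_ge_zero C[of "\<lambda>_. 0" undefined "\<lambda>_. 0"]] by simp
  moreover have "schwartz_seminorm \<alpha> \<beta> f \<le> C * ?w \<alpha> \<beta>" for \<alpha> \<beta>
    unfolding schwartz_seminorm_def by (rule cSUP_least) (use C in auto)
  ultimately show ?thesis by blast
qed

text \<open>Growth in the number of derivatives has exponent \<open>s\<close> and feeds the Fourier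
  side, for the polynomial; growth in the power of a coordinate has exponent \<open>t\<close> and
  serves the Dirac combination directly. The fixed multi-index \<gamma> only affects the
  constant.\<close>

lemma gs_seminorms_in_gs_sequences:
  assumes f: "f \<in> gs_space t s"
  shows "(\<lambda>k. schwartz_seminorm \<gamma> (\<lambda>j. if j = i then k else 0) f) \<in> gs_sequences s"
    and "(\<lambda>k. schwartz_seminorm (\<lambda>j. if j = i then k else 0) \<gamma> f) \<in> gs_sequences t"
  unfolding gs_sequences_def
proof (safe)
  fix h :: real assume h: "h > 0"
  obtain C where C: "0 \<le> C" "\<And>\<alpha> \<beta>. schwartz_seminorm \<alpha> \<beta> f
      \<le> C * (h ^ mi_abs (\<lambda>i. \<alpha> i + \<beta> i) * mi_fact \<alpha> powr t * mi_fact \<beta> powr s)"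
    using gs_schwartz_seminorm_le[OF f h] by blast
  have "schwartz_seminorm \<gamma> (\<lambda>j. if j = i then k else 0) f
      \<le> (C * h ^ mi_abs \<gamma> * mi_fact \<gamma> powr t) * h ^ k * fact k powr s" for k
    using C(2)[of \<gamma> "\<lambda>j. if j = i then k else 0"]
    by (simp add: mi_abs_add mi_abs_single mi_fact_single power_add mult_ac)
  moreover have "0 \<le> C * h ^ mi_abs \<gamma> * mi_fact \<gamma> powr t" using C h by simp
  ultimately show "\<exists>C\<ge>0. \<forall>k. schwartz_seminorm \<gamma> (\<lambda>j. if j = i then k else 0) f \<le> C * h ^ k * fact k powr s"
    by blast
  have "schwartz_seminorm (\<lambda>j. if j = i then k else 0) \<gamma> f
      \<le> (C * h ^ mi_abs \<gamma> * mi_fact \<gamma> powr s) * h ^ k * fact k powr t" for k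
    using C(2)[of "\<lambda>j. if j = i then k else 0" \<gamma>]
    by (simp add: mi_abs_add mi_abs_single mi_fact_single power_add mult_ac)
  moreover have "0 \<le> C * h ^ mi_abs \<gamma> * mi_fact \<gamma> powr s" using C h by simp
  ultimately show "\<exists>C\<ge>0. \<forall>k. schwartz_seminorm (\<lambda>j. if j = i then k else 0) \<gamma> f \<le> C * h ^ k * fact k powr t"
    by blast
qed

section \<open>Injectivity of the Fourier transform\<close>

definition fourier_null :: "(real ^ 'n::finite \<Rightarrow> complex) \<Rightarrow> bool"
  where "fourier_null F \<longleftrightarrow> integrable lborel F \<and> (\<forall>\<xi>. fourier F \<xi> = 0)"

lemma integrable_character_mult:
  assumes "integrable lborel F"
  shows "integrable lborel (\<lambda>y. character \<xi> y * F y)"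
  by (rule Bochner_Integration.integrable_bound[OF assms])
     (use borel_measurable_integrable[OF assms] in \<open>auto simp: norm_mult\<close>)

text \<open>Multiplication by a character translates the Fourier transform.\<close>

lemma fourier_null_character_mult:
  assumes "fourier_null F"
  shows "fourier_null (\<lambda>y. character \<xi> y * F y)"
proof -
  have "character (- \<eta>) y * (character \<xi> y * F y) = character (- (\<eta> - \<xi>)) y * F y" for \<eta> y
    by (simp add: exp_add[symmetric] inner_diff_right algebra_simps)
  then have "fourier (\<lambda>y. character \<xi> y * F y) \<eta> = fourier F (\<eta> - \<xi>)" for \<eta>
    unfolding fourier_def by (simp only:)
  with assms show ?thesis
    by (simp add: fourier_null_def integrable_character_mult)
qed

lemma fourier_null_add:
  assumes "fourier_null F" "fourier_null G"
  shows "fourier_null (\<lambda>y. a * F y + b * G y)"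
proof -
  have i: "integrable lborel F" "integrable lborel G" using assms by (auto simp: fourier_null_def)
  have "fourier (\<lambda>y. a * F y + b * G y) \<xi> = a * fourier F \<xi> + b * fourier G \<xi>" for \<xi>
    using integrable_character_mult[OF i(1), of "- \<xi>"] integrable_character_mult[OF i(2), of "- \<xi>"]
    by (simp add: fourier_def distrib_left mult.left_commute)
  with assms i show ?thesis
    by (simp add: fourier_null_def)
qed

text \<open>Euler's formula; the centre \<open>a\<close> contributes constant phases only.\<close>

lemma fourier_null_cos_mult:
  assumes "fourier_null F"
  shows "fourier_null (\<lambda>y. of_real (cos ((y $ j - a) * \<theta>)) * F y)"
proof -
  let ?w = "\<lambda>y. (y $ j - a) * \<theta>"
  have "of_real (cos (?w y)) * F y
      = (exp (- (\<i> * of_real (a * \<theta>))) / 2) * (character (\<theta> *\<^sub>R axis j 1) y * F y)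
      + (exp (\<i> * of_real (a * \<theta>)) / 2) * (character (- \<theta> *\<^sub>R axis j 1) y * F y)" for y
  proof -
    have "exp (- (\<i> * of_real (a * \<theta>))) * character (\<theta> *\<^sub>R axis j 1) y = exp (\<i> * of_real (?w y))"
      "exp (\<i> * of_real (a * \<theta>)) * character (- \<theta> *\<^sub>R axis j 1) y = exp (- (\<i> * of_real (?w y)))"
      by (simp_all add: exp_add[symmetric] inner_axis algebra_simps)
    then show ?thesis
      by (simp add: cos_of_real[symmetric] cos_exp_eq field_simps)
  qed
  then show ?thesis
    by (simp only:) (intro fourier_null_add fourier_null_character_mult assms)
qed

lemma fourier_null_prod_cos:
  assumes F: "fourier_null F"
  shows "fourier_null (\<lambda>y. of_real (\<Prod>j\<in>UNIV. cos ((y $ j - a $ j) * \<theta>) ^ k) * F y)"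
proof -
  have pow: "fourier_null (\<lambda>y. of_real (cos ((y $ j - a $ j) * \<theta>) ^ n) * G y)" if "fourier_null G" for G j n
  proof (induction n)
    case (Suc n)
    from fourier_null_cos_mult[OF this, of j "a $ j" \<theta>] show ?case
      by (simp add: mult.assoc)
  qed (use that in simp)
  have "fourier_null (\<lambda>y. of_real (\<Prod>j\<in>S. cos ((y $ j - a $ j) * \<theta>) ^ k) * F y)" if "finite S" for S
    using that
  proof (induction S)
    case (insert j S)
    from pow[OF insert.IH, of j k] insert.hyps show ?case
      by (simp add: mult.assoc)
  qed (use F in simp)
  then show ?thesis by simp
qed

text \<open>Since cos h = 1 - h^2/2 + o(h^2), the n-th power at h = x / sqrt n behaves like (1 -
  x^2/(2n))^n. The expansion is carried out for x > 0, and evenness of the cosine gives x <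
  0.\<close>

lemma cos_power_tendsto_gaussian: "(\<lambda>k. cos (x / sqrt (real (Suc k))) ^ Suc k) \<longlonglongrightarrow> exp (- x\<^sup>2 / 2)"
proof -
  have pos: "(\<lambda>k. cos (x / sqrt (real (Suc k))) ^ Suc k) \<longlonglongrightarrow> exp (- x\<^sup>2 / 2)" if "x > 0" for x :: real
  proof -
    have "(\<lambda>k. cos (x / sqrt (real (Suc k))) ^ Suc k) \<longlonglongrightarrow> exp (- (x * x / 2))"
      using that by real_asymp
    then show ?thesis by (simp add: power2_eq_square)
  qed
  consider "x > 0" | "x = 0" | "- x > 0" by linarith
  then show ?thesis
  proof cases
    case 3
    from pos[OF this] show ?thesis by simp
  qed (use pos in auto)
qed

text \<open>Kept as a product over the coordinates because it arises as the limit of products of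
  cosines.\<close>

definition gaussian :: "real ^ 'n::finite \<Rightarrow> real"
  where "gaussian w = (\<Prod>j\<in>UNIV. exp (- (w $ j)\<^sup>2 / 2))"

lemma gaussian_pos: "gaussian w > 0"
  by (auto simp: gaussian_def intro: prod_pos)

lemma borel_measurable_gaussian [measurable]: "gaussian \<in> borel_measurable borel"
proof -
  have "continuous_on UNIV (gaussian :: real^'a \<Rightarrow> real)"
    unfolding gaussian_def[abs_def] by (intro continuous_intros) auto
  then show ?thesis by (rule borel_measurable_continuous_onI)
qed

text \<open>By 1 + x \<le> exp x each factor is at most 2 / (1 + w_j^2), so a multiple of 1 / weight
  is a majorant.\<close>

lemma integrable_gaussian: "integrable lborel (gaussian :: real ^ 'n::finite \<Rightarrow> real)"
proof (rule Bochner_Integration.integrable_bound)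
  show "integrable lborel (\<lambda>w::real^'n. 2 ^ CARD('n) * (1 / weight w))"
    using integrable_inverse_weight by (rule integrable_mult_right)
  have "gaussian w \<le> 2 ^ CARD('n) * (1 / weight w)" for w :: "real^'n"
  proof -
    have "exp (- (w $ j)\<^sup>2 / 2) \<le> 2 / (1 + (w $ j)\<^sup>2)" for j
    proof -
      have "(1 + (w $ j)\<^sup>2) / 2 \<le> exp ((w $ j)\<^sup>2 / 2)"
        using exp_ge_add_one_self[of "(w $ j)\<^sup>2 / 2"] by (simp add: field_simps)
      moreover have "0 < 1 + (w $ j)\<^sup>2" by (simp add: add_pos_nonneg)
      ultimately show ?thesis by (simp add: exp_minus field_simps)
    qed
    then have "gaussian w \<le> (\<Prod>j\<in>UNIV. 2 / (1 + (w $ j)\<^sup>2))"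
      unfolding gaussian_def by (intro prod_mono) auto
    then show ?thesis
      by (simp add: weight_def prod_dividef)
  qed
  then show "AE w::real^'n in lborel. norm (gaussian w) \<le> norm (2 ^ CARD('n) * (1 / weight w :: real))"
    by (intro always_eventually allI) (simp add: abs_of_pos gaussian_pos weight_pos)
qed simp

text \<open>A positive function with integral 0 would be 0 almost everywhere, and Lebesgue measure
  would be null.\<close>

lemma integral_gaussian_nonzero: "(LINT w::real^'n::finite|lborel. gaussian w) \<noteq> 0"
proof
  assume "(LINT w::real^'n|lborel. gaussian w) = 0"
  then have "AE w::real^'n in lborel. gaussian w = 0"
    using integral_nonneg_eq_0_iff_AE[OF integrable_gaussian always_eventually[OF allI[OF less_imp_le[OF gaussian_pos]]]]
    by blast
  then have "AE w::real^'n in lborel. False"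
    by (rule eventually_mono) (simp add: gaussian_pos[THEN less_imp_neq, symmetric])
  then have "emeasure lborel (UNIV :: (real^'n) set) = 0"
    by (simp add: eventually_False ae_filter_eq_bot_iff)
  then show False by simp
qed

text \<open>The functions annihilated by the Fourier transform are stable under multiplication by
  cosines, and \<open>cos (x / sqrt k) ^ k \<longlongrightarrow> exp (- x\<^sup>2 / 2)\<close> boundedly. Hence they are orthogonal to
  all rescaled and translated Gaussians.\<close>

lemma fourier_null_imp_0:
  fixes F :: "real ^ 'n::finite \<Rightarrow> complex"
  assumes F: "fourier_null F" "continuous_on UNIV F" and M: "\<And>y. cmod (F y) \<le> M"
  shows "F a = 0"
proof -
  have [measurable]: "F \<in> borel_measurable borel"
    using F(2) by (rule borel_measurable_continuous_onI)
  have i: "integrable lborel F" using F(1) by (simp add: fourier_null_def)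
  have cos0: "(LINT w|lborel. of_real (\<Prod>j\<in>UNIV. cos (w $ j * \<theta>) ^ k) * F (a + c *\<^sub>R w)) = 0"
    if c: "c > 0" for c \<theta> k
  proof -
    \<comment> \<open>The frequency \<theta> / c in y becomes \<theta> under y = a + c w, and the
      Fourier transform at 0 is the integral.\<close>
    let ?g = "\<lambda>y. of_real (\<Prod>j\<in>UNIV. cos ((y $ j - a $ j) * (\<theta> / c)) ^ k) * F y"
    have "fourier ?g 0 = 0"
      using fourier_null_prod_cos[OF F(1)] unfolding fourier_null_def by blast
    then have "(LINT y|lborel. ?g y) = 0"
      by (simp add: fourier_def)
    moreover have "?g \<in> borel_measurable borel" by measurable
    ultimately have "(LINT w|lborel. ?g (a + c *\<^sub>R w)) = 0"
      using lborel_integral_affine[of ?g c a] c by simp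
    with c show ?thesis by simp
  qed
  have ic: "integrable lborel (\<lambda>w. F (a + c *\<^sub>R w))" if "c > 0" for c
  proof -
    have "integrable (density (distr lborel borel (\<lambda>x. a + c *\<^sub>R x)) (\<lambda>_. ennreal (\<bar>c\<bar> ^ DIM(real^'n)))) F"
      using i lborel_affine[of c a] that by simp
    then have "integrable lborel (\<lambda>w. c ^ CARD('n) *\<^sub>R F (a + c *\<^sub>R w))"
      using that by (subst (asm) integrable_density) (auto simp: integrable_distr_eq)
    then have "integrable lborel (\<lambda>w. (1 / c ^ CARD('n)) *\<^sub>R c ^ CARD('n) *\<^sub>R F (a + c *\<^sub>R w))"
      by (rule integrable_scaleR_right)
    with that show ?thesis by simp
  qed
  have gauss0: "(LINT w|lborel. of_real (gaussian w) * F (a + c *\<^sub>R w)) = 0" if c: "c > 0" for c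
  proof -
    let ?P = "\<lambda>k w. \<Prod>j\<in>UNIV. cos ((w::real^'n) $ j * (1 / sqrt (real (Suc k)))) ^ Suc k"
    have "(\<lambda>k. LINT w|lborel. of_real (?P k w) * F (a + c *\<^sub>R w))
        \<longlonglongrightarrow> (LINT w|lborel. of_real (gaussian w) * F (a + c *\<^sub>R w))"
    proof (rule integral_dominated_convergence)
      show "integrable lborel (\<lambda>w. cmod (F (a + c *\<^sub>R w)))"
        using ic[OF c] by (rule integrable_norm)
      have "(\<lambda>k. ?P k w) \<longlonglongrightarrow> gaussian w" for w
        unfolding gaussian_def using cos_power_tendsto_gaussian by (intro tendsto_prod) simp
      then show "AE w in lborel. (\<lambda>k. of_real (?P k w) * F (a + c *\<^sub>R w)) \<longlonglongrightarrow> of_real (gaussian w) * F (a + c *\<^sub>R w)"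
        by (intro always_eventually allI tendsto_mult tendsto_of_real tendsto_const)
      have "\<bar>?P k w\<bar> \<le> 1" for k w
        unfolding abs_prod power_abs by (intro prod_le_1 conjI power_le_one) auto
      then show "AE w in lborel. norm (of_real (?P k w) * F (a + c *\<^sub>R w)) \<le> cmod (F (a + c *\<^sub>R w))" for k
        by (intro always_eventually allI) (simp only: norm_mult norm_of_real mult_left_le_one_le norm_ge_zero abs_ge_zero)
    qed measurable
    then show ?thesis
      by (simp only: cos0[OF c] LIMSEQ_const_iff)
  qed
  \<comment> \<open>An approximate identity in rescaled variables: as the scale shrinks, F(a + c w)
    tends to F a by continuity, and M times the Gaussian is a majorant.\<close>
  define c where "c n = 1 / real (Suc n)" for n
  have "(\<lambda>n. LINT w|lborel. of_real (gaussian w) * F (a + c n *\<^sub>R w))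
      \<longlonglongrightarrow> (LINT w|lborel. of_real (gaussian (w::real^'n)) * F a)"
  proof (rule integral_dominated_convergence)
    show "integrable lborel (\<lambda>w::real^'n. gaussian w * M)"
      using integrable_gaussian by (rule integrable_mult_left)
    have "(\<lambda>n. F (a + c n *\<^sub>R w)) \<longlonglongrightarrow> F a" for w
    proof -
      have "c \<longlonglongrightarrow> 0" unfolding c_def using LIMSEQ_Suc[OF lim_1_over_n] .
      then have "(\<lambda>n. a + c n *\<^sub>R w) \<longlonglongrightarrow> a + 0 *\<^sub>R w" by (intro tendsto_intros)
      moreover have "isCont F a" using F(2) by (simp add: continuous_on_eq_continuous_at)
      ultimately show ?thesis using isCont_tendsto_compose by fastforce
    qed
    then show "AE w in lborel. (\<lambda>n. of_real (gaussian w) * F (a + c n *\<^sub>R w)) \<longlonglongrightarrow> of_real (gaussian (w::real^'n)) * F a"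
      by (intro always_eventually allI tendsto_mult tendsto_const)
    show "AE w in lborel. norm (of_real (gaussian w) * F (a + c n *\<^sub>R w)) \<le> gaussian w * M" for n
      by (intro always_eventually allI)
        (simp only: norm_mult norm_of_real abs_of_pos[OF gaussian_pos]
          mult_left_mono[OF M less_imp_le[OF gaussian_pos]])
  qed measurable
  moreover have "c n > 0" for n by (simp add: c_def)
  ultimately have "(LINT w|lborel. of_real (gaussian (w::real^'n)) * F a) = 0"
    by (simp add: gauss0 LIMSEQ_const_iff)
  then show ?thesis
    using integral_gaussian_nonzero[where 'n = 'n] by (simp add: integral_complex_of_real)
qed

section \<open>Polynomials in several variables\<close>

lemma finite_atMost_mindex: "finite {..\<alpha> :: 'n::finite mindex}"
proof (rule finite_subset)
  show "{..\<alpha>} \<subseteq> (UNIV :: 'n set) \<rightarrow>\<^sub>E {..mi_abs \<alpha>}"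
    using mi_le_mi_abs[of \<alpha>] order_trans by (fastforce simp: le_fun_def)
qed (auto intro: finite_PiE)

text \<open>The distributive law: \<beta> picks one term from each factor, and vanishing off
  \<open>S\<close> makes the picks correspond to multi-indices without repetition.\<close>

lemma prod_sum_atMost:
  fixes f :: "'n \<Rightarrow> nat \<Rightarrow> 'b::comm_semiring_1" and \<alpha> :: "'n mindex"
  assumes "finite S"
  shows "(\<Prod>i\<in>S. \<Sum>k\<le>\<alpha> i. f i k)
    = (\<Sum>\<beta> | (\<forall>i\<in>S. \<beta> i \<le> \<alpha> i) \<and> (\<forall>i. i \<notin> S \<longrightarrow> \<beta> i = 0). \<Prod>i\<in>S. f i (\<beta> i))"
  using assms
proof (induction S)
  case empty
  have "{\<beta>. \<forall>i. \<beta> i = 0} = {\<lambda>i::'n. 0::nat}" by auto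
  then show ?case by simp
next
  case (insert i S)
  let ?M = "\<lambda>S. {\<beta>. (\<forall>i\<in>S. \<beta> i \<le> \<alpha> i) \<and> (\<forall>i. i \<notin> S \<longrightarrow> \<beta> i = 0)}"
  have "(\<Prod>j\<in>insert i S. \<Sum>k\<le>\<alpha> j. f j k) = (\<Sum>(k, \<beta>)\<in>{..\<alpha> i} \<times> ?M S. f i k * (\<Prod>j\<in>S. f j (\<beta> j)))"
    using insert by (simp add: sum_product sum.cartesian_product)
  also have "\<dots> = (\<Sum>\<beta>\<in>?M (insert i S). \<Prod>j\<in>insert i S. f j (\<beta> j))"
  proof (rule sum.reindex_bij_witness[where j = "\<lambda>(k, \<beta>). \<beta>(i := k)" and i = "\<lambda>\<beta>. (\<beta> i, \<beta>(i := 0))"])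
    fix k\<beta> assume "k\<beta> \<in> {..\<alpha> i} \<times> ?M S"
    then obtain k \<beta> where *: "k\<beta> = (k, \<beta>)" "k \<le> \<alpha> i" "\<beta> \<in> ?M S" by blast
    with insert.hyps have "\<beta> i = 0" by simp
    then have u: "(\<beta>(i := k))(i := 0) = \<beta>" by auto
    show "((case k\<beta> of (k, \<beta>) \<Rightarrow> \<beta>(i := k)) i, (case k\<beta> of (k, \<beta>) \<Rightarrow> \<beta>(i := k))(i := 0)) = k\<beta>"
      using * u by simp
    show "(case k\<beta> of (k, \<beta>) \<Rightarrow> \<beta>(i := k)) \<in> ?M (insert i S)"
      using * insert.hyps by auto
    have "(\<Prod>j\<in>S. f j ((\<beta>(i := k)) j)) = (\<Prod>j\<in>S. f j (\<beta> j))"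
      using insert.hyps by (intro prod.cong) auto
    then show "(\<Prod>j\<in>insert i S. f j ((case k\<beta> of (k, \<beta>) \<Rightarrow> \<beta>(i := k)) j))
        = (case k\<beta> of (k, \<beta>) \<Rightarrow> f i k * (\<Prod>j\<in>S. f j (\<beta> j)))"
      using * insert.hyps by simp
  qed (use insert.hyps in auto)
  finally show ?case .
qed

lemma monomial_translate:
  "monomial \<alpha> (y + x) = (\<Sum>\<beta>\<in>{..\<alpha>}. mi_binom \<alpha> \<beta> * monomial (\<alpha> - \<beta>) x * monomial \<beta> y)"
proof -
  have "monomial \<alpha> (y + x) = (\<Prod>i\<in>UNIV. \<Sum>k\<le>\<alpha> i. real (\<alpha> i choose k) * (y $ i) ^ k * (x $ i) ^ (\<alpha> i - k))"
    by (simp add: monomial_def binomial_ring)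
  also have "\<dots> = (\<Sum>\<beta>\<in>{..\<alpha>}. \<Prod>i\<in>UNIV. real (\<alpha> i choose \<beta> i) * (y $ i) ^ \<beta> i * (x $ i) ^ (\<alpha> i - \<beta> i))"
    by (subst prod_sum_atMost) (auto simp: le_fun_def atMost_def)
  finally show ?thesis
    by (simp add: mi_binom_def monomial_def prod.distrib mult_ac)
qed

lemma monomial_scaleR: "monomial \<alpha> (l *\<^sub>R a) = l ^ mi_abs \<alpha> * monomial \<alpha> a"
  by (simp add: monomial_def mi_abs_def power_mult_distrib prod.distrib power_sum)

lemma abs_monomial_le: "\<bar>monomial \<alpha> a\<bar> \<le> norm a ^ mi_abs \<alpha>"
  unfolding monomial_def mi_abs_def power_sum abs_prod power_abs
  by (intro prod_mono conjI power_mono component_le_norm_cart) auto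

text \<open>Moving along the diagonal by \<open>d\<close>, each coordinate vanishes for a single
  \<open>d\<close> only, while infinitely many values are small enough.\<close>

lemma open_contains_nonzero_coordinates:
  fixes x0 :: "real^'n::finite"
  assumes "open A" "x0 \<in> A"
  obtains x where "x \<in> A" "\<And>i. x $ i \<noteq> 0"
proof -
  let ?f = "\<lambda>d. x0 + d *\<^sub>R (\<chi> i. 1)"
  have "open (?f -` A)"
    by (intro open_vimage assms continuous_intros)
  moreover have "0 \<in> ?f -` A" using assms by simp
  ultimately obtain e where e: "e > 0" "ball 0 e \<subseteq> ?f -` A" by (rule openE)
  have "infinite {0<..<e}" using e(1) by simp
  then obtain d where d: "d \<in> {0<..<e}" "d \<notin> range (\<lambda>i. - x0 $ i)"
  proof -
    have "finite (range (\<lambda>i. - x0 $ i))" by simp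
    with \<open>infinite {0<..<e}\<close> have "\<not> {0<..<e} \<subseteq> range (\<lambda>i. - x0 $ i)"
      using finite_subset by blast
    then show thesis using that by blast
  qed
  show thesis
  proof (rule that)
    show "?f d \<in> A" using d(1) e(2) by (auto simp: subset_iff dist_norm)
    show "?f d $ i \<noteq> 0" for i
    proof
      assume "?f d $ i = 0"
      then have "d = - x0 $ i" by simp
      with d(2) show False by blast
    qed
  qed
qed

text \<open>Rescaling one coordinate by \<open>\<mu>\<close> near \<open>1\<close> turns the sum into a polynomial in \<open>\<mu>\<close> with
  infinitely many roots, so the monomials can be separated by their degree in that coordinate.\<close>

lemma monomials_independent:
  fixes c :: "'n::finite mindex \<Rightarrow> complex"
  assumes O: "open A" "x0 \<in> A" and "finite J"
    and "\<And>x. x \<in> A \<Longrightarrow> (\<Sum>\<alpha>\<in>J. c \<alpha> * of_real (monomial \<alpha> x)) = 0"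
  shows "\<forall>\<alpha>\<in>J. c \<alpha> = 0"
  using assms(3,4)
proof (induction J rule: finite_psubset_induct)
  case (psubset J)
  show ?case
  proof (cases "\<exists>\<alpha>\<in>J. \<exists>\<beta>\<in>J. \<alpha> \<noteq> \<beta>")
    case False
    show ?thesis
    proof
      fix \<alpha> assume \<alpha>: "\<alpha> \<in> J"
      with False have J: "J = {\<alpha>}" by blast
      obtain x where x: "x \<in> A" "\<And>i. x $ i \<noteq> 0"
        using open_contains_nonzero_coordinates[OF O] by blast
      have "monomial \<alpha> x \<noteq> 0" using x(2) by (simp add: monomial_def)
      then show "c \<alpha> = 0" using psubset.prems[OF x(1)] by (simp add: J)
    qed
  next
    case True
    \<comment> \<open>Two members that differ at \<open>i\<close> make every class of fixed degree
      in that coordinate a proper subset of \<open>J\<close>, to which the induction hypothesis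
      applies.\<close>
    then obtain \<alpha> \<beta> i where ab: "\<alpha> \<in> J" "\<beta> \<in> J" "\<alpha> i \<noteq> \<beta> i" by (auto simp: fun_eq_iff)
    define N where "N = Max ((\<lambda>\<alpha>. \<alpha> i) ` J)"
    have N: "\<gamma> i \<le> N" if "\<gamma> \<in> J" for \<gamma>
      unfolding N_def using psubset.hyps(1) that by (intro Max_ge) auto
    show ?thesis
    proof
      fix \<delta> assume \<delta>: "\<delta> \<in> J"
      let ?J = "\<lambda>k. {\<gamma> \<in> J. \<gamma> i = k}"
      have "(\<Sum>\<gamma>\<in>?J k. c \<gamma> * of_real (monomial \<gamma> x)) = 0" if x: "x \<in> A" and k: "k \<le> N" for x k
      proof (rule ccontr)
        assume nz: "(\<Sum>\<gamma>\<in>?J k. c \<gamma> * of_real (monomial \<gamma> x)) \<noteq> 0"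
        let ?z = "\<lambda>\<mu>. x + ((\<mu> - 1) * x $ i) *\<^sub>R axis i 1"
        have "open (?z -` A)" by (intro open_vimage O continuous_intros)
        moreover have "1 \<in> ?z -` A" using x by simp
        ultimately obtain e where e: "e > 0" "ball 1 e \<subseteq> ?z -` A" by (rule openE)
        have mono: "monomial \<gamma> (?z \<mu>) = \<mu> ^ \<gamma> i * monomial \<gamma> x" for \<gamma> \<mu>
        proof -
          have "monomial \<gamma> z = (z $ i) ^ \<gamma> i * (\<Prod>j\<in>UNIV - {i}. (z $ j) ^ \<gamma> j)" for z :: "real^'n"
            unfolding monomial_def by (rule prod.remove) auto
          moreover have "(\<Prod>j\<in>UNIV - {i}. (?z \<mu> $ j) ^ \<gamma> j) = (\<Prod>j\<in>UNIV - {i}. (x $ j) ^ \<gamma> j)"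
            by (rule prod.cong) (auto simp: axis_def)
          moreover have "?z \<mu> $ i = \<mu> * x $ i" by (simp add: axis_def algebra_simps)
          ultimately show ?thesis by (simp add: power_mult_distrib)
        qed
        have root: "(\<Sum>k\<le>N. (\<Sum>\<gamma>\<in>?J k. c \<gamma> * of_real (monomial \<gamma> x)) * complex_of_real \<mu> ^ k) = 0"
          if "\<mu> \<in> ball 1 e" for \<mu>
        proof -
          have "0 = (\<Sum>\<gamma>\<in>J. c \<gamma> * of_real (monomial \<gamma> (?z \<mu>)))"
            using psubset.prems e(2) that by fastforce
          also have "\<dots> = (\<Sum>k\<le>N. \<Sum>\<gamma>\<in>?J k. c \<gamma> * of_real (monomial \<gamma> (?z \<mu>)))"
            using N psubset.hyps(1) by (intro sum.group[symmetric]) auto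
          also have "\<dots> = (\<Sum>k\<le>N. (\<Sum>\<gamma>\<in>?J k. c \<gamma> * of_real (monomial \<gamma> x)) * complex_of_real \<mu> ^ k)"
            unfolding mono sum_distrib_right by (intro sum.cong refl) auto
          finally show ?thesis by simp
        qed
        have "finite {z. (\<Sum>k\<le>N. (\<Sum>\<gamma>\<in>?J k. c \<gamma> * of_real (monomial \<gamma> x)) * z ^ k) = 0}"
          using nz k by (subst polyfun_finite_roots) blast
        then have "finite (complex_of_real ` ball 1 e)"
          by (rule rev_finite_subset) (use root in auto)
        then have "finite (ball (1::real) e)"
          by (rule finite_imageD) (simp add: inj_on_def)
        then show False using e(1) infinite_Ioo[of "1 - e" "1 + e"] by (simp add: ball_eq_greaterThanLessThan)
      qed
      moreover have "?J (\<delta> i) \<subset> J" using ab by (metis (mono_tags, lifting) mem_Collect_eq psubsetI subsetI)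
      ultimately have "\<forall>\<gamma>\<in>?J (\<delta> i). c \<gamma> = 0"
        using N[OF \<delta>] by (intro psubset.IH) auto
      with \<delta> show "c \<delta> = 0" by simp
    qed
  qed
qed

section \<open>Rapid decay\<close>

text \<open>At the coordinate of largest modulus, the norm is at most the dimension times |z_i|, so
  bounds for single coordinates become bounds in the norm. That coordinate depends on
  \<open>z\<close>, hence the sum over all \<open>i\<close> in the constant.\<close>

lemma polynomial_decay:
  fixes g :: "real^'n::finite \<Rightarrow> complex"
  assumes "\<And>i. \<exists>b::nat \<Rightarrow> real. \<forall>k z. \<bar>z $ i\<bar> ^ k * cmod (g z) \<le> b k"
  shows "\<exists>D. \<forall>z. (1 + norm z) ^ M * cmod (g z) \<le> D"
proof -
  obtain b :: "'n \<Rightarrow> nat \<Rightarrow> real" where b: "\<And>i k z. \<bar>z $ i\<bar> ^ k * cmod (g z) \<le> b i k"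
    using assms by metis
  have b0: "0 \<le> b i k" for i k
    using order_trans[OF _ b[of undefined i k]] by simp
  let ?n = "real CARD('n)"
  let ?D = "\<lambda>i. 2 ^ M * (b i 0 + ?n ^ M * b i M)"
  have "(1 + norm z) ^ M * cmod (g z) \<le> (\<Sum>i\<in>UNIV. ?D i)" for z
  proof -
    obtain i where i: "\<And>j. \<bar>z $ j\<bar> \<le> \<bar>z $ i\<bar>"
    proof -
      have "Max (range (\<lambda>j. \<bar>z $ j\<bar>)) \<in> range (\<lambda>j. \<bar>z $ j\<bar>)" by (intro Max_in) auto
      then obtain i where "Max (range (\<lambda>j. \<bar>z $ j\<bar>)) = \<bar>z $ i\<bar>" by blast
      then show thesis using that by (metis Max_ge finite finite_imageI rangeI)
    qed
    have "norm z \<le> (\<Sum>j\<in>UNIV. \<bar>z $ j\<bar>)" by (rule norm_le_l1_cart)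
    also have "\<dots> \<le> ?n * \<bar>z $ i\<bar>" using sum_mono[of UNIV "\<lambda>j. \<bar>z $ j\<bar>" "\<lambda>_. \<bar>z $ i\<bar>"] i by simp
    finally have z: "norm z \<le> ?n * \<bar>z $ i\<bar>" .
    have "(1 + norm z) ^ M \<le> (2 * max 1 (norm z)) ^ M"
      by (rule power_mono) auto
    also have "\<dots> \<le> 2 ^ M * (1 + norm z ^ M)"
      unfolding power_mult_distrib by (intro mult_left_mono) (auto simp: max_def)
    also have "\<dots> \<le> 2 ^ M * (1 + ?n ^ M * \<bar>z $ i\<bar> ^ M)"
      using power_mono[OF z, of M] by (simp add: power_mult_distrib)
    finally have "(1 + norm z) ^ M * cmod (g z) \<le> 2 ^ M * (1 + ?n ^ M * \<bar>z $ i\<bar> ^ M) * cmod (g z)"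
      by (rule mult_right_mono) simp
    also have "\<dots> = 2 ^ M * (\<bar>z $ i\<bar> ^ 0 * cmod (g z) + ?n ^ M * (\<bar>z $ i\<bar> ^ M * cmod (g z)))"
      by (simp add: algebra_simps)
    also have "\<dots> \<le> ?D i"
      by (intro mult_left_mono add_mono b) auto
    also have "\<dots> \<le> (\<Sum>i\<in>UNIV. ?D i)"
      using b0 by (intro member_le_sum) auto
    finally show ?thesis .
  qed
  then show ?thesis by blast
qed

text \<open>Taking \<open>\<tau>\<close>-th roots turns the factors \<open>k! powr \<tau>\<close> into \<open>k!\<close>, and the resulting bounds are
  summed over \<open>k\<close> against the exponential series.\<close>

lemma exponential_decay:
  fixes g :: "real^'n::finite \<Rightarrow> complex"
  assumes b: "b \<in> gs_sequences \<tau>" "\<And>k z. \<bar>z $ i\<bar> ^ k * cmod (g z) \<le> b k"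
    and pos: "\<tau> > 0" "\<delta> > 0" "\<rho> > 0"
  shows "\<exists>D\<ge>0. \<forall>l>0. \<forall>z. \<delta> * l powr \<tau> \<le> \<bar>z $ i\<bar> \<longrightarrow> cmod (g z) \<le> D * exp (- \<rho> * l)"
proof -
  \<comment> \<open>The rate \<rho> after a \<tau>-th root. With \<eta> = 1 / (2 r) below, r^k
    \<eta>^k = 2^(-k) is summable.\<close>
  define r where "r = \<rho> / \<tau>"
  have r: "r > 0" using pos by (simp add: r_def)
  define \<eta> where "\<eta> = 1 / (2 * r)"
  have \<eta>: "\<eta> > 0" using r by (simp add: \<eta>_def)
  \<comment> \<open>The free parameter of \<open>gs_sequences\<close> is chosen so that \<delta>^k
    cancels against the lower bound on |z_i|^k and the \<tau>-th root of the rest is a constant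
    times \<eta>^k k!.\<close>
  obtain C where C: "C \<ge> 0" "\<And>k. b k \<le> C * (\<delta> * \<eta> powr \<tau>) ^ k * fact k powr \<tau>"
  proof -
    have "0 < \<delta> * \<eta> powr \<tau>" using pos \<eta> by simp
    then show thesis using b(1) that unfolding gs_sequences_def by blast
  qed
  define C' where "C' = C powr (1 / \<tau>)"
  have "cmod (g z) \<le> (2 * C') powr \<tau> * exp (- \<rho> * l)" if l: "l > 0" and z: "\<delta> * l powr \<tau> \<le> \<bar>z $ i\<bar>" for l z
  proof -
    let ?X = "cmod (g z) powr (1 / \<tau>)"
    have *: "(r * l) ^ k /\<^sub>R fact k * ?X \<le> C' * (1 / 2) ^ k" for k
    proof -
      have "(\<delta> * l powr \<tau>) ^ k * cmod (g z) \<le> \<bar>z $ i\<bar> ^ k * cmod (g z)"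
        using z l pos by (intro mult_right_mono power_mono) auto
      also have "\<dots> \<le> C * (\<delta> * \<eta> powr \<tau>) ^ k * fact k powr \<tau>"
        using b(2)[of z k] C(2)[of k] by linarith
      finally have "\<delta> ^ k * ((l powr \<tau>) ^ k * cmod (g z)) \<le> \<delta> ^ k * (C * (\<eta> powr \<tau>) ^ k * fact k powr \<tau>)"
        by (simp add: power_mult_distrib mult_ac)
      then have "(l powr \<tau>) ^ k * cmod (g z) \<le> C * (\<eta> powr \<tau>) ^ k * fact k powr \<tau>"
        using pos by simp
      moreover have "(x powr \<tau>) ^ k = (x ^ k) powr \<tau>" if "x > 0" for x
        using that by (simp add: powr_powr powr_realpow[symmetric] mult.commute)
      ultimately have "(l ^ k) powr \<tau> * cmod (g z) \<le> C * (\<eta> ^ k) powr \<tau> * fact k powr \<tau>"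
        using l \<eta> by simp
      then have "((l ^ k) powr \<tau> * cmod (g z)) powr (1 / \<tau>) \<le> (C * (\<eta> ^ k) powr \<tau> * fact k powr \<tau>) powr (1 / \<tau>)"
        using pos by (intro powr_mono2) auto
      then have "l ^ k * ?X \<le> C' * \<eta> ^ k * fact k"
        using l \<eta> pos C(1) by (simp add: powr_mult powr_powr C'_def)
      then have "r ^ k * (l ^ k * ?X) \<le> r ^ k * (C' * \<eta> ^ k * fact k)"
        using r by (intro mult_left_mono) auto
      moreover have "r ^ k * \<eta> ^ k = (1 / 2) ^ k"
        using r by (simp add: power_mult_distrib[symmetric] \<eta>_def)
      ultimately have "(r * l) ^ k * ?X \<le> C' * (1 / 2) ^ k * fact k"
        by (simp add: power_mult_distrib mult_ac)
      then show ?thesis by (simp add: field_simps)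
    qed
    have "(\<lambda>k. (r * l) ^ k /\<^sub>R fact k * ?X) sums (exp (r * l) * ?X)"
      by (rule sums_mult2[OF exp_converges])
    moreover have "(\<lambda>k. C' * (1 / 2) ^ k) sums (C' * 2)"
      using sums_mult[OF geometric_sums[of "1 / 2 :: real"], of C'] by simp
    ultimately have "exp (r * l) * ?X \<le> C' * 2"
      using * by (rule sums_le[rotated])
    then have "?X \<le> 2 * C' * exp (- (r * l))"
      by (simp add: exp_minus field_simps)
    then have "?X powr \<tau> \<le> (2 * C' * exp (- (r * l))) powr \<tau>"
      using pos by (intro powr_mono2) auto
    then show ?thesis
      using pos by (simp add: powr_powr powr_mult C'_def exp_powr_real r_def mult_ac)
  qed
  then show ?thesis
    by (intro exI[of _ "(2 * C') powr \<tau>"]) simp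
qed

text \<open>The inequality x < exp x at x = l / \<sigma>, raised to the power \<sigma>. It prices
  the growth of the dilated polynomial variable at one factor exp l per degree, uniformly down to l
  = 0.\<close>

lemma powr_le_exp:
  fixes l \<sigma> :: real
  assumes "l > 0" "\<sigma> > 0"
  shows "l powr \<sigma> \<le> \<sigma> powr \<sigma> * exp l"
proof -
  have "l / \<sigma> \<le> exp (l / \<sigma>)" using exp_gt_self less_imp_le by blast
  then have "l \<le> \<sigma> * exp (l / \<sigma>)" using assms by (simp add: field_simps)
  then have "l powr \<sigma> \<le> (\<sigma> * exp (l / \<sigma>)) powr \<sigma>"
    using assms by (intro powr_mono2) auto
  then show ?thesis
    using assms by (simp add: powr_mult exp_powr_real)
qed

section \<open>Wave front sets of shifted polynomials\<close>

text \<open>Stated for an arbitrary function on phase space, so that position and frequency can be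
  exchanged by composing with \<open>prod.swap\<close>.\<close>

definition rapid_near :: "((real^'n::finite) \<times> (real^'n) \<Rightarrow> complex) \<Rightarrow> (real^'n) \<times> (real^'n) \<Rightarrow> bool"
  where "rapid_near V z0 \<longleftrightarrow> (\<exists>\<Gamma>. open \<Gamma> \<and> positive_conic \<Gamma> \<and> 0 \<notin> \<Gamma> \<and> z0 \<in> \<Gamma> \<and>
        (\<forall>N::nat. bdd_above ((\<lambda>z. bracket z ^ N * cmod (V z)) ` \<Gamma>)))"

definition rapid_near_ts :: "real \<Rightarrow> real \<Rightarrow> ((real^'n::finite) \<times> (real^'n) \<Rightarrow> complex)
    \<Rightarrow> (real^'n) \<times> (real^'n) \<Rightarrow> bool"
  where "rapid_near_ts t s V z0 \<longleftrightarrow> (\<exists>U. open U \<and> 0 \<notin> U \<and> z0 \<in> U \<and>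
        (\<forall>r>0. bdd_above
          ((\<lambda>(l, x, \<xi>). exp (r * l) * cmod (V (l powr t *\<^sub>R x, l powr s *\<^sub>R \<xi>))) ` ({0<..} \<times> U))))"

lemma WF_g_eq: "WF_g \<phi> u = {z0. z0 \<noteq> 0 \<and> \<not> rapid_near (stft \<phi> u) z0}"
  by (simp add: WF_g_def rapid_near_def)

lemma WF_ts_eq: "WF_ts t s \<psi> u = {z0. z0 \<noteq> 0 \<and> \<not> rapid_near_ts t s (stft \<psi> u) z0}"
  by (simp add: WF_ts_def rapid_near_ts_def)

lemma rapid_near_swap:
  assumes "rapid_near V z0"
  shows "rapid_near (V \<circ> prod.swap) (prod.swap z0)"
proof -
  obtain \<Gamma> where \<Gamma>: "open \<Gamma>" "positive_conic \<Gamma>" "0 \<notin> \<Gamma>" "z0 \<in> \<Gamma>"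
    "\<And>N::nat. bdd_above ((\<lambda>z. bracket z ^ N * cmod (V z)) ` \<Gamma>)"
    using assms unfolding rapid_near_def by blast
  have "bracket (prod.swap z) = bracket z" for z :: "(real^'a) \<times> (real^'a)"
    by (cases z) (simp add: bracket_def norm_Pair add.commute)
  then have "(\<lambda>z. bracket z ^ N * cmod ((V \<circ> prod.swap) z)) ` (prod.swap -` \<Gamma>)
      \<subseteq> (\<lambda>z. bracket z ^ N * cmod (V z)) ` \<Gamma>" for N
    by (auto intro!: rev_image_eqI)
  then have "bdd_above ((\<lambda>z. bracket z ^ N * cmod ((V \<circ> prod.swap) z)) ` (prod.swap -` \<Gamma>))" for N
    by (rule bdd_above_mono[OF \<Gamma>(5)])
  moreover have "open (prod.swap -` \<Gamma>)"
    by (intro open_vimage \<Gamma> continuous_on_swap)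
  moreover have "positive_conic (prod.swap -` \<Gamma>)"
    using \<Gamma>(2) by (auto simp: positive_conic_def)
  ultimately show ?thesis
    unfolding rapid_near_def using \<Gamma>(3,4)
    by (intro exI[of _ "prod.swap -` \<Gamma>"]) (auto simp: zero_prod_def)
qed

text \<open>Exchanging the coordinates also exchanges the exponents of the anisotropic
  dilation.\<close>

lemma rapid_near_ts_swap:
  assumes "rapid_near_ts t s V z0"
  shows "rapid_near_ts s t (V \<circ> prod.swap) (prod.swap z0)"
proof -
  let ?b = "\<lambda>t s V r (l, x, \<xi>). exp (r * l) * cmod (V (l powr t *\<^sub>R x, l powr s *\<^sub>R \<xi>))"
  obtain U where U: "open U" "0 \<notin> U" "z0 \<in> U"
    "\<And>r. r > 0 \<Longrightarrow> bdd_above (?b t s V r ` ({0<..} \<times> U))"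
    using assms unfolding rapid_near_ts_def by blast
  have "?b s t (V \<circ> prod.swap) r ` ({0<..} \<times> (prod.swap -` U)) \<subseteq> ?b t s V r ` ({0<..} \<times> U)" for r
    by force
  then have "bdd_above (?b s t (V \<circ> prod.swap) r ` ({0<..} \<times> (prod.swap -` U)))" if "r > 0" for r
    by (rule bdd_above_mono[OF U(4)[OF that]])
  moreover have "open (prod.swap -` U)"
    by (intro open_vimage U continuous_on_swap)
  ultimately show ?thesis
    unfolding rapid_near_ts_def using U(2,3)
    by (intro exI[of _ "prod.swap -` U"]) (auto simp: zero_prod_def)
qed

text \<open>Up to unimodular and constant factors, both short-time Fourier transforms have this form: the
  polynomial shifts by \<open>a\<close> and then acts on the window, through \<open>D\<^sup>\<beta>\<close> or through multiplication
  by \<open>y\<^sup>\<beta>\<close>.\<close>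

definition shifted_polynomial :: "nat \<Rightarrow> ('n::finite mindex \<Rightarrow> complex) \<Rightarrow> ('n mindex \<Rightarrow> real^'n \<Rightarrow> complex)
    \<Rightarrow> real^'n \<Rightarrow> real^'n \<Rightarrow> complex"
  where "shifted_polynomial m c g a b = (\<Sum>\<alpha> | mi_abs \<alpha> \<le> m. c \<alpha> *
    (\<Sum>\<beta>\<in>{..\<alpha>}. of_real (mi_binom \<alpha> \<beta> * monomial (\<alpha> - \<beta>) a) * g \<beta> b))"

lemma mi_abs_mono: "\<beta> \<le> \<alpha> \<Longrightarrow> mi_abs \<beta> \<le> mi_abs \<alpha>"
  unfolding mi_abs_def le_fun_def by (intro sum_mono) auto

lemma mi_abs_diff: "\<beta> \<le> \<alpha> \<Longrightarrow> mi_abs (\<alpha> - \<beta>) = mi_abs \<alpha> - mi_abs \<beta>"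
  unfolding mi_abs_def le_fun_def by (simp add: sum_subtractf_nat)

lemma mi_abs_eq_0_iff: "mi_abs \<alpha> = 0 \<longleftrightarrow> \<alpha> = (\<lambda>_. 0)"
  by (auto simp: mi_abs_def fun_eq_iff)

lemma mi_binom_nonneg: "0 \<le> mi_binom \<alpha> \<beta>"
  by (auto simp: mi_binom_def intro: prod_nonneg)

text \<open>Each shift contributes a monomial of degree at most \<open>m\<close> in
  \<open>a\<close>, and each \<beta> that occurs has order at most \<open>m\<close>. The constant is
  the sum of all coefficients in modulus, hence uniform in \<open>a\<close> and
  \<open>b\<close>.\<close>

lemma shifted_polynomial_bound:
  fixes g :: "'n::finite mindex \<Rightarrow> real^'n \<Rightarrow> complex"
  shows "\<exists>C\<ge>0. \<forall>a b. cmod (shifted_polynomial m c g a b)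
    \<le> C * (1 + norm a) ^ m * (\<Sum>\<beta> | mi_abs \<beta> \<le> m. cmod (g \<beta> b))"
proof -
  let ?C = "\<Sum>\<alpha> | mi_abs \<alpha> \<le> m. cmod (c \<alpha>) * (\<Sum>\<beta>\<in>{..\<alpha>}. mi_binom \<alpha> \<beta>)"
  let ?G = "\<lambda>b. \<Sum>\<beta> | mi_abs \<beta> \<le> m. cmod (g \<beta> b)"
  have "cmod (shifted_polynomial m c g a b) \<le> ?C * (1 + norm a) ^ m * ?G b" for a b
  proof -
    have "cmod (of_real (mi_binom \<alpha> \<beta> * monomial (\<alpha> - \<beta>) a) * g \<beta> b)
        \<le> mi_binom \<alpha> \<beta> * ((1 + norm a) ^ m * ?G b)" if "mi_abs \<alpha> \<le> m" "\<beta> \<le> \<alpha>" for \<alpha> \<beta>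
    proof -
      have "\<bar>monomial (\<alpha> - \<beta>) a\<bar> \<le> norm a ^ mi_abs (\<alpha> - \<beta>)" by (rule abs_monomial_le)
      also have "\<dots> \<le> (1 + norm a) ^ mi_abs (\<alpha> - \<beta>)" by (intro power_mono) auto
      also have "\<dots> \<le> (1 + norm a) ^ m"
        using that by (intro power_increasing) (auto simp: mi_abs_diff)
      finally have 1: "\<bar>monomial (\<alpha> - \<beta>) a\<bar> \<le> (1 + norm a) ^ m" .
      have 2: "cmod (g \<beta> b) \<le> ?G b"
        using mi_abs_mono[OF that(2)] that(1) finite_mi_abs_le by (intro member_le_sum) auto
      have "cmod (of_real (mi_binom \<alpha> \<beta> * monomial (\<alpha> - \<beta>) a) * g \<beta> b)
          = mi_binom \<alpha> \<beta> * (\<bar>monomial (\<alpha> - \<beta>) a\<bar> * cmod (g \<beta> b))"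
        by (simp add: norm_mult abs_mult mi_binom_nonneg)
      also have "\<dots> \<le> mi_binom \<alpha> \<beta> * ((1 + norm a) ^ m * ?G b)"
        by (intro mult_left_mono mult_mono 1 2 mi_binom_nonneg) auto
      finally show ?thesis .
    qed
    then have "cmod (c \<alpha> * (\<Sum>\<beta>\<in>{..\<alpha>}. of_real (mi_binom \<alpha> \<beta> * monomial (\<alpha> - \<beta>) a) * g \<beta> b))
        \<le> cmod (c \<alpha>) * (\<Sum>\<beta>\<in>{..\<alpha>}. mi_binom \<alpha> \<beta> * ((1 + norm a) ^ m * ?G b))" if "mi_abs \<alpha> \<le> m" for \<alpha>
      using that unfolding norm_mult[of "c \<alpha>"] by (intro mult_left_mono sum_norm_le) auto
    then have "cmod (shifted_polynomial m c g a b)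
        \<le> (\<Sum>\<alpha> | mi_abs \<alpha> \<le> m. cmod (c \<alpha>) * (\<Sum>\<beta>\<in>{..\<alpha>}. mi_binom \<alpha> \<beta> * ((1 + norm a) ^ m * ?G b)))"
      unfolding shifted_polynomial_def by (intro sum_norm_le) auto
    also have "\<dots> = ?C * (1 + norm a) ^ m * ?G b"
      by (simp only: sum_distrib_right[symmetric] mult.assoc[symmetric])
    finally show ?thesis .
  qed
  moreover have "0 \<le> ?C"
    by (intro sum_nonneg mult_nonneg_nonneg mi_binom_nonneg) auto
  ultimately show ?thesis by blast
qed

text \<open>Along a ray, the leading coefficient is the top degree part of the polynomial times
  \<open>g 0\<close>, and the top degree part cannot vanish on an open set.\<close>

lemma shifted_polynomial_lower_bound:
  fixes g :: "'n::finite mindex \<Rightarrow> real^'n \<Rightarrow> complex"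
  assumes c: "mi_abs \<alpha>0 \<le> m" "c \<alpha>0 \<noteq> 0" and g0: "g (\<lambda>_. 0) b \<noteq> 0" and A: "open A" "a0 \<in> A"
  obtains a \<epsilon> where "a \<in> A" "\<epsilon> > 0"
    "eventually (\<lambda>l. \<epsilon> \<le> cmod (shifted_polynomial m c g (l *\<^sub>R a) b)) at_top"
proof -
  let ?D = "mi_abs ` {\<alpha>. mi_abs \<alpha> \<le> m \<and> c \<alpha> \<noteq> 0}"
  \<comment> \<open>The actual degree, which may be smaller than \<open>m\<close>.\<close>
  define d where "d = Max ?D"
  have fin: "finite ?D"
    by (intro finite_imageI finite_subset[OF _ finite_mi_abs_le[of m]]) auto
  have ne: "?D \<noteq> {}" using c by blast
  have "d \<in> ?D" unfolding d_def using fin ne by (rule Max_in)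
  then obtain \<alpha>1 where \<alpha>1: "mi_abs \<alpha>1 = d" "d \<le> m" "c \<alpha>1 \<noteq> 0" by auto
  have d_max: "mi_abs \<alpha> \<le> d" if "mi_abs \<alpha> \<le> m" "c \<alpha> \<noteq> 0" for \<alpha>
    unfolding d_def using fin that by (intro Max_ge) auto
  let ?J = "{\<alpha> :: 'n mindex. mi_abs \<alpha> = d}"
  have J: "finite ?J" by (rule finite_subset[OF _ finite_mi_abs_le[of d]]) auto
  have "\<not> (\<forall>\<alpha>\<in>?J. c \<alpha> = 0)" using \<alpha>1 by auto
  then obtain a where a: "a \<in> A" "(\<Sum>\<alpha>\<in>?J. c \<alpha> * of_real (monomial \<alpha> a)) \<noteq> 0"
    using monomials_independent[OF A J, of c] by blast
  let ?L = "(\<Sum>\<alpha>\<in>?J. c \<alpha> * of_real (monomial \<alpha> a)) * g (\<lambda>_. 0) b"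
  let ?t = "\<lambda>l \<alpha> \<beta>. of_real (mi_binom \<alpha> \<beta> * monomial (\<alpha> - \<beta>) (l *\<^sub>R a)) * g \<beta> b"
  \<comment> \<open>The term of \<alpha>, \<beta> grows like l^(|\<alpha>| - |\<beta>|), so division
    by l^d leaves only |\<alpha>| = d with \<beta> = 0.\<close>
  have lim: "((\<lambda>l. c \<alpha> * ?t l \<alpha> \<beta> / of_real (l ^ d)) \<longlongrightarrow>
      (if \<beta> = (\<lambda>_. 0) then if mi_abs \<alpha> = d then c \<alpha> * of_real (monomial \<alpha> a) * g (\<lambda>_. 0) b else 0 else 0)) at_top"
    if \<alpha>: "mi_abs \<alpha> \<le> m" and \<beta>: "\<beta> \<in> {..\<alpha>}" for \<alpha> \<beta>
  proof (cases "c \<alpha> = 0")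
    case False
    note le = d_max[OF \<alpha> False]
    have \<beta>': "mi_abs \<beta> \<le> mi_abs \<alpha>" using \<beta> by (auto intro: mi_abs_mono)
    let ?k = "mi_abs (\<alpha> - \<beta>)"
    have k: "?k = mi_abs \<alpha> - mi_abs \<beta>" using \<beta> by (simp add: mi_abs_diff)
    have eq: "\<forall>\<^sub>F l in at_top. of_real (1 / l ^ (d - ?k)) * (c \<alpha> * ?t 1 \<alpha> \<beta>) = c \<alpha> * ?t l \<alpha> \<beta> / of_real (l ^ d)"
      using eventually_gt_at_top[of 0]
    proof eventually_elim
      case (elim l)
      have "l ^ ?k / l ^ d = 1 / l ^ (d - ?k)"
        using elim le k by (simp add: power_diff)
      then have "of_real (1 / l ^ (d - ?k)) * (c \<alpha> * ?t 1 \<alpha> \<beta>)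
          = complex_of_real (l ^ ?k) / of_real (l ^ d) * (c \<alpha> * ?t 1 \<alpha> \<beta>)"
        by (simp only: of_real_divide[symmetric])
      also have "\<dots> = c \<alpha> * ?t l \<alpha> \<beta> / of_real (l ^ d)"
        unfolding monomial_scaleR by simp
      finally show ?case .
    qed
    show ?thesis
    proof (cases "?k < d")
      case True
      then have "((\<lambda>l::real. 1 / l ^ (d - ?k)) \<longlongrightarrow> 0) at_top"
        by (intro tendsto_divide_0[OF tendsto_const] filterlim_at_top_imp_at_infinity
            filterlim_pow_at_top filterlim_ident) auto
      then have "((\<lambda>l. of_real (1 / l ^ (d - ?k)) * (c \<alpha> * ?t 1 \<alpha> \<beta>)) \<longlongrightarrow> of_real 0 * (c \<alpha> * ?t 1 \<alpha> \<beta>)) at_top"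
        by (intro tendsto_mult tendsto_of_real tendsto_const)
      moreover have "\<not> (\<beta> = (\<lambda>_. 0) \<and> mi_abs \<alpha> = d)"
        using True k by auto
      ultimately show ?thesis
        using Lim_transform_eventually[OF _ eq] by auto
    next
      case False
      then have "mi_abs \<beta> = 0" "mi_abs \<alpha> = d" "?k = d" using k le \<beta>' by auto
      then have z: "\<beta> = (\<lambda>_. 0)" by (simp add: mi_abs_eq_0_iff)
      then have "\<alpha> - \<beta> = \<alpha>" "mi_binom \<alpha> \<beta> = 1" by (auto simp: mi_binom_def)
      then have "((\<lambda>l. c \<alpha> * ?t l \<alpha> \<beta> / of_real (l ^ d)) \<longlongrightarrow> c \<alpha> * ?t 1 \<alpha> \<beta>) at_top"
        using \<open>?k = d\<close> by (intro Lim_transform_eventually[OF _ eq]) simp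
      then show ?thesis
        using z \<open>mi_abs \<alpha> = d\<close> \<open>\<alpha> - \<beta> = \<alpha>\<close> \<open>mi_binom \<alpha> \<beta> = 1\<close> by (simp add: mult.assoc)
    qed
  qed simp
  have "((\<lambda>l. \<Sum>\<alpha> | mi_abs \<alpha> \<le> m. \<Sum>\<beta>\<in>{..\<alpha>}. c \<alpha> * ?t l \<alpha> \<beta> / of_real (l ^ d)) \<longlongrightarrow>
      (\<Sum>\<alpha> | mi_abs \<alpha> \<le> m. \<Sum>\<beta>\<in>{..\<alpha>}. if \<beta> = (\<lambda>_. 0) then
        if mi_abs \<alpha> = d then c \<alpha> * of_real (monomial \<alpha> a) * g (\<lambda>_. 0) b else 0 else 0)) at_top"
    by (intro tendsto_sum lim) auto
  also have "(\<lambda>l. \<Sum>\<alpha> | mi_abs \<alpha> \<le> m. \<Sum>\<beta>\<in>{..\<alpha>}. c \<alpha> * ?t l \<alpha> \<beta> / of_real (l ^ d))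
      = (\<lambda>l. shifted_polynomial m c g (l *\<^sub>R a) b / of_real (l ^ d))"
    by (simp only: shifted_polynomial_def sum_divide_distrib sum_distrib_left)
  also have "(\<Sum>\<alpha> | mi_abs \<alpha> \<le> m. \<Sum>\<beta>\<in>{..\<alpha>}. if \<beta> = (\<lambda>_. 0) then
        if mi_abs \<alpha> = d then c \<alpha> * of_real (monomial \<alpha> a) * g (\<lambda>_. 0) b else 0 else 0)
      = (\<Sum>\<alpha> | mi_abs \<alpha> \<le> m. if mi_abs \<alpha> = d then c \<alpha> * of_real (monomial \<alpha> a) * g (\<lambda>_. 0) b else 0)"
    by (intro sum.cong refl, subst sum.delta[OF finite_atMost_mindex]) (auto simp: le_fun_def)
  also have "\<dots> = ?L"
  proof -
    have "{\<alpha> :: 'n mindex. mi_abs \<alpha> \<le> m \<and> mi_abs \<alpha> = d} = ?J" using \<alpha>1(2) by auto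
    then show ?thesis
      by (simp add: sum.If_cases finite_mi_abs_le Collect_conj_eq[symmetric] sum_distrib_right)
  qed
  finally have "((\<lambda>l. cmod (shifted_polynomial m c g (l *\<^sub>R a) b / of_real (l ^ d))) \<longlongrightarrow> cmod ?L) at_top"
    by (rule tendsto_norm)
  moreover have L: "cmod ?L / 2 > 0" "cmod ?L / 2 < cmod ?L" using a(2) g0 by auto
  ultimately have "\<forall>\<^sub>F l in at_top. cmod ?L / 2 < cmod (shifted_polynomial m c g (l *\<^sub>R a) b / of_real (l ^ d))"
    by (intro order_tendstoD(1))
  then have "\<forall>\<^sub>F l in at_top. cmod ?L / 2 \<le> cmod (shifted_polynomial m c g (l *\<^sub>R a) b)"
    using eventually_ge_at_top[of "1::real"]
  proof eventually_elim
    case (elim l)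
    then have "1 \<le> l ^ d" by (intro one_le_power)
    then have "cmod (shifted_polynomial m c g (l *\<^sub>R a) b / of_real (l ^ d)) \<le> cmod (shifted_polynomial m c g (l *\<^sub>R a) b)"
      using elim(2) mult_left_mono[of 1 "l ^ d" "cmod (shifted_polynomial m c g (l *\<^sub>R a) b)"]
      by (simp add: norm_divide norm_power divide_le_eq)
    with elim show ?case by linarith
  qed
  with a(1) L(1) show thesis by (rule that)
qed

section \<open>Where a shifted polynomial decays rapidly\<close>

context
  fixes V :: "(real^'n::finite) \<times> (real^'n) \<Rightarrow> complex" and m c g and K :: real
  assumes V: "\<And>a b. cmod (V (a, b)) = K * cmod (shifted_polynomial m c g a b)"
    and K: "K > 0" and c: "\<exists>\<alpha>. mi_abs \<alpha> \<le> m \<and> c \<alpha> \<noteq> 0" and g0: "\<exists>b. g (\<lambda>_. 0) b \<noteq> 0"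
begin

text \<open>If b0 is nonzero, |a| < R |b| defines a conic neighbourhood in which the bracket and the
  polynomial growth in \<open>a\<close> are both bounded by powers of 1 + |b|. If b0 = 0, a ray with
  fixed \<open>b\<close> eventually runs inside any cone around (a0, 0).\<close>

lemma rapid_near_iff:
  assumes decay: "\<And>\<beta> i. mi_abs \<beta> \<le> m \<Longrightarrow> \<exists>b::nat \<Rightarrow> real. \<forall>k z. \<bar>z $ i\<bar> ^ k * cmod (g \<beta> z) \<le> b k"
    and ab: "(a0, b0) \<noteq> 0"
  shows "rapid_near V (a0, b0) \<longleftrightarrow> b0 \<noteq> 0"
proof
  assume b0: "b0 \<noteq> 0"
  \<comment> \<open>The \<open>+ 1\<close> makes the cone condition strict at (a0, b0) and keeps
    \<open>R\<close> positive for a0 = 0.\<close>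
  define R where "R = norm a0 / norm b0 + 1"
  have R: "R > 0" by (simp add: R_def add_nonneg_pos)
  define \<Gamma> where "\<Gamma> = {z :: (real^'n) \<times> (real^'n). norm (fst z) < R * norm (snd z)}"
  obtain C where C: "C \<ge> 0" "\<And>a b. cmod (shifted_polynomial m c g a b)
      \<le> C * (1 + norm a) ^ m * (\<Sum>\<beta> | mi_abs \<beta> \<le> m. cmod (g \<beta> b))"
    using shifted_polynomial_bound by blast
  have "open \<Gamma>"
    unfolding \<Gamma>_def by (intro open_Collect_less continuous_intros)
  moreover have "positive_conic \<Gamma>"
    by (auto simp: positive_conic_def \<Gamma>_def mult.left_commute)
  moreover have "0 \<notin> \<Gamma>" by (simp add: \<Gamma>_def)
  moreover have "(a0, b0) \<in> \<Gamma>"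
    using b0 by (simp add: \<Gamma>_def R_def field_simps)
  moreover have "bdd_above ((\<lambda>z. bracket z ^ N * cmod (V z)) ` \<Gamma>)" for N :: nat
  proof -
    have "\<forall>\<beta>\<in>{\<beta>. mi_abs \<beta> \<le> m}. \<exists>D. \<forall>z. (1 + norm z) ^ (N + m) * cmod (g \<beta> z) \<le> D"
      using polynomial_decay[OF decay] by blast
    then obtain D where D: "\<And>\<beta> z. mi_abs \<beta> \<le> m \<Longrightarrow> (1 + norm z) ^ (N + m) * cmod (g \<beta> z) \<le> D \<beta>"
      by (auto simp: bchoice_iff)
    let ?B = "(1 + R) ^ (N + m) * (K * C) * (\<Sum>\<beta> | mi_abs \<beta> \<le> m. D \<beta>)"
    have "bracket (a, b) ^ N * cmod (V (a, b)) \<le> ?B" if "(a, b) \<in> \<Gamma>" for a b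
    proof -
      have a: "norm a \<le> R * norm b" using that by (simp add: \<Gamma>_def)
      have "bracket (a, b) \<le> 1 + norm a + norm b"
        unfolding bracket_def norm_Pair
        by (rule real_le_lsqrt) (auto simp: power2_eq_square algebra_simps)
      also have "\<dots> \<le> (1 + R) * (1 + norm b)"
        using a R by (simp add: algebra_simps)
      finally have br: "bracket (a, b) ^ N \<le> ((1 + R) * (1 + norm b)) ^ N"
        by (intro power_mono) (auto simp: bracket_def)
      have "1 + norm a \<le> (1 + R) * (1 + norm b)"
      proof -
        have "(1 + R) * (1 + norm b) = 1 + R + norm b + R * norm b" by (simp add: algebra_simps)
        then show ?thesis using a R norm_ge_zero[of b] by linarith
      qed
      then have an: "(1 + norm a) ^ m \<le> ((1 + R) * (1 + norm b)) ^ m"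
        by (intro power_mono) auto
      let ?G = "\<Sum>\<beta> | mi_abs \<beta> \<le> m. cmod (g \<beta> b)"
      have G: "0 \<le> ?G" by (simp add: sum_nonneg)
      have "cmod (V (a, b)) \<le> K * (C * ((1 + R) * (1 + norm b)) ^ m * ?G)"
        unfolding V using K C(1) G
        by (intro mult_left_mono order_trans[OF C(2)] mult_right_mono an) auto
      then have "bracket (a, b) ^ N * cmod (V (a, b))
          \<le> ((1 + R) * (1 + norm b)) ^ N * (K * (C * ((1 + R) * (1 + norm b)) ^ m * ?G))"
        using R by (intro mult_mono br) auto
      also have "\<dots> = (1 + R) ^ (N + m) * (K * C) * ((1 + norm b) ^ (N + m) * ?G)"
        by (simp add: power_mult_distrib power_add mult_ac)
      also have "(1 + norm b) ^ (N + m) * ?G = (\<Sum>\<beta> | mi_abs \<beta> \<le> m. (1 + norm b) ^ (N + m) * cmod (g \<beta> b))"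
        by (rule sum_distrib_left)
      also have "(1 + R) ^ (N + m) * (K * C) * \<dots> \<le> ?B"
        using R K C(1) D by (intro mult_left_mono sum_mono) auto
      finally show ?thesis .
    qed
    then show ?thesis by (intro bdd_aboveI[where M = ?B]) auto
  qed
  ultimately show "rapid_near V (a0, b0)"
    unfolding rapid_near_def by blast
next
  assume "rapid_near V (a0, b0)"
  then obtain \<Gamma> where \<Gamma>: "open \<Gamma>" "positive_conic \<Gamma>" "0 \<notin> \<Gamma>" "(a0, b0) \<in> \<Gamma>"
    and bd: "\<And>N::nat. bdd_above ((\<lambda>z. bracket z ^ N * cmod (V z)) ` \<Gamma>)"
    unfolding rapid_near_def by blast
  show "b0 \<noteq> 0"
  proof
    assume b0: "b0 = 0"
    obtain A B where "open A" "open B" "(a0, b0) \<in> A \<times> B" "A \<times> B \<subseteq> \<Gamma>"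
      by (rule open_prod_elim[OF \<Gamma>(1,4)])
    then have AB: "open A" "open B" "a0 \<in> A" "0 \<in> B" "A \<times> B \<subseteq> \<Gamma>"
      by (simp_all add: b0)
    obtain b \<alpha>0 where b: "g (\<lambda>_. 0) b \<noteq> 0" and \<alpha>0: "mi_abs \<alpha>0 \<le> m" "c \<alpha>0 \<noteq> 0"
      using g0 c by blast
    obtain a \<epsilon> where a: "a \<in> A" "\<epsilon> > 0"
      and low: "\<forall>\<^sub>F l in at_top. \<epsilon> \<le> cmod (shifted_polynomial m c g (l *\<^sub>R a) b)"
      using shifted_polynomial_lower_bound[where g = g and c = c and m = m and b = b and A = A, OF \<alpha>0 b AB(1,3)] by metis
    \<comment> \<open>The point (a, 0) lies in \<Gamma>, which omits the origin. This makes the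
      bracket grow linearly along the ray.\<close>
    have a_nz: "a \<noteq> 0"
      using a(1) AB(4,5) \<Gamma>(3) by (auto simp: zero_prod_def)
    \<comment> \<open>The points (a, b / l) are in A \<times> B for large l; conicity then puts
      their l-fold multiples (l a, b) into \<Gamma>.\<close>
    have "((\<lambda>l::real. (1 / l) *\<^sub>R b) \<longlongrightarrow> 0 *\<^sub>R b) at_top"
      by (intro tendsto_scaleR tendsto_divide_0[OF tendsto_const] filterlim_at_top_imp_at_infinity
          filterlim_ident tendsto_const)
    then have inB: "\<forall>\<^sub>F l::real in at_top. (1 / l) *\<^sub>R b \<in> B"
      using AB(2,4) by (intro topological_tendstoD) auto
    \<comment> \<open>The exponent 1 already gives a contradiction: the bracket is unbounded while
      |V| stays above K \<epsilon>.\<close>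
    obtain M where M: "\<And>z. z \<in> \<Gamma> \<Longrightarrow> bracket z ^ 1 * cmod (V z) \<le> M"
      using bd[of 1] by (auto simp: bdd_above_def)
    have "\<forall>\<^sub>F l::real in at_top. l * (norm a * (K * \<epsilon>)) \<le> M"
      using low inB eventually_gt_at_top[of 0]
    proof eventually_elim
      case (elim l)
      then have "(a, (1 / l) *\<^sub>R b) \<in> \<Gamma>" using a(1) AB(5) by blast
      then have "l *\<^sub>R (a, (1 / l) *\<^sub>R b) \<in> \<Gamma>"
        using \<Gamma>(2) elim(3) unfolding positive_conic_def by blast
      then have in_\<Gamma>: "(l *\<^sub>R a, b) \<in> \<Gamma>" using elim(3) by simp
      have "l * norm a \<le> bracket (l *\<^sub>R a, b)"
        unfolding bracket_def norm_Pair
        by (rule real_le_rsqrt) (use elim(3) in \<open>simp add: power_mult_distrib\<close>)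
      moreover have "K * \<epsilon> \<le> cmod (V (l *\<^sub>R a, b))"
        unfolding V using elim(1) K by (intro mult_left_mono) auto
      ultimately have "(l * norm a) * (K * \<epsilon>) \<le> bracket (l *\<^sub>R a, b) * cmod (V (l *\<^sub>R a, b))"
        using K a(2) by (intro mult_mono) (auto simp: bracket_def)
      with M[OF in_\<Gamma>] show ?case by (simp add: mult.assoc)
    qed
    moreover have "norm a * (K * \<epsilon>) > 0" using a_nz K a(2) by simp
    then have "\<forall>\<^sub>F l::real in at_top. M < l * (norm a * (K * \<epsilon>))"
      using eventually_gt_at_top[of "M / (norm a * (K * \<epsilon>))"]
      by (auto simp: pos_divide_less_eq elim: eventually_mono)
    ultimately have "\<forall>\<^sub>F l::real in at_top. False"
      by eventually_elim linarith
    then show False by simp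
  qed
qed

text \<open>For nonzero b0 the neighbourhood only has to bound \<open>a\<close> and keep one
  coordinate of \<open>b\<close> away from 0: after dilation the polynomial costs at most a constant
  times exp(m l), and each \<open>g \<beta>\<close> beats every exp(-\<rho> l).\<close>

lemma rapid_near_ts_iff:
  fixes \<sigma> \<tau> :: real
  assumes decay: "\<And>\<beta> i. mi_abs \<beta> \<le> m \<Longrightarrow> \<exists>b\<in>gs_sequences \<tau>. \<forall>k z. \<bar>z $ i\<bar> ^ k * cmod (g \<beta> z) \<le> b k"
    and pos: "\<sigma> > 0" "\<tau> > 0" and ab: "(a0, b0) \<noteq> 0"
  shows "rapid_near_ts \<sigma> \<tau> V (a0, b0) \<longleftrightarrow> b0 \<noteq> 0"
proof
  assume "b0 \<noteq> 0"
  then obtain i where i: "b0 $ i \<noteq> 0" by (auto simp: vec_eq_iff)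
  \<comment> \<open>Half of the nonzero coordinate, so that |b_i| > \<delta> is an open condition at
    b0; dilated by l^\<tau> it is the threshold of \<open>exponential_decay\<close>.\<close>
  define \<delta> where "\<delta> = \<bar>b0 $ i\<bar> / 2"
  have \<delta>: "\<delta> > 0" using i by (simp add: \<delta>_def)
  define R where "R = norm a0 + 1"
  have R: "R > 0" by (simp add: R_def add_nonneg_pos)
  define U where "U = {z :: (real^'n) \<times> (real^'n). norm (fst z) < R} \<inter> {z. \<delta> < \<bar>snd z $ i\<bar>}"
  obtain C where C: "C \<ge> 0" "\<And>a b. cmod (shifted_polynomial m c g a b)
      \<le> C * (1 + norm a) ^ m * (\<Sum>\<beta> | mi_abs \<beta> \<le> m. cmod (g \<beta> b))"
    using shifted_polynomial_bound by blast
  have "open U"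
    unfolding U_def by (intro open_Int open_Collect_less continuous_intros)
  moreover have "0 \<notin> U" using \<delta> by (simp add: U_def)
  moreover have "(a0, b0) \<in> U" using i by (simp add: U_def R_def \<delta>_def)
  moreover have "bdd_above ((\<lambda>(l, x, \<xi>). exp (r * l) * cmod (V (l powr \<sigma> *\<^sub>R x, l powr \<tau> *\<^sub>R \<xi>)))
      ` ({0<..} \<times> U))" if r: "r > 0" for r
  proof -
    \<comment> \<open>The part \<open>r\<close> offsets the weight exp(r l), the part
      \<open>m\<close> the growth of the dilated polynomial.\<close>
    let ?\<rho> = "r + real m"
    have "\<forall>\<beta>\<in>{\<beta>. mi_abs \<beta> \<le> m}. \<exists>D\<ge>0. \<forall>l>0. \<forall>z. \<delta> * l powr \<tau> \<le> \<bar>z $ i\<bar> \<longrightarrow> cmod (g \<beta> z) \<le> D * exp (- ?\<rho> * l)"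
    proof
      fix \<beta> :: "'n mindex" assume "\<beta> \<in> {\<beta>. mi_abs \<beta> \<le> m}"
      then obtain b where b: "b \<in> gs_sequences \<tau>" "\<And>k z. \<bar>z $ i\<bar> ^ k * cmod (g \<beta> z) \<le> b k"
        using decay[of \<beta> i] by blast
      show "\<exists>D\<ge>0. \<forall>l>0. \<forall>z. \<delta> * l powr \<tau> \<le> \<bar>z $ i\<bar> \<longrightarrow> cmod (g \<beta> z) \<le> D * exp (- ?\<rho> * l)"
        using r by (intro exponential_decay[OF b pos(2) \<delta>]) auto
    qed
    then obtain D where D: "\<And>\<beta> l z. mi_abs \<beta> \<le> m \<Longrightarrow> l > 0 \<Longrightarrow> \<delta> * l powr \<tau> \<le> \<bar>z $ i\<bar>
        \<Longrightarrow> cmod (g \<beta> z) \<le> D \<beta> * exp (- ?\<rho> * l)"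
      by (auto simp: bchoice_iff)
    let ?E = "1 + \<sigma> powr \<sigma> * R"
    let ?B = "K * C * ?E ^ m * (\<Sum>\<beta> | mi_abs \<beta> \<le> m. D \<beta>)"
    have "exp (r * l) * cmod (V (l powr \<sigma> *\<^sub>R a, l powr \<tau> *\<^sub>R b)) \<le> ?B"
      if l: "l > 0" and ab: "(a, b) \<in> U" for l a b
    proof -
      have a: "norm a \<le> R" and b: "\<delta> \<le> \<bar>b $ i\<bar>" using ab by (auto simp: U_def)
      have "norm (l powr \<sigma> *\<^sub>R a) \<le> (\<sigma> powr \<sigma> * exp l) * R"
        using powr_le_exp[OF l pos(1)] a by (auto intro: mult_mono)
      moreover have "1 \<le> exp l" using l by simp
      moreover have "?E * exp l = exp l + \<sigma> powr \<sigma> * exp l * R" by (simp add: algebra_simps)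
      ultimately have "1 + norm (l powr \<sigma> *\<^sub>R a) \<le> ?E * exp l"
        by linarith
      then have "(1 + norm (l powr \<sigma> *\<^sub>R a)) ^ m \<le> (?E * exp l) ^ m"
        by (intro power_mono) auto
      then have an: "(1 + norm (l powr \<sigma> *\<^sub>R a)) ^ m \<le> ?E ^ m * exp (real m * l)"
        by (simp add: power_mult_distrib exp_of_nat_mult)
      have "\<delta> * l powr \<tau> \<le> \<bar>(l powr \<tau> *\<^sub>R b) $ i\<bar>"
        using mult_right_mono[OF b, of "l powr \<tau>"] by (simp add: abs_mult mult.commute)
      then have "(\<Sum>\<beta> | mi_abs \<beta> \<le> m. cmod (g \<beta> (l powr \<tau> *\<^sub>R b))) \<le> (\<Sum>\<beta> | mi_abs \<beta> \<le> m. D \<beta> * exp (- ?\<rho> * l))"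
        using D l by (intro sum_mono) auto
      also have "\<dots> = (\<Sum>\<beta> | mi_abs \<beta> \<le> m. D \<beta>) * exp (- ?\<rho> * l)"
        by (rule sum_distrib_right[symmetric])
      finally have gn: "(\<Sum>\<beta> | mi_abs \<beta> \<le> m. cmod (g \<beta> (l powr \<tau> *\<^sub>R b))) \<le> (\<Sum>\<beta> | mi_abs \<beta> \<le> m. D \<beta>) * exp (- ?\<rho> * l)" .
      have "cmod (V (l powr \<sigma> *\<^sub>R a, l powr \<tau> *\<^sub>R b))
          \<le> K * (C * (1 + norm (l powr \<sigma> *\<^sub>R a)) ^ m * (\<Sum>\<beta> | mi_abs \<beta> \<le> m. cmod (g \<beta> (l powr \<tau> *\<^sub>R b))))"
        unfolding V using K by (intro mult_left_mono C(2)) auto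
      also have "\<dots> \<le> K * (C * (?E ^ m * exp (real m * l)) * ((\<Sum>\<beta> | mi_abs \<beta> \<le> m. D \<beta>) * exp (- ?\<rho> * l)))"
        using K C(1) R by (intro mult_left_mono mult_mono an gn) (auto intro!: sum_nonneg)
      also have "\<dots> = ?B * (exp (real m * l) * exp (- ?\<rho> * l))"
        by (simp add: mult_ac)
      also have "exp (real m * l) * exp (- ?\<rho> * l) = exp (- (r * l))"
        by (simp add: exp_add[symmetric] algebra_simps)
      finally have "exp (r * l) * cmod (V (l powr \<sigma> *\<^sub>R a, l powr \<tau> *\<^sub>R b)) \<le> exp (r * l) * (?B * exp (- (r * l)))"
        by (rule mult_left_mono) simp
      also have "\<dots> = ?B" by (simp add: exp_minus)
      finally show ?thesis .
    qed
    then show ?thesis by (intro bdd_aboveI[where M = ?B]) auto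
  qed
  ultimately show "rapid_near_ts \<sigma> \<tau> V (a0, b0)"
    unfolding rapid_near_ts_def by blast
next
  assume "rapid_near_ts \<sigma> \<tau> V (a0, b0)"
  then obtain U where U: "open U" "0 \<notin> U" "(a0, b0) \<in> U"
    and bd: "\<And>r. r > 0 \<Longrightarrow> bdd_above
      ((\<lambda>(l, x, \<xi>). exp (r * l) * cmod (V (l powr \<sigma> *\<^sub>R x, l powr \<tau> *\<^sub>R \<xi>))) ` ({0<..} \<times> U))"
    unfolding rapid_near_ts_def by blast
  show "b0 \<noteq> 0"
  proof
    assume b0: "b0 = 0"
    obtain A B where "open A" "open B" "(a0, b0) \<in> A \<times> B" "A \<times> B \<subseteq> U"
      by (rule open_prod_elim[OF U(1,3)])
    then have AB: "open A" "open B" "a0 \<in> A" "0 \<in> B" "A \<times> B \<subseteq> U"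
      by (simp_all add: b0)
    obtain b \<alpha>0 where b: "g (\<lambda>_. 0) b \<noteq> 0" and \<alpha>0: "mi_abs \<alpha>0 \<le> m" "c \<alpha>0 \<noteq> 0"
      using g0 c by blast
    obtain a \<epsilon> where a: "a \<in> A" "\<epsilon> > 0"
      and low: "\<forall>\<^sub>F l in at_top. \<epsilon> \<le> cmod (shifted_polynomial m c g (l *\<^sub>R a) b)"
      using shifted_polynomial_lower_bound[where g = g and c = c and m = m and b = b and A = A, OF \<alpha>0 b AB(1,3)] by metis
    have low': "\<forall>\<^sub>F l in at_top. \<epsilon> \<le> cmod (shifted_polynomial m c g (l powr \<sigma> *\<^sub>R a) b)"
    proof (rule eventually_compose_filterlim[OF low])
      show "filterlim (\<lambda>l::real. l powr \<sigma>) at_top at_top" using pos(1) by real_asymp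
    qed
    \<comment> \<open>The point (a, l^(-\<tau>) b) enters A \<times> B for large l and is dilated
      exactly to (l^\<sigma> a, b).\<close>
    have "((\<lambda>l::real. l powr - \<tau> *\<^sub>R b) \<longlongrightarrow> 0 *\<^sub>R b) at_top"
      using pos by (intro tendsto_scaleR tendsto_neg_powr filterlim_ident tendsto_const) auto
    then have inB: "\<forall>\<^sub>F l::real in at_top. l powr - \<tau> *\<^sub>R b \<in> B"
      using AB(2,4) by (intro topological_tendstoD) auto
    obtain M where M: "\<And>l x \<xi>. l > 0 \<Longrightarrow> (x, \<xi>) \<in> U \<Longrightarrow>
        exp (1 * l) * cmod (V (l powr \<sigma> *\<^sub>R x, l powr \<tau> *\<^sub>R \<xi>)) \<le> M"
      using bd[of 1] unfolding bdd_above_def by fastforce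
    have "\<forall>\<^sub>F l::real in at_top. l * (K * \<epsilon>) \<le> M"
      using low' inB eventually_gt_at_top[of 0]
    proof eventually_elim
      case (elim l)
      then have "(a, l powr - \<tau> *\<^sub>R b) \<in> U" using a(1) AB(5) by blast
      from M[OF elim(3) this] have "exp l * cmod (V (l powr \<sigma> *\<^sub>R a, b)) \<le> M"
        using elim(3) by (simp add: powr_add[symmetric])
      moreover have "K * \<epsilon> \<le> cmod (V (l powr \<sigma> *\<^sub>R a, b))"
        unfolding V using elim(1) K by (intro mult_left_mono) auto
      then have "l * (K * \<epsilon>) \<le> exp l * cmod (V (l powr \<sigma> *\<^sub>R a, b))"
        using K a(2) elim(3) exp_gt_self[of l] by (intro mult_mono) auto
      ultimately show ?case by linarith
    qed
    moreover have "K * \<epsilon> > 0" using K a(2) by simp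
    then have "\<forall>\<^sub>F l::real in at_top. M < l * (K * \<epsilon>)"
      using eventually_gt_at_top[of "M / (K * \<epsilon>)"]
      by (auto simp: pos_divide_less_eq elim: eventually_mono)
    ultimately have "\<forall>\<^sub>F l::real in at_top. False"
      by eventually_elim linarith
    then show False by simp
  qed
qed

end

section \<open>Short-time Fourier transforms\<close>

lemma foldr_pd_translation:
  "foldr (\<lambda>i. pd i ^^ a i) is (translation x f) = translation x (foldr (\<lambda>i. pd i ^^ a i) is f)"
  by (induction "is") (auto simp: pd_funpow_translation)

lemma Dop_translation: "Dop \<beta> (translation x f) y = Dop \<beta> f (y - x)"
  by (simp add: Dop_def partial_def foldr_pd_translation) (simp add: translation_def)

text \<open>At the origin the character is 1 and the translated window is evaluated at -x. The
  Leibniz coefficients are real, so conjugation only reaches the window.\<close>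

lemma cmod_stft_dirac_combination:
  fixes \<psi> :: "real^'n::finite \<Rightarrow> complex"
  assumes "smooth \<psi>"
  shows "cmod (stft \<psi> (\<lambda>\<phi>. \<Sum>\<alpha> | mi_abs \<alpha> \<le> m. c \<alpha> * dist_D \<alpha> dirac0 \<phi>) (x, \<xi>))
    = (2 * pi) powr (- real CARD('n) / 2)
      * cmod (shifted_polynomial m c (\<lambda>\<beta> x. cnj (Dop \<beta> \<psi> (- x))) \<xi> x)"
proof -
  have "dist_D \<alpha> dirac0 (modulation \<xi> (translation x \<psi>))
      = (\<Sum>\<beta>\<in>{..\<alpha>}. of_real (mi_binom \<alpha> \<beta> * monomial (\<alpha> - \<beta>) \<xi>) * cnj (Dop \<beta> \<psi> (- x)))" for \<alpha>
    using Dop_character_mult[OF smooth_translation[OF assms], of \<alpha> \<xi> x 0]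
    by (simp add: dist_D_def dirac0_def modulation_def[abs_def] Dop_translation)
  then show ?thesis
    by (simp add: stft_def shifted_polynomial_def norm_mult)
qed

text \<open>The substitution y \<mapsto> y + x moves the translation from the window to the
  polynomial, and the character splits off a unimodular factor depending on x and \<xi>
  only.\<close>

lemma cmod_stft_polynomial:
  fixes \<psi> :: "real^'n::finite \<Rightarrow> complex"
  assumes \<psi>: "\<psi> \<in> schwartz_space"
    and p: "p = (\<lambda>x. \<Sum>\<alpha> | mi_abs \<alpha> \<le> m. c \<alpha> * of_real (monomial \<alpha> x))"
  shows "cmod (stft \<psi> (dist_of_fun p) (x, \<xi>)) = (2 * pi) powr (- real CARD('n) / 2)
    * cmod (shifted_polynomial m c (\<lambda>\<beta>. fourier (\<lambda>y. of_real (monomial \<beta> y) * cnj (\<psi> y))) x \<xi>)"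
proof -
  have [measurable]: "\<psi> \<in> borel_measurable borel"
    using \<psi> by (intro smooth_borel_measurable schwartz_smooth)
  have [measurable]: "cnj \<in> borel_measurable borel"
    by (intro borel_measurable_continuous_onI continuous_on_cnj continuous_on_id)
  have [measurable]: "p \<in> borel_measurable borel"
    unfolding p by measurable
  let ?F = "\<lambda>y. p y * cnj (modulation \<xi> (translation x \<psi>) y)"
  let ?h = "\<lambda>\<beta> y. character (- \<xi>) y * (of_real (monomial \<beta> y) * cnj (\<psi> y))"
  have i: "integrable lborel (?h \<beta>)" for \<beta>
  proof (rule integrable_character_mult)
    show "integrable lborel (\<lambda>y. of_real (monomial \<beta> y) * cnj (\<psi> y))"
      using integrable_cnj[OF integrable_monomial_schwartz(1)[OF \<psi>, of \<beta>]] by simp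
  qed
  have eq: "?F (y + x) = character (- \<xi>) x * (\<Sum>\<alpha> | mi_abs \<alpha> \<le> m. c \<alpha> *
      (\<Sum>\<beta>\<in>{..\<alpha>}. of_real (mi_binom \<alpha> \<beta> * monomial (\<alpha> - \<beta>) x) * ?h \<beta> y))" for y
  proof -
    have "cnj (modulation \<xi> (translation x \<psi>) (y + x)) = character (- \<xi>) x * (character (- \<xi>) y * cnj (\<psi> y))"
      by (simp add: modulation_def translation_def exp_cnj inner_add_left exp_add[symmetric] algebra_simps)
    moreover have "p (y + x) = (\<Sum>\<alpha> | mi_abs \<alpha> \<le> m. c \<alpha> *
        (\<Sum>\<beta>\<in>{..\<alpha>}. of_real (mi_binom \<alpha> \<beta> * monomial (\<alpha> - \<beta>) x) * of_real (monomial \<beta> y)))"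
      by (simp add: p monomial_translate)
    ultimately show ?thesis
      by (simp only: sum_distrib_left sum_distrib_right mult_ac)
  qed
  have "dist_of_fun p (modulation \<xi> (translation x \<psi>)) = (LINT y|lborel. ?F (y + x))"
    unfolding dist_of_fun_def
    by (rule lborel_integral_translation[symmetric], unfold modulation_def translation_def) measurable
  also have "\<dots> = character (- \<xi>) x *
      shifted_polynomial m c (\<lambda>\<beta>. fourier (\<lambda>y. of_real (monomial \<beta> y) * cnj (\<psi> y))) x \<xi>"
    unfolding eq shifted_polynomial_def fourier_def
    by (subst integral_mult_right_zero, subst Bochner_Integration.integral_sum,
        (intro integrable_mult_right Bochner_Integration.integrable_sum i)[1],
        subst integral_mult_right_zero, subst Bochner_Integration.integral_sum,
        (intro integrable_mult_right i)[1], subst integral_mult_right_zero) (rule refl)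
  finally show ?thesis
    by (simp only: stft_def case_prod_conv norm_mult cmod_character mult_1 norm_of_real) simp
qed

lemma continuous_schwartz: "f \<in> schwartz_space \<Longrightarrow> continuous_on UNIV f"
  by (intro smooth_continuous schwartz_smooth)

lemma fourier_cnj_nonzero:
  fixes \<psi> :: "real^'n::finite \<Rightarrow> complex"
  assumes \<psi>: "\<psi> \<in> schwartz_space" "\<psi> \<noteq> (\<lambda>_. 0)"
  shows "\<exists>\<xi>. fourier (\<lambda>y. of_real (monomial (\<lambda>_. 0) y) * cnj (\<psi> y)) \<xi> \<noteq> 0"
proof (rule ccontr)
  assume "\<not> ?thesis"
  moreover have "integrable lborel (\<lambda>y. cnj (\<psi> y))"
    using integrable_cnj[OF integrable_monomial_schwartz(1)[OF \<psi>(1), of "\<lambda>_. 0"]] by simp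
  ultimately have "fourier_null (\<lambda>y. cnj (\<psi> y))"
    by (simp add: fourier_null_def)
  moreover have "cmod (cnj (\<psi> y)) \<le> schwartz_seminorm (\<lambda>_. 0) (\<lambda>_. 0) \<psi>" for y
    using schwartz_seminorm_upper[OF \<psi>(1), of "\<lambda>_. 0" y "\<lambda>_. 0"] by simp
  moreover have "continuous_on UNIV (\<lambda>y. cnj (\<psi> y))"
    by (intro continuous_on_cnj continuous_schwartz \<psi>)
  ultimately have "cnj (\<psi> a) = 0" for a
    using fourier_null_imp_0 by blast
  with \<psi>(2) show False by auto
qed

theorem proposition7p2:
  fixes s t :: real and m :: nat
    and c :: "('n::finite \<Rightarrow> nat) \<Rightarrow> complex"
    and p :: "real ^ 'n \<Rightarrow> complex"
    and u :: "(real ^ 'n \<Rightarrow> complex) \<Rightarrow> complex"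
  assumes "s > 0" and "t > 0" and "s + t > 1"
    and "m \<noteq> 0"
    and p_def: "p = (\<lambda>x. \<Sum>\<alpha> | mi_abs \<alpha> \<le> m. c \<alpha> * of_real (monomial \<alpha> x))"
    and p_nonzero: "\<exists>\<alpha>. mi_abs \<alpha> \<le> m \<and> c \<alpha> \<noteq> 0"
    and u_def: "u = (\<lambda>\<phi>. \<Sum>\<alpha> | mi_abs \<alpha> \<le> m. c \<alpha> * dist_D \<alpha> dirac0 \<phi>)"
  shows "u \<in> tempered_distributions \<inter> gs_dual t s
    \<and> dist_of_fun p \<in> tempered_distributions \<inter> gs_dual t s
    \<and> (\<forall>\<phi> \<in> schwartz_space - {\<lambda>_. 0}.
          WF_g \<phi> u = {0} \<times> (UNIV - {0}) \<and>
          WF_g \<phi> (dist_of_fun p) = (UNIV - {0}) \<times> {0})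
    \<and> (\<forall>\<psi> \<in> gs_space t s - {\<lambda>_. 0}.
          WF_ts t s \<psi> u = {0} \<times> (UNIV - {0}) \<and>
          WF_ts t s \<psi> (dist_of_fun p) = (UNIV - {0}) \<times> {0})"
proof (intro conjI ballI)
  show "u \<in> tempered_distributions \<inter> gs_dual t s"
    unfolding u_def by (rule dirac_combination_in_duals)
  show "dist_of_fun p \<in> tempered_distributions \<inter> gs_dual t s"
    using p_def by (rule dist_of_polynomial_in_duals)
  let ?K = "(2 * pi) powr (- real CARD('n) / 2)"
  have K: "?K > 0" by simp
  let ?gu = "\<lambda>\<psi> \<beta> x. cnj (Dop \<beta> \<psi> (- x))"
  let ?gp = "\<lambda>\<psi> \<beta>. fourier (\<lambda>y. of_real (monomial \<beta> y) * cnj (\<psi> y))"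
  \<comment> \<open>The swap makes the frequency the first variable, which is where the polynomial
    of \<open>u\<close> lives.\<close>
  have Vu: "cmod ((stft \<psi> u \<circ> prod.swap) (a, b)) = ?K * cmod (shifted_polynomial m c (?gu \<psi>) a b)"
    if "\<psi> \<in> schwartz_space" for \<psi> a b
    unfolding u_def using cmod_stft_dirac_combination[OF schwartz_smooth[OF that]] by simp
  have Vp: "cmod (stft \<psi> (dist_of_fun p) (a, b)) = ?K * cmod (shifted_polynomial m c (?gp \<psi>) a b)"
    if "\<psi> \<in> schwartz_space" for \<psi> a b
    by (rule cmod_stft_polynomial[OF that p_def])
  have u0: "\<exists>x. ?gu \<psi> (\<lambda>_. 0) x \<noteq> 0" if nz: "\<psi> \<noteq> (\<lambda>_. 0)" for \<psi> :: "real^'n \<Rightarrow> complex"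
  proof -
    obtain x where "\<psi> x \<noteq> 0" using nz by blast
    then show ?thesis by (intro exI[of _ "- x"]) simp
  qed
  \<comment> \<open>Decay in position is read off the seminorms of the window itself; the reflection
    in \<open>?gu\<close> disappears in the modulus.\<close>
  have du: "\<bar>z $ i\<bar> ^ k * cmod (?gu \<psi> \<beta> z) \<le> schwartz_seminorm (\<lambda>j. if j = i then k else 0) \<beta> \<psi>"
    if "\<psi> \<in> schwartz_space" for \<psi> \<beta> i k z
    using schwartz_seminorm_upper[OF that, of "\<lambda>j. if j = i then k else 0" "- z" \<beta>]
    by (simp add: monomial_single norm_mult norm_power)
  {
    fix \<phi> :: "real^'n \<Rightarrow> complex"
    assume "\<phi> \<in> schwartz_space - {\<lambda>_. 0}"
    then have \<phi>: "\<phi> \<in> schwartz_space" "\<phi> \<noteq> (\<lambda>_. 0)" by auto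
    have "rapid_near (stft \<phi> u \<circ> prod.swap) (a, b) \<longleftrightarrow> b \<noteq> 0" if "(a, b) \<noteq> 0" for a b
      by (rule rapid_near_iff[OF Vu[OF \<phi>(1)] K p_nonzero u0[OF \<phi>(2)] _ that])
         (rule exI, intro allI, rule du[OF \<phi>(1)])
    then have "rapid_near (stft \<phi> u) (b, a) \<longleftrightarrow> b \<noteq> 0" if "(b, a) \<noteq> 0" for a b
      using rapid_near_swap[of "stft \<phi> u" "(b, a)"] rapid_near_swap[of "stft \<phi> u \<circ> prod.swap" "(a, b)"] that
      by (auto simp: zero_prod_def o_assoc[symmetric] swap_comp_swap)
    then show "WF_g \<phi> u = {0} \<times> (UNIV - {0})"
      unfolding WF_g_eq by (auto simp: zero_prod_def)
    \<comment> \<open>Any sequence of bounds is admissible here, since \<open>WF_g\<close> asks for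
      decay of every polynomial order without uniformity in the order.\<close>
    interpret growth_class UNIV by (rule growth_class_UNIV)
    have "rapid_near (stft \<phi> (dist_of_fun p)) (a, b) \<longleftrightarrow> b \<noteq> 0" if "(a, b) \<noteq> 0" for a b
    proof (rule rapid_near_iff[OF Vp[OF \<phi>(1)] K p_nonzero fourier_cnj_nonzero[OF \<phi>] _ that])
      show "\<exists>b. \<forall>k z. \<bar>z $ i\<bar> ^ k * cmod (?gp \<phi> \<beta> z) \<le> b k" for \<beta> i
        using controlled_fourier_decay[OF controlled_monomial_mult[OF controlled_cnj_schwartz[OF \<phi>(1)]]]
        by blast
    qed
    then show "WF_g \<phi> (dist_of_fun p) = (UNIV - {0}) \<times> {0}"
      unfolding WF_g_eq by (auto simp: zero_prod_def)
  }
  {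
    fix \<psi> :: "real^'n \<Rightarrow> complex"
    assume "\<psi> \<in> gs_space t s - {\<lambda>_. 0}"
    then have gs: "\<psi> \<in> gs_space t s" and \<psi>: "\<psi> \<in> schwartz_space" "\<psi> \<noteq> (\<lambda>_. 0)"
      using gs_space_subset_schwartz_space by auto
    \<comment> \<open>After the swap the decaying variable is the position, dilated with exponent
      \<open>t\<close>, the exponent that also governs the powers of x on the window.\<close>
    have "rapid_near_ts s t (stft \<psi> u \<circ> prod.swap) (a, b) \<longleftrightarrow> b \<noteq> 0" if "(a, b) \<noteq> 0" for a b
      by (rule rapid_near_ts_iff[OF Vu[OF \<psi>(1)] K p_nonzero u0[OF \<psi>(2)] _ \<open>s > 0\<close> \<open>t > 0\<close> that])
         (rule bexI[OF _ gs_seminorms_in_gs_sequences(2)[OF gs]], intro allI, rule du[OF \<psi>(1)])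
    then have "rapid_near_ts t s (stft \<psi> u) (b, a) \<longleftrightarrow> b \<noteq> 0" if "(b, a) \<noteq> 0" for a b
      using rapid_near_ts_swap[of t s "stft \<psi> u" "(b, a)"]
        rapid_near_ts_swap[of s t "stft \<psi> u \<circ> prod.swap" "(a, b)"] that
      by (auto simp: zero_prod_def o_assoc[symmetric] swap_comp_swap)
    then show "WF_ts t s \<psi> u = {0} \<times> (UNIV - {0})"
      unfolding WF_ts_eq by (auto simp: zero_prod_def)
    interpret growth_class "gs_sequences s" by (rule growth_class_gs_sequences[OF \<open>s > 0\<close>])
    \<comment> \<open>Here the decaying variable is the frequency, dilated with exponent
      \<open>s\<close>, which is the growth exponent of the window's derivatives.\<close>
    have "rapid_near_ts t s (stft \<psi> (dist_of_fun p)) (a, b) \<longleftrightarrow> b \<noteq> 0" if "(a, b) \<noteq> 0" for a b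
      by (rule rapid_near_ts_iff[OF Vp[OF \<psi>(1)] K p_nonzero fourier_cnj_nonzero[OF \<psi>] _ \<open>t > 0\<close> \<open>s > 0\<close> that])
         (rule controlled_fourier_decay[OF controlled_monomial_mult[OF controlled_cnj_schwartz[OF \<psi>(1)
            gs_seminorms_in_gs_sequences(1)[OF gs]]]])
    then show "WF_ts t s \<psi> (dist_of_fun p) = (UNIV - {0}) \<times> {0}"
      unfolding WF_ts_eq by (auto simp: zero_prod_def)
  }
qed

end
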